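(* Let $d\ge 1$, let $C\subset\mathbb{R}^d$ be an open convex cone, and let $K\subset\mathbb{R}^d$ be a bounded open convex set, symmetric with respect to the origin $\theta$, with $\theta\in\operatorname{int}K$. Let $p\in(d,\infty]$ and $p'=p/(p-1)$. (i) If $h>0$ and $f\in W^{1,p}(C)\cap L_{\rfloor\cdot\lceil_h}(C)$, then $f\in L_\infty(C)$ and $$\|f\|_{L_\infty(C)}\le \left\|g_h(|\cdot|_K)\right\|_{L_{p'}(hK\cap C)}\,\big\||\nabla f|_{K^\circ}\big\|_{L_p(C)}+\mu^{-1}(K\cap C)\,h^{-d}\,\rfloor f\lceil_h.$$ This inequality is sharp: it becomes an equality for the function $$f_{e,h}(y)=\begin{cases}\displaystyle\int_{|y|_K}^{h}g_h^{p'-1}(u)\,du, & y\in hK\cap C,\\ 0, & y\in C\setminus hK.\end{cases}$$ (ii) For each $f\in W^{1,p}(C)\cap L_{\rfloor\cdot\lceil}(C)$ the following multiplicative inequality holds: $$\|f\|_{L_\infty(C)}\le a(d,p)\,\mu^{-\frac{\alpha}{d}}(K\cap C)\,\rfloor f\lceil^{1-\alpha}\,\big\||\nabla f|_{K^\circ}\big\|_{L_p(C)}^{\alpha},$$ where $$\alpha=\frac{pd}{p+(p-1)d},\qquad a(d,p)=\left(\frac{(p-d)A(d,p)}{pd}\right)^{\alpha}\left(\frac{pd}{p-d}+1\right),$$ $$A(d,p)=d^{-1}B^{\frac1{p'}}\left(1-\frac{(d-1)p'}{d},\,p'+1\right).$$ This multiplicative inequality is sharp: it becomes an equality for each function $f_{e,h}$,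 $h>0$. (iii) If $f\in W^{1,p}(C)\cap L_1(C)$, then the quantities $\rfloor f\lceil_h$ and $\rfloor f\lceil$, respectively, can be replaced by $\|f\|_{L_1(C)}$, that is, for every $h>0$, $$\|f\|_{L_\infty(C)}\le \left\|g_h(|\cdot|_K)\right\|_{L_{p'}(hK\cap C)}\,\big\||\nabla f|_{K^\circ}\big\|_{L_p(C)}+\mu^{-1}(K\cap C)\,h^{-d}\,\|f\|_{L_1(C)}$$ and $$\|f\|_{L_\infty(C)}\le a(d,p)\,\mu^{-\frac{\alpha}{d}}(K\cap C)\,\|f\|_{L_1(C)}^{1-\alpha}\,\big\||\nabla f|_{K^\circ}\big\|_{L_p(C)}^{\alpha},$$ and the inequalities so obtained remain sharp.
   Context: $\mu$ is Lebesgue measure on $C$; $B(\cdot,\cdot)$ is the Euler beta function, and $B^{1/p'}(\cdot,\cdot)$ is its value raised to the power $1/p'$; $\mu^{s}(E)$ means $(\mu(E))^{s}$. For $p=\infty$ one has $p'=1$, and the expressions for $\alpha$ and $a(d,p)$ are understood as limits as $p\to\infty$. $(x,y)$ is the dot product in $\mathbb{R}^d$. For $x,z\in\mathbb{R}^d$: $|x|_K=\inf\{\lambda>0: x\in\lambda K\}$ and the dual norm is $|z|_{K^\circ}=\sup\{(x,z): |x|_K\le 1\}$. $L_{\rm loc}(C)$ is the space of functions $f\colon C\to\mathbb{R}$ integrable on each compact subset of $C$. For $f\in L_{\rm loc}(C)$ and $h>0$, $$\rfloor f\lceil_h=\sup_{x\in C}\left|\int_{hK\cap C}f(x+u)\,du\right|,\qquad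 \rfloor f\lceil=\sup_{h>0}\rfloor f\lceil_h .$$ $L_{\rfloor\cdot\lceil_h}(C)$ (respectively $L_{\rfloor\cdot\lceil}(C)$) is the set of $f\in L_{\rm loc}(C)$ with $\rfloor f\lceil_h<\infty$ (respectively $\rfloor f\lceil<\infty$). $\nabla f$ is the gradient of a locally integrable function $f$, with derivatives in the distributional sense. $W^{1,p}(C)$ is the Sobolev space of (locally integrable) functions $f\colon C\to\mathbb{R}$ all of whose first-order distributional derivatives belong to $L_p(C)$. For $h>0$, $g_h\colon(0,h)\to\mathbb{R}$ is the function $$g_h(u)=\frac{1}{d\,\mu(K\cap C)}\left(\frac{1}{u^{d-1}}-\frac{u}{h^d}\right).$$ An inequality is called sharp if there is an admissible function for which it becomes an equality with both sides nonzero. *)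

theory Defs
  imports "HOL-Analysis.Analysis" "HOL-Probability.Essential_Supremum"
begin

text \<open>Functions on a set \<open>S\<close> are total functions whose values outside \<open>S\<close> are ignored;
  \<open>\<mu>\<close> is \<open>lebesgue\<close>.\<close>

subsection \<open>Cones and the norms given by a convex body\<close>

text \<open>The library predicates \<open>cone\<close> and \<open>conic\<close> force the origin into a nonempty cone; an open
  cone other than the whole space does not contain it, so only positive factors are used.\<close>

definition open_convex_cone :: "'a::euclidean_space set \<Rightarrow> bool" where
  "open_convex_cone C \<longleftrightarrow>
     C \<noteq> {} \<and> open C \<and> convex C \<and> (\<forall>x\<in>C. \<forall>t>0. t *\<^sub>R x \<in> C)"

definition body_norm :: "'a::euclidean_space set \<Rightarrow> 'a \<Rightarrow> real" where
  "body_norm K x = Inf {t. t > 0 \<and> x \<in> (*\<^sub>R) t ` K}"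

definition dual_body_norm :: "'a::euclidean_space set \<Rightarrow> 'a \<Rightarrow> real" where
  "dual_body_norm K z = (SUP x\<in>{x. body_norm K x \<le> 1}. x \<bullet> z)"

subsection \<open>Lebesgue spaces\<close>

definition Lp_space :: "ereal \<Rightarrow> 'a::euclidean_space set \<Rightarrow> ('a \<Rightarrow> real) set" where
  "Lp_space p S = {f. f \<in> borel_measurable (lebesgue_on S) \<and>
     (if p = \<infinity> then esssup (lebesgue_on S) (\<lambda>x. ereal \<bar>f x\<bar>) < \<infinity>
      else integrable (lebesgue_on S) (\<lambda>x. \<bar>f x\<bar> powr real_of_ereal p))}"

text \<open>Meaningful only for \<open>f \<in> Lp_space p S\<close>.\<close>

definition Lp_norm :: "ereal \<Rightarrow> 'a::euclidean_space set \<Rightarrow> ('a \<Rightarrow> real) \<Rightarrow> real" where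
  "Lp_norm p S f =
     (if p = \<infinity> then real_of_ereal (esssup (lebesgue_on S) (\<lambda>x. ereal \<bar>f x\<bar>))
      else (LINT x|lebesgue_on S. \<bar>f x\<bar> powr real_of_ereal p) powr (1 / real_of_ereal p))"

definition loc_integrable :: "'a::euclidean_space set \<Rightarrow> ('a \<Rightarrow> real) set" where
  "loc_integrable C = {f. \<forall>Q. compact Q \<and> Q \<subseteq> C \<longrightarrow> f absolutely_integrable_on Q}"

subsection \<open>Distributional derivatives and Sobolev spaces\<close>

text \<open>\<open>C_k k \<phi>\<close>: \<open>\<phi>\<close> is \<open>k\<close> times continuously differentiable on the whole space
  (the partial derivative along \<open>i\<close> is the Frechet derivative applied to \<open>i\<close>).\<close>

primrec C_k :: "nat \<Rightarrow> ('a::euclidean_space \<Rightarrow> real) \<Rightarrow> bool" where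
  "C_k 0 \<phi> \<longleftrightarrow> continuous_on UNIV \<phi>"
| "C_k (Suc k) \<phi> \<longleftrightarrow> (\<forall>x. \<phi> differentiable (at x)) \<and>
     (\<forall>i\<in>Basis. C_k k (\<lambda>x. frechet_derivative \<phi> (at x) i))"

definition test_functions :: "'a::euclidean_space set \<Rightarrow> ('a \<Rightarrow> real) set" where
  "test_functions C = {\<phi>. (\<forall>k. C_k k \<phi>) \<and>
     compact (closure {x. \<phi> x \<noteq> 0}) \<and> closure {x. \<phi> x \<noteq> 0} \<subseteq> C}"

definition weak_partial ::
    "'a::euclidean_space set \<Rightarrow> ('a \<Rightarrow> real) \<Rightarrow> 'a \<Rightarrow> ('a \<Rightarrow> real) \<Rightarrow> bool" where
  "weak_partial C f i g \<longleftrightarrow> g \<in> loc_integrable C \<and>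
     (\<forall>\<phi>\<in>test_functions C.
        (LINT x:C|lebesgue. f x * frechet_derivative \<phi> (at x) i) =
        - (LINT x:C|lebesgue. g x * \<phi> x))"

definition W1p :: "ereal \<Rightarrow> 'a::euclidean_space set \<Rightarrow> ('a \<Rightarrow> real) set" where
  "W1p p C = {f \<in> loc_integrable C. \<forall>i\<in>Basis. \<exists>g\<in>Lp_space p C. weak_partial C f i g}"

text \<open>The weak partial derivatives are determined almost everywhere on \<open>C\<close> only; the choice
  of representative does not affect integrals and essential suprema.\<close>

definition weak_gradient :: "'a::euclidean_space set \<Rightarrow> ('a \<Rightarrow> real) \<Rightarrow> 'a \<Rightarrow> 'a" where
  "weak_gradient C f x = (\<Sum>i\<in>Basis. (SOME g. weak_partial C f i g) x *\<^sub>R i)"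

subsection \<open>The averaged seminorms\<close>

text \<open>\<open>avg_norm_h C K h f\<close> and \<open>avg_norm C K f\<close> take values in \<open>[0, \<infinity>]\<close>.\<close>

definition avg_norm_h ::
    "'a::euclidean_space set \<Rightarrow> 'a set \<Rightarrow> real \<Rightarrow> ('a \<Rightarrow> real) \<Rightarrow> ereal" where
  "avg_norm_h C K h f =
     (SUP x\<in>C. ereal \<bar>LINT u:((*\<^sub>R) h ` K \<inter> C)|lebesgue. f (x + u)\<bar>)"

definition avg_norm ::
    "'a::euclidean_space set \<Rightarrow> 'a set \<Rightarrow> ('a \<Rightarrow> real) \<Rightarrow> ereal" where
  "avg_norm C K f = (SUP h\<in>{0<..}. avg_norm_h C K h f)"

definition L_avg_h ::
    "'a::euclidean_space set \<Rightarrow> 'a set \<Rightarrow> real \<Rightarrow> ('a \<Rightarrow> real) set" where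
  "L_avg_h C K h = {f \<in> loc_integrable C. avg_norm_h C K h f < \<infinity>}"

definition L_avg ::
    "'a::euclidean_space set \<Rightarrow> 'a set \<Rightarrow> ('a \<Rightarrow> real) set" where
  "L_avg C K = {f \<in> loc_integrable C. avg_norm C K f < \<infinity>}"

subsection \<open>Exponents, constants and extremal functions\<close>

definition conj_exp :: "ereal \<Rightarrow> real" where
  "conj_exp p = (if p = \<infinity> then 1 else real_of_ereal p / (real_of_ereal p - 1))"

text \<open>The value at \<open>p = \<infinity>\<close> is the limit for \<open>p \<rightarrow> \<infinity>\<close>.\<close>

definition extend_to_infinity :: "(real \<Rightarrow> real) \<Rightarrow> ereal \<Rightarrow> real" where
  "extend_to_infinity F p = (if p = \<infinity> then Lim at_top F else F (real_of_ereal p))"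

definition alpha_fin :: "nat \<Rightarrow> real \<Rightarrow> real" where
  "alpha_fin d p = p * real d / (p + (p - 1) * real d)"

definition A_fin :: "nat \<Rightarrow> real \<Rightarrow> real" where
  "A_fin d p = (let p' = p / (p - 1) in
     1 / real d * Beta (1 - (real d - 1) * p' / real d) (p' + 1) powr (1 / p'))"

definition a_fin :: "nat \<Rightarrow> real \<Rightarrow> real" where
  "a_fin d p = ((p - real d) * A_fin d p / (p * real d)) powr alpha_fin d p
     * (p * real d / (p - real d) + 1)"

definition alpha :: "nat \<Rightarrow> ereal \<Rightarrow> real" where
  "alpha d = extend_to_infinity (alpha_fin d)"

definition a_const :: "nat \<Rightarrow> ereal \<Rightarrow> real" where
  "a_const d = extend_to_infinity (a_fin d)"

definition g_fun :: "'a::euclidean_space set \<Rightarrow> 'a set \<Rightarrow> real \<Rightarrow> real \<Rightarrow> real" where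
  "g_fun C K h u = 1 / (real DIM('a) * measure lebesgue (K \<inter> C))
     * (1 / u ^ (DIM('a) - 1) - u / h ^ DIM('a))"

definition f_ext ::
    "'a::euclidean_space set \<Rightarrow> 'a set \<Rightarrow> ereal \<Rightarrow> real \<Rightarrow> 'a \<Rightarrow> real" where
  "f_ext C K p h y =
     (if y \<in> (*\<^sub>R) h ` K \<inter> C
      then LINT u:{body_norm K y<..<h}|lebesgue. g_fun C K h u powr (conj_exp p - 1)
      else 0)"

end

theory Submission
  imports Defs
begin

text \<open>
  Averaging \<open>f (x + u) - f x = \<integral>\<^sub>0\<^sup>1 \<langle>\<nabla>f (x + t u), u\<rangle> dt\<close> over \<open>u \<in> hK \<inter> C\<close> and substituting \<open>w = t u\<close>
  gives the kernel \<open>g\<^sub>h\<close>, so Hoelder's inequality bounds \<open>f\<close> minus its average. For weakly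
  differentiable \<open>f\<close> the identity is integrated against a nonnegative test function, and a function whose
  integrals against all of these are bounded by \<open>M\<close> times the mass is at most \<open>M\<close> almost everywhere.
  Sharpness: the extremal function is a decreasing function \<open>F\<close> of the body norm with slope \<open>g\<^sub>h\<close> to the power \<open>p' - 1\<close>, which is
  the equality case of Hoelder's inequality, and integration over spheres of the body norm gives the
  exact value \<open>F 0\<close> for the right-hand side. The multiplicative inequality is the additive one
  minimized over \<open>h\<close>, and the extremal function attains the minimum at its own \<open>h\<close>.
\<close>

subsection \<open>The norm of a symmetric convex body\<close>

text \<open>The kernel is the radial integral left after w = t u: the Jacobian t^(-d), the factor N
  u = N w / t and the range N w / h < t \<le> 1 produce (N w / d) ((h / N w)^d - 1), which is \<mu>
  h^d g_h(N w). Two features of the cone are decisive: C + C lies in C, so x + V h stays in the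
  domain and test functions may be shifted by u without leaving C, and sections scale, so V h has
  measure \<mu> h^d. The body norm is merely convex, hence the gradient of the extremal function is
  found from one-sided directional quotients of N, and only an upper bound for its dual norm is
  established. That is enough: with this bound the right-hand side is at most F 0, while the
  inequality already proved keeps it above the supremum of the extremal function, which is at least
  F 0. The exponent p = \<infinity> runs along with the finite ones through q = 1 / p, the constants
  being continuous at q = 0.\<close>

locale symmetric_body =
  fixes K :: "'a::euclidean_space set"
  assumes bounded_body: "bounded K" and open_body: "open K" and convex_body: "convex K"
    and uminus_body: "\<And>x. x \<in> K \<Longrightarrow> - x \<in> K" and zero_body: "0 \<in> K"
begin

abbreviation "N \<equiv> body_norm K"
abbreviation "N\<^sub>d \<equiv> dual_body_norm K"

lemma scaleR_body: "0 \<le> c \<Longrightarrow> c \<le> 1 \<Longrightarrow> x \<in> K \<Longrightarrow> c *\<^sub>R x \<in> K"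
  using convexD[OF convex_body, of x 0 c "1 - c"] zero_body by auto

lemma mem_scaleR_body_iff: "t > 0 \<Longrightarrow> x \<in> (*\<^sub>R) t ` K \<longleftrightarrow> (1 / t) *\<^sub>R x \<in> K"
  by (auto simp: image_iff intro!: bexI[of _ "(1 / t) *\<^sub>R x"])

lemma ex_scaleR_body: "\<exists>t>0. (1 / t) *\<^sub>R x \<in> K"
proof -
  obtain e where e: "e > 0" "ball 0 e \<subseteq> K" using open_body zero_body open_contains_ball by blast
  show ?thesis
    using e by (intro exI[of _ "(norm x + 1) / e"]) (auto intro!: subsetD[OF e(2)] simp: add_pos_nonneg field_simps add_nonneg_pos abs_of_pos)
qed

text \<open>The admissible scales t form a set that is upward closed, because K is star-shaped about
  0, and open, because K is open. Such a set lies strictly above its infimum, which makes the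
  inequality strict.\<close>

lemma body_norm_less_iff:
  assumes t: "t > 0" shows "N x < t \<longleftrightarrow> (1 / t) *\<^sub>R x \<in> K"
proof -
  define S where "S = {t. t > 0 \<and> x \<in> (*\<^sub>R) t ` K}"
  have S: "S = {t. t > 0 \<and> (1 / t) *\<^sub>R x \<in> K}" by (auto simp: S_def mem_scaleR_body_iff)
  have ne: "S \<noteq> {}" using ex_scaleR_body[of x] S by auto
  have bd: "bdd_below S" by (rule bdd_belowI[of _ 0]) (auto simp: S)
  have N: "N x = Inf S" by (simp add: body_norm_def S_def)
  have "t \<in> S" if "s \<in> S" "s < t" for s
  proof -
    have "(s / t) *\<^sub>R ((1 / s) *\<^sub>R x) \<in> K" by (rule scaleR_body) (use that t in \<open>auto simp: S\<close>)
    moreover have "(s / t) *\<^sub>R ((1 / s) *\<^sub>R x) = (1 / t) *\<^sub>R x" using that t by (auto simp: S)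
    ultimately show ?thesis using t by (auto simp: S)
  qed
  moreover have "\<exists>s\<in>S. s < t" if "t \<in> S"
  proof -
    have "open ({0<..} \<inter> (\<lambda>s. (1 / s) *\<^sub>R x) -` K)"
      by (intro continuous_open_preimage continuous_intros open_body) auto
    then have "open ((\<lambda>s. (1 / s) *\<^sub>R x) -` K \<inter> {0<..})" by (simp add: Int_commute)
    moreover have "t \<in> (\<lambda>s. (1 / s) *\<^sub>R x) -` K \<inter> {0<..}" using that by (auto simp: S)
    ultimately obtain e where e: "e > 0" "ball t e \<subseteq> (\<lambda>s. (1 / s) *\<^sub>R x) -` K \<inter> {0<..}"
      using open_contains_ball by meson
    then have "t - e / 2 \<in> (\<lambda>s. (1 / s) *\<^sub>R x) -` K \<inter> {0<..}"
      by (intro subsetD[OF e(2)]) (auto simp: dist_real_def)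
    then show ?thesis using e by (intro bexI[of _ "t - e / 2"]) (auto simp: S)
  qed
  ultimately have "(\<exists>s\<in>S. s < t) \<longleftrightarrow> t \<in> S" by blast
  moreover have "t \<in> S \<longleftrightarrow> (1 / t) *\<^sub>R x \<in> K" using t by (auto simp: S)
  ultimately show ?thesis unfolding N using cInf_less_iff[OF ne bd] by auto
qed

lemma mem_scaleR_body: "t > 0 \<Longrightarrow> x \<in> (*\<^sub>R) t ` K \<longleftrightarrow> N x < t"
  by (simp add: mem_scaleR_body_iff body_norm_less_iff)

lemma body_norm_nonneg [simp]: "0 \<le> N x"
  unfolding body_norm_def using ex_scaleR_body[of x]
  by (intro cInf_greatest) (auto simp: mem_scaleR_body_iff)

lemma body_norm_scaleR_pos: assumes "c > 0" shows "N (c *\<^sub>R x) = c * N x"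
proof -
  have *: "N (c *\<^sub>R x) < t \<longleftrightarrow> N x < t / c" if "t > 0" for t
    using that assms by (simp add: body_norm_less_iff)
  show ?thesis
  proof (rule antisym)
    show "N (c *\<^sub>R x) \<le> c * N x"
    proof (rule dense_ge)
      fix t assume t: "c * N x < t"
      then have "t > 0" using assms by (meson body_norm_nonneg le_less_trans less_imp_le mult_nonneg_nonneg)
      then show "N (c *\<^sub>R x) \<le> t" using * t assms by (simp add: field_simps less_imp_le)
    qed
    show "c * N x \<le> N (c *\<^sub>R x)"
    proof (rule dense_ge)
      fix t assume t: "N (c *\<^sub>R x) < t"
      then have "t > 0" by (meson body_norm_nonneg le_less_trans)
      then show "c * N x \<le> t" using * t assms by (simp add: field_simps less_imp_le)
    qed
  qed
qed

lemma body_norm_uminus [simp]: "N (- x) = N x"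
proof -
  have *: "N (- x) \<le> N x" for x
  proof (rule dense_ge)
    fix t assume t: "N x < t"
    then have "t > 0" by (meson body_norm_nonneg le_less_trans)
    then show "N (- x) \<le> t" using t uminus_body[of "(1 / t) *\<^sub>R x"] by (simp add: body_norm_less_iff less_imp_le)
  qed
  show ?thesis using *[of x] *[of "- x"] by simp
qed

lemma body_norm_zero [simp]: "N 0 = 0"
proof (rule antisym)
  show "N 0 \<le> 0" by (rule dense_ge) (simp add: body_norm_less_iff zero_body less_imp_le)
qed simp

lemma body_norm_scaleR: "N (c *\<^sub>R x) = \<bar>c\<bar> * N x"
proof (cases "c = 0")
  case False
  have "N (c *\<^sub>R x) = N (\<bar>c\<bar> *\<^sub>R x)" 
    using body_norm_uminus[of "c *\<^sub>R x"] by (cases "c > 0") (simp_all add: abs_if)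
  then show ?thesis using False body_norm_scaleR_pos[of "\<bar>c\<bar>" x] by simp
qed simp

text \<open>For s > N x and t > N y the point (x + y) / (s + t) is the convex combination of x / s
  and y / t with weights s / (s + t) and t / (s + t). The slack e / 2 in each scale makes both
  inequalities strict.\<close>

lemma body_norm_triangle: "N (x + y) \<le> N x + N y"
proof (rule field_le_epsilon)
  fix e :: real assume e: "e > 0"
  define s t where "s = N x + e / 2" and "t = N y + e / 2"
  have p: "s > 0" "t > 0" "N x < s" "N y < t"
    using e by (auto simp: s_def t_def intro: add_nonneg_pos)
  have "(s / (s + t)) *\<^sub>R ((1 / s) *\<^sub>R x) + (t / (s + t)) *\<^sub>R ((1 / t) *\<^sub>R y) \<in> K"
    using p by (intro convexD[OF convex_body]) (auto simp: body_norm_less_iff add_divide_distrib[symmetric])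
  then have "(1 / (s + t)) *\<^sub>R (x + y) \<in> K" using p by (simp add: scaleR_add_right)
  then have "N (x + y) < s + t" using p by (simp add: body_norm_less_iff)
  then show "N (x + y) \<le> N x + N y + e" by (simp add: s_def t_def)
qed

lemma body_norm_diff_abs: "\<bar>N x - N y\<bar> \<le> N (x - y)"
  using body_norm_triangle[of "x - y" y] body_norm_triangle[of "y - x" x] body_norm_uminus[of "x - y"]
  by (simp add: abs_le_iff)

lemma body_norm_bounds:
  "\<exists>r R. r > 0 \<and> R > 0 \<and> (\<forall>x. N x \<le> r * norm x) \<and> (\<forall>x. norm x \<le> R * N x)"
proof -
  obtain e where e: "e > 0" "ball 0 e \<subseteq> K" using open_body zero_body open_contains_ball by blast
  obtain R where R: "R > 0" "\<And>x. x \<in> K \<Longrightarrow> norm x \<le> R" using bounded_body bounded_pos by metis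
  have 1: "N x \<le> 1 / e * norm x" for x
  proof (rule dense_ge)
    fix t assume t: "1 / e * norm x < t"
    have "0 \<le> 1 / e * norm x" using e by simp
    then have "t > 0" using t by linarith
    moreover have "(1 / t) *\<^sub>R x \<in> K"
      using t e \<open>t > 0\<close> by (intro subsetD[OF e(2)]) (auto simp: field_simps)
    ultimately show "N x \<le> t" using body_norm_less_iff by (simp add: less_imp_le)
  qed
  have 2: "norm x \<le> R * N x" for x
  proof -
    have "norm x / R \<le> N x"
    proof (rule dense_ge)
      fix t assume t: "N x < t"
      then have "t > 0" using body_norm_nonneg le_less_trans by blast
      then have "norm ((1 / t) *\<^sub>R x) \<le> R" using t R(2) body_norm_less_iff by blast
      then show "norm x / R \<le> t" using \<open>t > 0\<close> R by (simp add: field_simps)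
    qed
    then show ?thesis using R by (simp add: field_simps)
  qed
  show ?thesis using e R(1) 1 2 by (intro exI[of _ "1 / e"] exI[of _ R]) auto
qed

lemma body_norm_eq_0_iff [simp]: "N x = 0 \<longleftrightarrow> x = 0"
proof
  obtain r R where rR: "r > 0" "R > 0" "\<And>x. N x \<le> r * norm x" "\<And>x. norm x \<le> R * N x" using body_norm_bounds by blast
  show "x = 0" if "N x = 0" using rR(4)[of x] that by simp
qed simp

lemma continuous_on_body_norm [continuous_intros]: "continuous_on S f \<Longrightarrow> continuous_on S (\<lambda>x. N (f x))"
proof -
  obtain r R where rR: "r > 0" "R > 0" "\<And>x. N x \<le> r * norm x" "\<And>x. norm x \<le> R * N x" using body_norm_bounds by blast
  have "\<bar>N x - N y\<bar> \<le> r * norm (x - y)" for x y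
    using body_norm_diff_abs[of x y] rR(3)[of "x - y"] by linarith
  then have "r-lipschitz_on UNIV N"
    using rR by (intro lipschitz_onI) (auto simp: dist_real_def dist_norm)
  then show "continuous_on S f \<Longrightarrow> continuous_on S (\<lambda>x. N (f x))"
    using continuous_on_compose2[OF lipschitz_on_continuous_on] by blast
qed

lemma borel_measurable_body_norm [measurable]: "N \<in> borel_measurable borel"
  by (intro borel_measurable_continuous_onI continuous_intros)

subsection \<open>Dual norm\<close>

lemma bdd_above_dual: "bdd_above ((\<lambda>x. x \<bullet> z) ` {x. N x \<le> 1})"
proof -
  obtain r R where rR: "r > 0" "R > 0" "\<And>x. N x \<le> r * norm x" "\<And>x. norm x \<le> R * N x" using body_norm_bounds by blast
  have "x \<bullet> z \<le> R * norm z" if "N x \<le> 1" for x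
  proof -
    have "norm x \<le> R" using rR(4)[of x] mult_left_mono[OF that, of R] rR(2) by linarith
    then show ?thesis using norm_cauchy_schwarz[of x z] mult_right_mono[of "norm x" R "norm z"] by simp
  qed
  then show ?thesis by (intro bdd_aboveI[of _ "R * norm z"]) auto
qed

lemma inner_le_dual: "x \<bullet> z \<le> N x * N\<^sub>d z"
proof (cases "x = 0")
  case False
  then have p: "N x > 0" using body_norm_nonneg[of x] by (simp add: order_less_le)
  have "((1 / N x) *\<^sub>R x) \<bullet> z \<le> N\<^sub>d z"
    unfolding dual_body_norm_def using p
    by (intro cSUP_upper[OF _ bdd_above_dual]) (auto simp: body_norm_scaleR)
  with p show ?thesis by (simp add: field_simps)
qed simp

lemma dual_body_norm_le:
  assumes "c \<ge> 0" "\<And>x. x \<bullet> z \<le> c * N x" shows "N\<^sub>d z \<le> c"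
  unfolding dual_body_norm_def
proof (rule cSUP_least)
  show "{x. N x \<le> 1} \<noteq> {}" by (auto intro: exI[of _ 0])
  show "x \<bullet> z \<le> c" if "x \<in> {x. N x \<le> 1}" for x
    using assms(2)[of x] that mult_left_mono[of "N x" 1 c] assms(1) by auto
qed

lemma dual_body_norm_nonneg [simp]: "0 \<le> N\<^sub>d z"
proof -
  have "0 \<bullet> z \<le> N\<^sub>d z" unfolding dual_body_norm_def by (intro cSUP_upper[OF _ bdd_above_dual]) auto
  then show ?thesis by simp
qed

lemma abs_inner_le_dual: "\<bar>x \<bullet> z\<bar> \<le> N x * N\<^sub>d z"
  using inner_le_dual[of x z] inner_le_dual[of "- x" z] by (auto simp: abs_le_iff)

lemma dual_body_norm_triangle: "N\<^sub>d (x + y) \<le> N\<^sub>d x + N\<^sub>d y"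
  by (rule dual_body_norm_le) (auto simp: inner_add_right distrib_right intro!: add_mono order_trans[OF inner_le_dual])

lemma dual_body_norm_le_norm: "\<exists>R>0. \<forall>z. N\<^sub>d z \<le> R * norm z"
proof -
  obtain r R where rR: "r > 0" "R > 0" "\<And>x. N x \<le> r * norm x" "\<And>x. norm x \<le> R * N x" using body_norm_bounds by blast
  have "N\<^sub>d z \<le> R * norm z" for z
  proof (rule dual_body_norm_le)
    fix x
    have "x \<bullet> z \<le> norm x * norm z" by (rule norm_cauchy_schwarz)
    also have "\<dots> \<le> (R * N x) * norm z" by (intro mult_right_mono rR(4)) auto
    finally show "x \<bullet> z \<le> R * norm z * N x" by (simp add: ac_simps)
  qed (use rR in auto)
  with rR(2) show ?thesis by blast
qed

lemma borel_measurable_dual_body_norm [measurable]: "N\<^sub>d \<in> borel_measurable borel"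
proof (rule borel_measurable_continuous_onI)
  obtain R where R: "R > 0" "\<And>z. N\<^sub>d z \<le> R * norm z" using dual_body_norm_le_norm by blast
  have "\<bar>N\<^sub>d x - N\<^sub>d y\<bar> \<le> R * norm (x - y)" for x y
    using dual_body_norm_triangle[of "x - y" y] dual_body_norm_triangle[of "y - x" x]
      R(2)[of "x - y"] R(2)[of "y - x"] by (simp add: abs_le_iff norm_minus_commute)
  then have "R-lipschitz_on UNIV N\<^sub>d"
    using R by (intro lipschitz_onI) (auto simp: dist_real_def dist_norm)
  then show "continuous_on UNIV N\<^sub>d" by (rule lipschitz_on_continuous_on)
qed

end

subsection \<open>Sections of the cone\<close>

lemma nn_integral_scaleR:
  fixes f :: "'a::euclidean_space \<Rightarrow> ennreal"
  assumes [measurable]: "f \<in> borel_measurable borel" and t: "t > 0"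
  shows "(\<integral>\<^sup>+u. f (t *\<^sub>R u) \<partial>lborel) = ennreal (1 / t ^ DIM('a)) * (\<integral>\<^sup>+w. f w \<partial>lborel)"
proof -
  have "(\<integral>\<^sup>+w. f w \<partial>lborel) = ennreal (t ^ DIM('a)) * (\<integral>\<^sup>+u. f (t *\<^sub>R u) \<partial>lborel)"
    using t by (subst lborel_affine[of t "0::'a"])
      (simp_all add: nn_integral_density nn_integral_distr nn_integral_cmult)
  moreover have "ennreal (1 / t ^ DIM('a)) * ennreal (t ^ DIM('a)) = 1"
    using t by (simp add: ennreal_mult'[symmetric])
  ultimately show ?thesis by (simp add: mult.assoc[symmetric])
qed

locale cone_body = symmetric_body K for K :: "'a::euclidean_space set" +
  fixes C :: "'a set"
  assumes cone: "open_convex_cone C"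
begin

abbreviation "V h \<equiv> (*\<^sub>R) h ` K \<inter> C"
abbreviation "\<mu> \<equiv> measure lebesgue (K \<inter> C)"
abbreviation "g \<equiv> g_fun C K"

lemma open_cone: "open C" and convex_cone: "convex C" and cone_nonempty: "C \<noteq> {}"
  and scaleR_cone: "x \<in> C \<Longrightarrow> t > 0 \<Longrightarrow> t *\<^sub>R x \<in> C"
  using cone by (auto simp: open_convex_cone_def)

lemma cone_borel [measurable]: "C \<in> sets borel"
  using open_cone by simp

lemma add_cone: assumes "x \<in> C" "y \<in> C" shows "x + y \<in> C"
proof -
  have "(1 / 2) *\<^sub>R x + (1 / 2) *\<^sub>R y \<in> C" using assms by (intro convexD[OF convex_cone]) auto
  then have "2 *\<^sub>R ((1 / 2) *\<^sub>R x + (1 / 2) *\<^sub>R y) \<in> C" by (rule scaleR_cone) simp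
  then show ?thesis by (simp add: scaleR_add_right)
qed

text \<open>The error y - z of approximating y from C is absorbed by a ball around the interior
  point x. Needed because the sum of a compact subset of C and the closure of a section must stay in
  C.\<close>

lemma add_closure_cone: assumes "x \<in> C" "y \<in> closure C" shows "x + y \<in> C"
proof -
  obtain e where e: "e > 0" "ball x e \<subseteq> C" using open_cone assms(1) open_contains_ball by blast
  obtain z where z: "z \<in> C" "dist z y < e" using assms(2) e(1) closure_approachable by blast
  have "x + (y - z) \<in> C" using z by (intro subsetD[OF e(2)]) (simp add: dist_norm norm_minus_commute)
  from add_cone[OF this z(1)] show ?thesis by simp
qed

lemma scaleR_section: assumes "h > 0" shows "V h = (*\<^sub>R) h ` (K \<inter> C)"
proof -
  have "x \<in> C \<Longrightarrow> x \<in> (*\<^sub>R) h ` C" for x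
    using assms scaleR_cone[of x "1 / h"] by (auto simp: image_iff intro!: bexI[of _ "(1 / h) *\<^sub>R x"])
  moreover have "(*\<^sub>R) h ` C \<subseteq> C" using assms scaleR_cone by auto
  moreover have "inj ((*\<^sub>R) h :: 'a \<Rightarrow> 'a)" using assms by (auto simp: inj_def)
  ultimately show ?thesis by (auto simp: image_Int)
qed

lemma section_iff: "h > 0 \<Longrightarrow> y \<in> V h \<longleftrightarrow> N y < h \<and> y \<in> C"
  using mem_scaleR_body by auto

lemma section_eq: "h > 0 \<Longrightarrow> V h = {y\<in>C. N y < h}"
  using section_iff by auto

lemma section_borel [measurable]: "h > 0 \<Longrightarrow> V h \<in> sets borel"
  by (simp add: section_eq)

lemma bounded_section: "bounded (V h)"
  by (meson bounded_Int bounded_scaling bounded_body)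

lemma measure_section_pos: "\<mu> > 0"
proof -
  obtain x where x: "x \<in> C" using cone_nonempty by auto
  obtain t where t: "t > 0" "(1 / t) *\<^sub>R x \<in> K" using ex_scaleR_body by blast
  with x have "(1 / t) *\<^sub>R x \<in> K \<inter> C" using scaleR_cone[of x "1 / t"] by auto
  moreover have "open (K \<inter> C)" using open_body open_cone by auto
  moreover have "K \<inter> C \<in> lmeasurable"
    using \<open>open (K \<inter> C)\<close> bounded_body by (intro lmeasurable_open) (auto intro: bounded_subset)
  ultimately show ?thesis
    by (metis empty_iff negligible_iff_measure open_not_negligible zero_less_measure_iff)
qed

lemma emeasure_section: assumes "h > 0" shows "emeasure lborel (V h) = ennreal (\<mu> * h ^ DIM('a))"
proof -
  have "open (K \<inter> C)" using open_body open_cone by auto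
  then have "K \<inter> C \<in> lmeasurable" 
    using bounded_body by (intro lmeasurable_open) (auto intro: bounded_subset)
  then have "emeasure lebesgue (K \<inter> C) = ennreal \<mu>" by (simp add: emeasure_eq_measure2)
  moreover have "emeasure lborel (V h) = emeasure lebesgue (V h)" using assms by simp
  moreover have "emeasure lebesgue (V h) = h ^ DIM('a) * emeasure lebesgue (K \<inter> C)"
    using emeasure_lebesgue_affine[of h 0 "K \<inter> C"] assms by (simp add: scaleR_section)
  ultimately show ?thesis using assms by (simp add: ennreal_mult'[symmetric] ennreal_mult''[symmetric] mult.commute)
qed

text \<open>The closed section is squeezed between V x and the open sections V s with s > x, whose
  measures tend to the same value as s decreases to x.\<close>

lemma emeasure_section_le:
  assumes "x \<ge> 0" shows "emeasure lborel {y\<in>C. N y \<le> x} = ennreal (\<mu> * x ^ DIM('a))"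
proof -
  have sub: "{y\<in>C. N y \<le> x} \<subseteq> V s" if "s > x" for s using that assms by (auto simp: section_eq)
  have fin: "emeasure lborel {y\<in>C. N y \<le> x} < \<infinity>"
    using emeasure_mono[OF sub[of "x + 1"], of lborel] emeasure_section[of "x + 1"] assms by (auto simp: le_less_trans)
  define c where "c = measure lborel {y\<in>C. N y \<le> x}"
  have c: "emeasure lborel {y\<in>C. N y \<le> x} = ennreal c"
    using fin by (simp add: c_def emeasure_eq_ennreal_measure)
  have "c \<le> \<mu> * s ^ DIM('a)" if "s > x" for s
    using emeasure_mono[OF sub[OF that], of lborel] emeasure_section[of s] that assms c
    by (auto simp: ennreal_le_iff)
  moreover have "((\<lambda>s. \<mu> * s ^ DIM('a)) \<longlongrightarrow> \<mu> * x ^ DIM('a)) (at_right x)"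
    by (intro tendsto_intros)
  ultimately have "c \<le> \<mu> * x ^ DIM('a)"
    by (intro tendsto_lowerbound) (auto intro!: eventually_at_rightI[of x "x + 1"])
  moreover have "ennreal (\<mu> * x ^ DIM('a)) \<le> ennreal c"
  proof (cases "x = 0")
    case False
    then have "V x \<subseteq> {y\<in>C. N y \<le> x}" using section_eq[of x] assms by (simp only: less_le) auto
    then show ?thesis using emeasure_mono[of "V x" "{y\<in>C. N y \<le> x}" lborel] emeasure_section[of x] False assms c by auto
  qed (auto simp: zero_power)
  ultimately show ?thesis unfolding c
    by (rule antisym[OF ennreal_leI])
qed

text \<open>A sphere of N inside C is the difference of a closed and an open section of equal finite
  measure. This supplies the null sets off which the truncated extremal function has convergent
  difference quotients.\<close>

lemma AE_body_norm_neq: assumes "x \<ge> 0" shows "AE y in lborel. y \<in> C \<longrightarrow> N y \<noteq> x"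
proof -
  have "{y\<in>C. N y = x} \<in> null_sets lborel"
  proof (cases "x = 0")
    case True
    then have "{y\<in>C. N y = x} \<subseteq> {0}" by auto
    then show ?thesis by (metis finite.simps finite_imp_null_set_lborel finite_subset)
  next
    case False
    then have x: "x > 0" using assms by simp
    have "{y\<in>C. N y = x} = {y\<in>C. N y \<le> x} - V x" using x by (auto simp: section_eq)
    moreover have "emeasure lborel ({y\<in>C. N y \<le> x} - V x) = emeasure lborel {y\<in>C. N y \<le> x} - emeasure lborel (V x)"
      using x emeasure_section[OF x] by (intro emeasure_Diff) (auto simp: section_eq)
    ultimately show ?thesis
      using x emeasure_section[OF x] emeasure_section_le[of x] by (auto simp: null_sets_def)
  qed
  then show ?thesis by (rule AE_I') auto
qed

text \<open>Polar coordinates for N: the image under N of Lebesgue measure on V h is identified with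
  the density on the right by comparing both measures on the rays \<open>{x<..}\<close>, where they
  are finite and the masses come from the measures of sections.\<close>

lemma nn_integral_section_polar:
  assumes h: "h > 0" and [measurable]: "\<phi> \<in> borel_measurable borel"
  shows "(\<integral>\<^sup>+y. \<phi> (N y) * indicator (V h) y \<partial>lborel)
       = (\<integral>\<^sup>+u. ennreal (DIM('a) * \<mu> * u ^ (DIM('a) - 1)) * \<phi> u * indicator {0<..<h} u \<partial>lborel)"
proof -
  have [measurable]: "V h \<in> sets borel" using h by (rule section_borel)
  define M where "M = distr (density lborel (indicator (V h))) borel N"
  define M' where "M' = density lborel (\<lambda>u. ennreal (DIM('a) * \<mu> * u ^ (DIM('a) - 1)) * indicator {0<..<h} u)"
  have eM: "emeasure M {x<..} = emeasure lborel (V h \<inter> {y. N y > x})" for x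
  proof -
    have "emeasure M {x<..} = emeasure (density lborel (indicator (V h))) {y. N y > x}"
      unfolding M_def by (subst emeasure_distr) (auto simp: vimage_def)
    also have "\<dots> = (\<integral>\<^sup>+y. indicator (V h \<inter> {y. N y > x}) y \<partial>lborel)"
    proof (subst emeasure_density)
      show "indicator (V h) \<in> borel_measurable lborel" by measurable
      show "{y. N y > x} \<in> sets lborel" by measurable
      show "(\<integral>\<^sup>+y. indicator (V h) y * indicator {y. N y > x} y \<partial>lborel) = (\<integral>\<^sup>+y. indicator (V h \<inter> {y. N y > x}) y \<partial>lborel)"
        by (simp only: indicator_inter_arith)
    qed
    also have "\<dots> = emeasure lborel (V h \<inter> {y. N y > x})" by (rule nn_integral_indicator) measurable
    finally show ?thesis .
  qed
  \<comment> \<open>For negative x the ray loses nothing, since the density lives on (0, h); hence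
    the truncation \<open>max x 0\<close>.\<close>
  have eM': "emeasure M' {x<..} = ennreal (\<mu> * (h ^ DIM('a) - (max x 0) ^ DIM('a)))" if "x < h" for x
  proof -
    let ?x = "max x 0"
    have "emeasure M' {x<..} = (\<integral>\<^sup>+u. ennreal (DIM('a) * \<mu> * u ^ (DIM('a) - 1)) * indicator {0<..<h} u * indicator {x<..} u \<partial>lborel)"
      unfolding M'_def by (subst emeasure_density) auto
    also have "\<dots> = (\<integral>\<^sup>+u. ennreal (DIM('a) * \<mu> * u ^ (DIM('a) - 1)) * indicator {?x..h} u \<partial>lborel)"
    proof (rule nn_integral_cong_AE)
      show "AE u in lborel. ennreal (DIM('a) * \<mu> * u ^ (DIM('a) - 1)) * indicator {0<..<h} u * indicator {x<..} u
          = ennreal (DIM('a) * \<mu> * u ^ (DIM('a) - 1)) * indicator {?x..h} u"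
        using AE_lborel_singleton[of ?x] AE_lborel_singleton[of h]
        by eventually_elim (auto simp: indicator_def)
    qed
    also have "\<dots> = ennreal (\<mu> * h ^ DIM('a) - \<mu> * ?x ^ DIM('a))"
      using that h measure_section_pos
      by (intro nn_integral_FTC_Icc) (auto intro!: derivative_eq_intros)
    finally show ?thesis by (simp add: right_diff_distrib)
  qed
  have "emeasure M {x<..} = emeasure M' {x<..}" for x
  proof (cases "x < h")
    case True
    show ?thesis
    proof (cases "x < 0")
      case x: True
      have "y \<in> V h \<Longrightarrow> N y > x" for y using body_norm_nonneg[of y] x by linarith
      then have "V h \<inter> {y. N y > x} = V h" by auto
      then show ?thesis using eM[of x] eM'[OF True] emeasure_section[OF h] x by (simp add: max_def zero_power)
    next
      case False
      have "V h \<inter> {y. N y > x} = V h - {y\<in>C. N y \<le> x}" by auto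
      moreover have "emeasure lborel (V h - {y\<in>C. N y \<le> x}) = emeasure lborel (V h) - emeasure lborel {y\<in>C. N y \<le> x}"
        using False True emeasure_section_le[of x] h by (intro emeasure_Diff) (auto simp: section_eq)
      ultimately have "emeasure M {x<..} = ennreal (\<mu> * h ^ DIM('a)) - ennreal (\<mu> * x ^ DIM('a))"
        using eM[of x] False emeasure_section_le[of x] emeasure_section[OF h] by simp
      then show ?thesis using eM'[OF True] False measure_section_pos
        by (simp add: ennreal_minus right_diff_distrib max_def)
    qed
  next
    case False
    have "V h \<inter> {y. N y > x} = {}" using section_iff[OF h] False by force
    moreover have "emeasure M' {x<..} = 0"
      unfolding M'_def using False by (subst emeasure_density) (auto simp: nn_integral_0_iff_AE split: split_indicator)
    ultimately show ?thesis using eM by simp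
  qed
  moreover have "emeasure M {x<..} < \<infinity>" for x
  proof -
    have "emeasure M {x<..} \<le> emeasure lborel (V h)" unfolding eM by (intro emeasure_mono) auto
    then show ?thesis using emeasure_section[OF h] by (simp add: le_less_trans)
  qed
  ultimately have eq: "M = M'" by (intro measure_eqI_lessThan) (auto simp: M_def M'_def)
  have "(\<integral>\<^sup>+y. \<phi> (N y) * indicator (V h) y \<partial>lborel) = (\<integral>\<^sup>+u. \<phi> u \<partial>M)"
    unfolding M_def by (subst nn_integral_distr) (auto simp: nn_integral_density mult.commute)
  also have "\<dots> = (\<integral>\<^sup>+u. ennreal (DIM('a) * \<mu> * u ^ (DIM('a) - 1)) * \<phi> u * indicator {0<..<h} u \<partial>lborel)"
    unfolding eq M'_def by (subst nn_integral_density) (auto simp: ac_simps)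
  finally show ?thesis .
qed

end

subsection \<open>Smooth functions\<close>

text \<open>\<open>C_k\<close> recurses through the partial derivatives, so a family of
  differentiable functions that is closed under them lies in every \<open>C_k\<close>; smoothness
  reduces to exhibiting such a family.\<close>

lemma C_k_coinduct:
  assumes "\<phi> \<in> F" and "\<And>\<psi> x. \<psi> \<in> F \<Longrightarrow> \<psi> differentiable (at x)"
    and "\<And>\<psi> i. \<psi> \<in> F \<Longrightarrow> i \<in> Basis \<Longrightarrow> (\<lambda>x. frechet_derivative \<psi> (at x) i) \<in> F"
  shows "C_k k \<phi>"
  using assms(1)
proof (induction k arbitrary: \<phi>)
  case 0
  then show ?case
    using assms(2) by (auto simp: continuous_on_eq_continuous_within intro: differentiable_imp_continuous_within)
qed (use assms in auto)

text \<open>The classical flat function exp(- 1 / t), carried together with its multiples by powers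
  of 1 / t so that differentiation stays within linear combinations of the same functions.\<close>

definition flat_exp :: "nat \<Rightarrow> real \<Rightarrow> real" where
  "flat_exp m t = (if t > 0 then inverse t ^ m * exp (- inverse t) else 0)"

lemma flat_exp_tendsto: "(flat_exp m \<longlongrightarrow> 0) (at 0)"
proof -
  have "((\<lambda>t. (inverse t) ^ m / exp (inverse t)) \<longlongrightarrow> 0) (at_right (0::real))"
    by (rule filterlim_compose[OF tendsto_power_div_exp_0 filterlim_inverse_at_top_right])
  then have "(flat_exp m \<longlongrightarrow> 0) (at_right 0)"
    by (rule Lim_transform_eventually)
      (auto simp: flat_exp_def exp_minus divide_inverse eventually_at_right_field intro!: exI[of _ 1])
  moreover have "(flat_exp m \<longlongrightarrow> 0) (at_left 0)"
    by (rule Lim_transform_eventually[OF tendsto_const])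
      (auto simp: flat_exp_def eventually_at_left_field intro!: exI[of _ "-1"])
  ultimately show ?thesis by (simp add: filterlim_split_at)
qed

lemma flat_exp_DERIV:
  "(flat_exp m has_real_derivative (flat_exp (m + 2) t - real m * flat_exp (m + 1) t)) (at t)"
proof -
  consider "t > 0" | "t < 0" | "t = 0" by linarith
  then show ?thesis
  proof cases
    case 1
    have "((\<lambda>t. inverse t ^ m * exp (- inverse t)) has_real_derivative
        (inverse t ^ (m + 2) * exp (- inverse t) - real m * (inverse t ^ (m + 1) * exp (- inverse t)))) (at t)"
    proof (rule DERIV_cong)
      show "((\<lambda>t. inverse t ^ m * exp (- inverse t)) has_real_derivative
          real m * (- (inverse t ^ 2) * inverse t ^ (m - Suc 0)) * exp (- inverse t)
            + exp (- inverse t) * inverse t ^ 2 * inverse t ^ m) (at t)"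
        using 1 by (auto intro!: derivative_eq_intros simp: power2_eq_square)
    qed (cases m; simp add: power2_eq_square algebra_simps)
    then have "(flat_exp m has_real_derivative
        (inverse t ^ (m + 2) * exp (- inverse t) - real m * (inverse t ^ (m + 1) * exp (- inverse t)))) (at t)"
      by (rule DERIV_cong_ev[THEN iffD1, OF refl _ refl, rotated])
        (use 1 in \<open>auto simp: flat_exp_def intro!: eventually_mono[OF eventually_nhds_in_open[of "{0<..}" t]]\<close>)
    with 1 show ?thesis by (simp add: flat_exp_def)
  next
    case 2
    have "((\<lambda>_. 0) has_real_derivative 0) (at t)" by auto
    then have "(flat_exp m has_real_derivative 0) (at t)"
      by (rule DERIV_cong_ev[THEN iffD1, OF refl _ refl, rotated])
        (use 2 in \<open>auto simp: flat_exp_def intro!: eventually_mono[OF eventually_nhds_in_open[of "{..<0}" t]]\<close>)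
    with 2 show ?thesis by (simp add: flat_exp_def)
  next
    case 3
    \<comment> \<open>At 0 the difference quotient is \<open>flat_exp\<close> of the next order,
      whose limit is 0.\<close>
    have "((\<lambda>h. (flat_exp m (0 + h) - flat_exp m 0) / h) \<longlongrightarrow> 0) (at 0)"
      by (rule Lim_transform_eventually[OF flat_exp_tendsto[of "Suc m"]])
        (auto simp: flat_exp_def divide_inverse mult_ac intro!: always_eventually)
    with 3 show ?thesis by (simp add: DERIV_def flat_exp_def)
  qed
qed

text \<open>A class just large enough for products of \<open>flat_exp\<close> in the coordinates.
  Sums are included because the Leibniz rule and the derivative of \<open>flat_exp\<close> produce
  them, constants because of the factors from the chain rule.\<close>

inductive_set smooth_family :: "('a::euclidean_space \<Rightarrow> real) set" where
  const: "(\<lambda>_. c) \<in> smooth_family"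
| flat: "(\<lambda>x. flat_exp m (c + b * (x \<bullet> i))) \<in> smooth_family"
| add: "\<phi> \<in> smooth_family \<Longrightarrow> \<psi> \<in> smooth_family \<Longrightarrow> (\<lambda>x. \<phi> x + \<psi> x) \<in> smooth_family"
| mult: "\<phi> \<in> smooth_family \<Longrightarrow> \<psi> \<in> smooth_family \<Longrightarrow> (\<lambda>x. \<phi> x * \<psi> x) \<in> smooth_family"

lemma smooth_family_derivative:
  assumes "\<phi> \<in> smooth_family"
  shows "\<exists>D. (\<forall>x. (\<phi> has_derivative D x) (at x)) \<and> (\<forall>i. (\<lambda>x. D x i) \<in> smooth_family)"
  using assms
proof induction
  case (const c)
  show ?case by (rule exI[of _ "\<lambda>_ _. 0"]) (auto intro: smooth_family.const)
next
  case (flat m c b i)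
  let ?f = "\<lambda>n x. flat_exp n (c + b * (x \<bullet> i))"
  let ?D = "\<lambda>x v. (b * (v \<bullet> i)) * (?f (m + 2) x + (- real m) * ?f (m + 1) x)"
  have "(?f m has_derivative ?D x) (at x)" for x
  proof -
    have "((\<lambda>x. c + b * (x \<bullet> i)) has_derivative (\<lambda>v. b * (v \<bullet> i))) (at x)"
      by (auto intro!: derivative_eq_intros)
    from DERIV_compose_FDERIV[OF flat_exp_DERIV this]
    show ?thesis by simp
  qed
  then show ?case
    by (intro exI[of _ ?D] conjI allI smooth_family.intros) auto
next
  case (add \<phi> \<psi>)
  then obtain D E where D: "\<And>x. (\<phi> has_derivative D x) (at x)" "\<And>i. (\<lambda>x. D x i) \<in> smooth_family"
    and E: "\<And>x. (\<psi> has_derivative E x) (at x)" "\<And>i. (\<lambda>x. E x i) \<in> smooth_family" by blast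
  show ?case
    by (rule exI[of _ "\<lambda>x v. D x v + E x v"]) (auto intro!: D E smooth_family.add has_derivative_add)
next
  case (mult \<phi> \<psi>)
  then obtain D E where D: "\<And>x. (\<phi> has_derivative D x) (at x)" "\<And>i. (\<lambda>x. D x i) \<in> smooth_family"
    and E: "\<And>x. (\<psi> has_derivative E x) (at x)" "\<And>i. (\<lambda>x. E x i) \<in> smooth_family" by blast
  show ?case
    by (rule exI[of _ "\<lambda>x v. \<phi> x * E x v + D x v * \<psi> x"])
      (auto intro!: D E smooth_family.add smooth_family.mult mult.hyps has_derivative_mult)
qed

lemma C_k_smooth_family: "\<phi> \<in> smooth_family \<Longrightarrow> C_k k \<phi>"
proof (erule C_k_coinduct)
  fix \<psi> :: "'a \<Rightarrow> real" assume \<psi>: "\<psi> \<in> smooth_family"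
  then obtain D where D: "\<And>x. (\<psi> has_derivative D x) (at x)" "\<And>i. (\<lambda>x. D x i) \<in> smooth_family"
    using smooth_family_derivative by blast
  show "\<psi> differentiable (at x)" for x using D(1) by (auto simp: differentiable_def)
  show "(\<lambda>x. frechet_derivative \<psi> (at x) i) \<in> smooth_family" for i
    using D by (simp add: frechet_derivative_at[OF D(1), symmetric])
qed

lemma smooth_family_prod:
  "finite I \<Longrightarrow> (\<And>i. i \<in> I \<Longrightarrow> \<phi> i \<in> smooth_family) \<Longrightarrow> (\<lambda>x. \<Prod>i\<in>I. \<phi> i x) \<in> smooth_family"
  by (induction I rule: finite_induct) (auto intro: smooth_family.intros)

text \<open>A smooth minorant of the indicator of \<open>box a b\<close>. Since exp(- 1 / (n t))
  tends to 1 for t > 0, these functions tend to that indicator as n grows.\<close>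

definition box_bump :: "'a::euclidean_space \<Rightarrow> 'a \<Rightarrow> nat \<Rightarrow> 'a \<Rightarrow> real" where
  "box_bump a b n x = (\<Prod>i\<in>Basis. flat_exp 0 (real n * (x \<bullet> i - a \<bullet> i)) * flat_exp 0 (real n * (b \<bullet> i - x \<bullet> i)))"

lemma flat_exp_0_bounds: "0 \<le> flat_exp 0 t" "flat_exp 0 t \<le> 1"
  by (auto simp: flat_exp_def)

lemma box_bump_bounds: "0 \<le> box_bump a b n x" "box_bump a b n x \<le> 1"
  unfolding box_bump_def
  by (auto intro!: prod_nonneg prod_le_1 mult_nonneg_nonneg mult_le_one flat_exp_0_bounds)

lemma box_bump_nonzero_iff: "n > 0 \<Longrightarrow> box_bump a b n x \<noteq> 0 \<longleftrightarrow> x \<in> box a b"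
  unfolding box_bump_def
  by (auto simp: prod_zero_iff mem_box flat_exp_def zero_less_mult_iff)

lemma C_k_box_bump: "C_k k (box_bump a b n)"
proof -
  have 1: "(\<lambda>x. flat_exp 0 (real n * (x \<bullet> i - a \<bullet> i))) = (\<lambda>x. flat_exp 0 (- (real n * (a \<bullet> i)) + real n * (x \<bullet> i)))"
    and 2: "(\<lambda>x. flat_exp 0 (real n * (b \<bullet> i - x \<bullet> i))) = (\<lambda>x. flat_exp 0 (real n * (b \<bullet> i) + (- real n) * (x \<bullet> i)))"
    for i by (simp_all add: algebra_simps)
  have "box_bump a b n \<in> smooth_family"
    unfolding box_bump_def[abs_def]
    by (intro smooth_family_prod smooth_family.mult) (auto simp only: 1 2 finite_Basis smooth_family.flat)
  then show ?thesis by (rule C_k_smooth_family)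
qed

lemma box_bump_test_function:
  assumes "n > 0" "cbox a b \<subseteq> C" shows "box_bump a b n \<in> test_functions C"
proof -
  have "{x. box_bump a b n x \<noteq> 0} = box a b" using box_bump_nonzero_iff[OF assms(1)] by blast
  moreover have "closure (box a b) \<subseteq> cbox a b" by (rule closure_minimal[OF box_subset_cbox closed_cbox])
  ultimately show ?thesis
    using assms(2) by (auto simp: test_functions_def C_k_box_bump compact_closure)
qed

lemma flat_exp_0_tendsto: "(\<lambda>n. flat_exp 0 (real n * t)) \<longlonglongrightarrow> (if t > 0 then 1 else 0)"
proof (cases "t > 0")
  case True
  have "(\<lambda>n. exp (- (inverse (real n) * inverse t))) \<longlonglongrightarrow> exp (- (0 * inverse t))"
    by (intro tendsto_intros lim_inverse_n)
  moreover have "\<forall>\<^sub>F n in sequentially. exp (- (inverse (real n) * inverse t)) = flat_exp 0 (real n * t)"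
    using eventually_gt_at_top[of "0::nat"] by eventually_elim (use True in \<open>auto simp: flat_exp_def\<close>)
  ultimately show ?thesis using True by (simp add: Lim_transform_eventually)
next
  case False
  then have "flat_exp 0 (real n * t) = 0" for n by (auto simp: flat_exp_def zero_less_mult_iff)
  with False show ?thesis by simp
qed

lemma box_bump_tendsto: "(\<lambda>n. box_bump a b n x) \<longlonglongrightarrow> indicator (box a b) x"
proof -
  have "(\<lambda>n. box_bump a b n x) \<longlonglongrightarrow>
    (\<Prod>i\<in>Basis. (if x \<bullet> i - a \<bullet> i > 0 then 1 else 0) * (if b \<bullet> i - x \<bullet> i > 0 then 1 else 0))"
    unfolding box_bump_def by (intro tendsto_prod tendsto_mult flat_exp_0_tendsto)
  also have "(\<Prod>i\<in>Basis. (if x \<bullet> i - a \<bullet> i > 0 then 1 else 0) * (if b \<bullet> i - x \<bullet> i > 0 then 1 else (0::real)))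
     = indicator (box a b) x"
    by (cases "x \<in> box a b") (auto simp: mem_box intro!: prod.neutral prod_zero)
  finally show ?thesis .
qed

lemma test_function_props:
  assumes "\<phi> \<in> test_functions C"
  shows "continuous_on UNIV \<phi>" "\<phi> differentiable (at x)" 
    "i \<in> Basis \<Longrightarrow> continuous_on UNIV (\<lambda>x. frechet_derivative \<phi> (at x) i)"
    "compact (closure {x. \<phi> x \<noteq> 0})" "closure {x. \<phi> x \<noteq> 0} \<subseteq> C"
proof -
  have "C_k 0 \<phi>" "C_k (Suc 0) \<phi>" using assms by (auto simp: test_functions_def simp del: C_k.simps)
  then show "continuous_on UNIV \<phi>" "\<phi> differentiable (at x)" 
    "i \<in> Basis \<Longrightarrow> continuous_on UNIV (\<lambda>x. frechet_derivative \<phi> (at x) i)" by auto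
qed (use assms in \<open>auto simp: test_functions_def\<close>)

subsection \<open>Recovering bounds from test functions\<close>

lemma test_function_measurable:
  assumes "\<phi> \<in> test_functions C" shows "\<phi> \<in> borel_measurable borel"
  using test_function_props(1)[OF assms] by (rule borel_measurable_continuous_onI)

text \<open>The hypothesis is applied to \<open>box_bump a b (Suc n)\<close> and passed to the limit
  by dominated convergence. Open and closed box differ by a null set, so the limit of the bumps may
  be read as the indicator of \<open>cbox a b\<close>.\<close>

lemma integral_box_le:
  assumes f: "f \<in> loc_integrable C" and ab: "cbox a b \<subseteq> C"
    and le: "\<And>\<Psi>. \<Psi> \<in> test_functions C \<Longrightarrow> (\<And>x. 0 \<le> \<Psi> x) \<Longrightarrow>
      (LINT x:C|lebesgue. f x * \<Psi> x) \<le> M * (LINT x|lebesgue. \<Psi> x)"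
  shows "integral (cbox a b) f \<le> M * measure lebesgue (cbox a b)"
proof -
  have int: "f absolutely_integrable_on cbox a b" using f ab by (auto simp: loc_integrable_def)
  define F where "F x = indicator (cbox a b) x * f x" for x
  have F: "integrable lebesgue F" using int by (simp add: set_integrable_def F_def[abs_def])
  \<comment> \<open>Indexing by \<open>Suc n\<close> skips \<open>box_bump a b 0\<close>, which
    vanishes identically.\<close>
  have z: "x \<in> cbox a b" if "box_bump a b (Suc n) x \<noteq> 0" for n x
    using box_bump_nonzero_iff[of "Suc n" a b x] that box_subset_cbox by auto
  have bm: "box_bump a b (Suc n) \<in> borel_measurable lebesgue" for n
    using test_function_measurable[OF box_bump_test_function[OF _ ab, of "Suc n"]] by (simp add: measurable_completion)
  have bound: "\<bar>box_bump a b (Suc n) x\<bar> \<le> indicator (cbox a b) x" for n x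
    using box_bump_bounds[of a b "Suc n" x] z[of n x] by (cases "x \<in> cbox a b") auto
  have cb: "integrable lebesgue (indicator (cbox a b) :: 'a \<Rightarrow> real)"
    by (rule integrable_real_indicator) (auto simp: emeasure_lborel_cbox_finite[unfolded infinity_ennreal_def])
  have AEb: "AE x in lebesgue. x \<in> cbox a b \<longrightarrow> x \<in> box a b"
    by (rule AE_I'[of "cbox a b - box a b"]) (auto simp: negligible_iff_null_sets[symmetric] negligible_frontier_interval)
  have lim: "(\<lambda>n. box_bump a b (Suc n) x) \<longlonglongrightarrow> indicator (cbox a b) x" if "x \<in> cbox a b \<longrightarrow> x \<in> box a b" for x
  proof -
    have "indicator (box a b) x = (indicator (cbox a b) x :: real)"
      using that box_subset_cbox[of a b] by (auto simp: indicator_def)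
    then show ?thesis using LIMSEQ_Suc[OF box_bump_tendsto[of a b x]] by simp
  qed
  have "(\<lambda>n. LINT x|lebesgue. F x * box_bump a b (Suc n) x) \<longlonglongrightarrow> (LINT x|lebesgue. F x)"
  proof (rule integral_dominated_convergence)
    show "(\<lambda>x. F x * box_bump a b (Suc n) x) \<in> borel_measurable lebesgue" for n
      using F bm by (intro borel_measurable_times) auto
    show "AE x in lebesgue. (\<lambda>n. F x * box_bump a b (Suc n) x) \<longlonglongrightarrow> F x"
      using AEb
    proof eventually_elim
      case (elim x)
      show ?case using tendsto_mult[OF tendsto_const[of "F x"] lim[OF elim]]
        by (auto simp: F_def indicator_def split: if_splits)
    qed
    show "AE x in lebesgue. norm (F x * box_bump a b (Suc n) x) \<le> norm (F x)" for n
      using box_bump_bounds[of a b "Suc n"] by (auto simp: abs_mult mult_left_le)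
  qed (use F in auto)
  moreover have "(LINT x|lebesgue. F x * box_bump a b (Suc n) x) \<le> M * (LINT x|lebesgue. box_bump a b (Suc n) x)" for n
  proof -
    have "(LINT x|lebesgue. F x * box_bump a b (Suc n) x) = (LINT x:C|lebesgue. f x * box_bump a b (Suc n) x)"
      unfolding set_lebesgue_integral_def using z ab by (intro Bochner_Integration.integral_cong) (auto simp: F_def indicator_def)
    also have "\<dots> \<le> M * (LINT x|lebesgue. box_bump a b (Suc n) x)"
      using box_bump_test_function[OF _ ab] box_bump_bounds by (intro le) auto
    finally show ?thesis .
  qed
  moreover have "(\<lambda>n. M * (LINT x|lebesgue. box_bump a b (Suc n) x)) \<longlonglongrightarrow> M * (LINT x|lebesgue. indicator (cbox a b) x)"
  proof (intro tendsto_intros integral_dominated_convergence[where w="indicator (cbox a b)"])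
    show "AE x in lebesgue. (\<lambda>n. box_bump a b (Suc n) x) \<longlonglongrightarrow> indicator (cbox a b) x"
      using AEb by eventually_elim (rule lim)
  qed (use cb bm bound in auto)
  ultimately have "(LINT x|lebesgue. F x) \<le> M * (LINT x|lebesgue. indicator (cbox a b) x)"
    using LIMSEQ_le by blast
  moreover have "integral (cbox a b) f = (LINT x|lebesgue. F x)"
    using set_lebesgue_integral_eq_integral(2)[OF int] by (simp add: set_lebesgue_integral_def F_def)
  ultimately show ?thesis by simp
qed

text \<open>Every box average of \<open>f\<close> is at most \<open>M\<close>, and the averages over small cubes converge to
  \<open>f\<close> almost everywhere.\<close>

lemma AE_le_of_test_functions:
  assumes C: "open C" and f: "f \<in> loc_integrable C"
    and le: "\<And>\<Psi>. \<Psi> \<in> test_functions C \<Longrightarrow> (\<And>x. 0 \<le> \<Psi> x) \<Longrightarrow>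
      (LINT x:C|lebesgue. f x * \<Psi> x) \<le> M * (LINT x|lebesgue. \<Psi> x)"
  shows "AE x in lebesgue. x \<in> C \<longrightarrow> f x \<le> M"
proof -
  have box: "AE x in lebesgue. x \<in> cbox A B \<longrightarrow> f x \<le> M" if AB: "cbox A B \<subseteq> C" for A B
  proof -
    \<comment> \<open>Extending by 0 outside the box gives a function integrable over every box, as
      Lebesgue differentiation along the cubes with corner x requires.\<close>
    define F where "F x = (if x \<in> cbox A B then f x else 0)" for x
    have "f absolutely_integrable_on cbox A B" using f AB by (auto simp: loc_integrable_def)
    then have "F integrable_on UNIV"
      unfolding F_def integrable_restrict_UNIV by (rule set_lebesgue_integral_eq_integral(1))
    then have "F integrable_on cbox a b" for a b by (rule integrable_on_subcbox) auto
    then obtain S where S: "negligible S" "\<And>x e. x \<notin> S \<Longrightarrow> 0 < e \<Longrightarrow>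
        \<exists>d>0. \<forall>h. 0 < h \<and> h < d \<longrightarrow> norm (integral (cbox x (x + h *\<^sub>R One)) F /\<^sub>R h ^ DIM('a) - F x) < e"
      using integrable_ccontinuous_explicit[of F] by metis
    have "f x \<le> M" if x: "x \<in> box A B" "x \<notin> S" for x
    proof (rule ccontr)
      assume "\<not> f x \<le> M"
      moreover have "F x = f x" using x box_subset_cbox by (auto simp: F_def)
      ultimately have "F x - M > 0" by simp
      then obtain d where d: "d > 0" "\<And>h. 0 < h \<Longrightarrow> h < d \<Longrightarrow>
          norm (integral (cbox x (x + h *\<^sub>R One)) F /\<^sub>R h ^ DIM('a) - F x) < F x - M"
        using S(2)[OF x(2)] by blast
      have "\<exists>d'>0. ball x d' \<subseteq> box A B" using x(1) open_box open_contains_ball by blast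
      then obtain d' where d': "d' > 0" "ball x d' \<subseteq> box A B" by blast
      obtain h where h: "0 < h" "h < d" "h * norm (One::'a) < d'"
      proof
        \<comment> \<open>\<open>norm One\<close> is the diagonal of the unit cube, so this side
          length keeps the cube with corner x inside the box.\<close>
        define h where "h = min (d / 2) (d' / (2 * (norm (One::'a) + 1)))"
        have p: "norm (One::'a) + 1 > 0" by (smt (verit) norm_ge_zero)
        show "0 < h" "h < d" using d(1) d'(1) p by (auto simp: h_def)
        have "h * norm (One::'a) \<le> d' / (2 * (norm (One::'a) + 1)) * norm (One::'a)"
          by (intro mult_right_mono) (auto simp: h_def)
        also have "\<dots> < d'" using d'(1) p by (simp add: field_simps add_nonneg_pos)
        finally show "h * norm (One::'a) < d'" .
      qed
      have sub: "cbox x (x + h *\<^sub>R One) \<subseteq> box A B"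
      proof
        fix y assume y: "y \<in> cbox x (x + h *\<^sub>R One)"
        have "\<bar>(y - x) \<bullet> i\<bar> \<le> \<bar>(h *\<^sub>R One) \<bullet> i\<bar>" if "i \<in> Basis" for i
          using y that h(1) by (auto simp: mem_box inner_diff_left inner_add_left)
        then have "norm (y - x) \<le> norm (h *\<^sub>R (One::'a))" by (rule norm_le_componentwise)
        with h d' show "y \<in> box A B" by (auto simp: dist_norm norm_minus_commute)
      qed
      then have "cbox x (x + h *\<^sub>R One) \<subseteq> C" using AB box_subset_cbox by blast
      from integral_box_le[OF f this le]
      have "integral (cbox x (x + h *\<^sub>R One)) f \<le> M * measure lebesgue (cbox x (x + h *\<^sub>R One))" by blast
      also have "measure lebesgue (cbox x (x + h *\<^sub>R One)) = h ^ DIM('a)"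
        using h(1) by (simp add: content_cbox_if inner_add_left algebra_simps box_eq_empty)
      also have "integral (cbox x (x + h *\<^sub>R One)) f = integral (cbox x (x + h *\<^sub>R One)) F"
        using sub box_subset_cbox by (intro integral_cong) (auto simp: F_def)
      finally have "integral (cbox x (x + h *\<^sub>R One)) F /\<^sub>R h ^ DIM('a) \<le> M"
        using h(1) by (simp add: field_simps)
      with d(2)[OF h(1,2)] show False by (auto simp: abs_less_iff)
    qed
    then have "{x. \<not> (x \<in> cbox A B \<longrightarrow> f x \<le> M)} \<subseteq> S \<union> (cbox A B - box A B)" by auto
    moreover have "negligible (S \<union> (cbox A B - box A B))"
      using S(1) negligible_frontier_interval by (simp add: negligible_Un)
    ultimately show ?thesis
      by (intro AE_I'[of "S \<union> (cbox A B - box A B)"]) (auto simp: negligible_iff_null_sets)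
  qed
  obtain D where D: "countable D" "D \<subseteq> Pow C" "\<And>X. X \<in> D \<Longrightarrow> \<exists>a b. X = cbox a b" "\<Union>D = C"
    using open_countable_Union_open_cbox[OF C] by metis
  have "AE x in lebesgue. \<forall>X\<in>D. x \<in> X \<longrightarrow> f x \<le> M"
    using box D(2,3) by (intro AE_ball_countable[THEN iffD2] D(1)) fastforce+
  then show ?thesis by eventually_elim (use D(4) in auto)
qed

text \<open>Integrability on compact sets gives measurability only on each of them; countably many
  closed boxes exhaust the open set C, and the function is measurable piece by piece.\<close>

lemma loc_integrable_measurable:
  assumes C: "open C" and f: "f \<in> loc_integrable C"
  shows "(\<lambda>x. indicator C x * f x) \<in> borel_measurable lebesgue"
proof -
  obtain D where D: "countable D" "D \<subseteq> Pow C" "\<And>X. X \<in> D \<Longrightarrow> \<exists>a b. X = cbox a b" "\<Union>D = C"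
    using open_countable_Union_open_cbox[OF C] by metis
  show ?thesis
  proof (rule measurable_piecewise_restrict[where C="insert (- C) D"])
    show "X \<inter> space lebesgue \<in> sets lebesgue" if "X \<in> insert (- C) D" for X
    proof (cases "X = - C")
      case False
      then have "X \<in> D" using that by auto
      then obtain a b where "X = cbox a b" using D(3) by blast
      then show ?thesis by simp
    qed (use C in \<open>auto simp: borel_comp\<close>)
    show "(\<lambda>x. indicator C x * f x) \<in> borel_measurable (lebesgue_on X)" if "X \<in> insert (- C) D" for X
    proof (cases "X = - C")
      case True
      then show ?thesis by (subst measurable_cong[where g="\<lambda>_. 0"]) auto
    next
      case False
      then have "X \<in> D" using that by auto
      moreover from D(3)[OF this] obtain a b where "X = cbox a b" by blast
      ultimately have X: "compact X" "X \<subseteq> C" "X \<in> sets lebesgue" using D(2) by auto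
      then have "f absolutely_integrable_on X" using f by (auto simp: loc_integrable_def)
      then have "f \<in> borel_measurable (lebesgue_on X)" 
        using X(3) by (metis absolutely_integrable_measurable)
      then show ?thesis using X(2) by (subst measurable_cong[where g=f]) (auto simp: subsetD)
    qed
  qed (use D in auto)
qed

lemma loc_integrable_mult:
  assumes C: "open C" and f: "f \<in> loc_integrable C" and \<psi>: "continuous_on UNIV \<psi>"
    and Q: "compact Q" "Q \<subseteq> C" "{x. \<psi> x \<noteq> 0} \<subseteq> Q"
  shows "integrable lebesgue (\<lambda>x. indicator C x *\<^sub>R (f x * \<psi> x))"
proof -
  have fQ: "integrable lebesgue (\<lambda>x. indicator Q x * f x)"
    using f Q by (auto simp: loc_integrable_def set_integrable_def)
  have [measurable]: "\<psi> \<in> borel_measurable lebesgue"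
    using borel_measurable_continuous_onI[OF \<psi>] by (simp add: measurable_completion)
  have "bounded (\<psi> ` Q)"
    using compact_continuous_image[OF continuous_on_subset[OF \<psi> subset_UNIV] Q(1)] by (rule compact_imp_bounded)
  then obtain B where B: "\<And>x. x \<in> Q \<Longrightarrow> \<bar>\<psi> x\<bar> \<le> B" unfolding bounded_iff by auto
  have "integrable lebesgue (\<lambda>x. (indicator Q x * f x) * \<psi> x)"
  proof (rule Bochner_Integration.integrable_bound)
    show "integrable lebesgue (\<lambda>x. B * \<bar>indicator Q x * f x\<bar>)" using fQ by auto
    show "(\<lambda>x. (indicator Q x * f x) * \<psi> x) \<in> borel_measurable lebesgue" using fQ by measurable
    have "\<bar>indicator Q x * f x * \<psi> x\<bar> \<le> \<bar>B * \<bar>indicator Q x * f x\<bar>\<bar>" for x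
      using order_trans[OF B[of x] abs_ge_self] by (cases "x \<in> Q") (auto simp: abs_mult mult.commute intro!: mult_right_mono)
    then show "AE x in lebesgue. norm ((indicator Q x * f x) * \<psi> x) \<le> norm (B * \<bar>indicator Q x * f x\<bar>)" by simp
  qed
  moreover have "(\<lambda>x. (indicator Q x * f x) * \<psi> x) = (\<lambda>x. indicator C x *\<^sub>R (f x * \<psi> x))"
    using Q by (auto simp: indicator_def fun_eq_iff)
  ultimately show ?thesis by simp
qed

lemma test_function_subset:
  "\<phi> \<in> test_functions C \<Longrightarrow> {x. \<phi> x \<noteq> 0} \<subseteq> closure {x. \<phi> x \<noteq> 0}"
  by (rule closure_subset)

lemma loc_integrable_test_function:
  assumes "open C" "f \<in> loc_integrable C" "\<phi> \<in> test_functions C"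
  shows "integrable lebesgue (\<lambda>x. indicator C x *\<^sub>R (f x * \<phi> x))"
  using assms test_function_props[OF assms(3)]
  by (intro loc_integrable_mult[OF assms(1,2) _ _ _ test_function_subset]) auto

lemma frechet_derivative_outside_support:
  assumes "\<phi> \<in> test_functions C" "x \<notin> closure {x. \<phi> x \<noteq> 0}"
  shows "frechet_derivative \<phi> (at x) = (\<lambda>_. 0)"
proof -
  have "(\<phi> has_derivative (\<lambda>_. 0)) (at x)"
  proof (rule has_derivative_transform_within_open[of "\<lambda>_. 0" _ _ _ "- closure {x. \<phi> x \<noteq> 0}"])
    show "0 = \<phi> y" if "y \<in> - closure {x. \<phi> x \<noteq> 0}" for y
      using that closure_subset[of "{x. \<phi> x \<noteq> 0}"] by auto
  qed (use assms in auto)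
  then show ?thesis by (rule frechet_derivative_at[symmetric])
qed

lemma loc_integrable_test_function_derivative:
  assumes "open C" "f \<in> loc_integrable C" "\<phi> \<in> test_functions C" "i \<in> Basis"
  shows "integrable lebesgue (\<lambda>x. indicator C x *\<^sub>R (f x * frechet_derivative \<phi> (at x) i))"
proof -
  have "{x. frechet_derivative \<phi> (at x) i \<noteq> 0} \<subseteq> closure {x. \<phi> x \<noteq> 0}"
    using frechet_derivative_outside_support[OF assms(3)] by (metis (mono_tags, lifting) mem_Collect_eq subsetI)
  then show ?thesis
    using test_function_props[OF assms(3)] assms by (intro loc_integrable_mult[OF assms(1,2)]) auto
qed

lemma loc_integrable_diff:
  "f \<in> loc_integrable C \<Longrightarrow> g \<in> loc_integrable C \<Longrightarrow> (\<lambda>x. f x - g x) \<in> loc_integrable C"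
  by (auto simp: loc_integrable_def intro: set_integral_diff(1))

text \<open>The fundamental lemma of the calculus of variations: both f - g and g - f satisfy the
  test function bound with M = 0.\<close>

lemma AE_eq_of_test_functions:
  assumes C: "open C" and f: "f \<in> loc_integrable C" and g: "g \<in> loc_integrable C"
    and eq: "\<And>\<phi>. \<phi> \<in> test_functions C \<Longrightarrow> (LINT x:C|lebesgue. f x * \<phi> x) = (LINT x:C|lebesgue. g x * \<phi> x)"
  shows "AE x in lebesgue. x \<in> C \<longrightarrow> f x = g x"
proof -
  have "(LINT x:C|lebesgue. (f x - g x) * \<phi> x) = 0" if "\<phi> \<in> test_functions C" for \<phi>
    using eq[OF that] loc_integrable_test_function[OF C f that] loc_integrable_test_function[OF C g that]
    unfolding set_lebesgue_integral_def by (simp add: left_diff_distrib right_diff_distrib)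
  moreover from this have "(LINT x:C|lebesgue. (g x - f x) * \<phi> x) = 0" if "\<phi> \<in> test_functions C" for \<phi>
    using eq[OF that] loc_integrable_test_function[OF C f that] loc_integrable_test_function[OF C g that]
    unfolding set_lebesgue_integral_def by (simp add: left_diff_distrib right_diff_distrib)
  ultimately have "AE x in lebesgue. x \<in> C \<longrightarrow> f x - g x \<le> 0" "AE x in lebesgue. x \<in> C \<longrightarrow> g x - f x \<le> 0"
    by (intro AE_le_of_test_functions[OF C] loc_integrable_diff f g; simp)+
  then show ?thesis by eventually_elim auto
qed

text \<open>Serves to transfer membership in an L_p space from some weak partial derivative to the
  one chosen by \<open>SOME\<close> in \<open>weak_gradient\<close>.\<close>

lemma weak_partial_AE_unique:
  assumes "open C" "weak_partial C f i g" "weak_partial C f i g'"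
  shows "AE x in lebesgue. x \<in> C \<longrightarrow> g x = g' x"
  using assms by (intro AE_eq_of_test_functions) (auto simp: weak_partial_def)

lemma has_derivative_translate:
  assumes "(\<phi> has_derivative D) (at (x - v))"
  shows "((\<lambda>x. \<phi> (x - v)) has_derivative D) (at x)"
proof -
  have "((\<lambda>x. x - v) has_derivative (\<lambda>y. y)) (at x)" by (auto intro!: derivative_eq_intros)
  from has_derivative_compose[OF this assms] show ?thesis .
qed

lemma C_k_translate: "C_k k \<phi> \<Longrightarrow> C_k k (\<lambda>x. \<phi> (x - v))"
proof (induction k arbitrary: \<phi>)
  case 0
  then show ?case by (auto intro!: continuous_on_compose2[of UNIV \<phi>] continuous_intros)
next
  case (Suc k)
  have D: "((\<lambda>x. \<phi> (x - v)) has_derivative frechet_derivative \<phi> (at (x - v))) (at x)" for x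
    using Suc.prems by (intro has_derivative_translate) (simp add: frechet_derivative_works[symmetric])
  have eq: "frechet_derivative (\<lambda>x. \<phi> (x - v)) (at x) = frechet_derivative \<phi> (at (x - v))" for x
    using frechet_derivative_at[OF D] by simp
  have "C_k k (\<lambda>x. frechet_derivative \<phi> (at (x - v)) i)" if "i \<in> Basis" for i
    using Suc.IH[of "\<lambda>x. frechet_derivative \<phi> (at x) i"] Suc.prems that by simp
  then show ?case unfolding C_k.simps eq using D by (auto simp: differentiable_def)
qed

text \<open>When C is stable under adding v, shifting a test function by v keeps its support in C;
  in a convex cone this applies to every v in C.\<close>

lemma test_function_translate:
  assumes "\<phi> \<in> test_functions C" "\<And>x. x \<in> C \<Longrightarrow> x + v \<in> C"
  shows "(\<lambda>x. \<phi> (x - v)) \<in> test_functions C"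
    "frechet_derivative (\<lambda>x. \<phi> (x - v)) (at x) = frechet_derivative \<phi> (at (x - v))"
proof -
  have "{x. \<phi> (x - v) \<noteq> 0} = (+) v ` {x. \<phi> x \<noteq> 0}"
    by (auto simp: image_iff intro!: exI[of _ "x - v" for x])
  then have "closure {x. \<phi> (x - v) \<noteq> 0} = (+) v ` closure {x. \<phi> x \<noteq> 0}"
    by (simp add: closure_translation)
  then have "compact (closure {x. \<phi> (x - v) \<noteq> 0})" "closure {x. \<phi> (x - v) \<noteq> 0} \<subseteq> C"
    using compact_translation[OF test_function_props(4)[OF assms(1)], of v]
      assms(2) test_function_props(5)[OF assms(1)] by (simp_all only:) (auto simp: add.commute)
  then show "(\<lambda>x. \<phi> (x - v)) \<in> test_functions C"
    using assms by (auto simp: test_functions_def C_k_translate)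
  have "((\<lambda>x. \<phi> (x - v)) has_derivative frechet_derivative \<phi> (at (x - v))) (at x)"
    using test_function_props(2)[OF assms(1)]
    by (intro has_derivative_translate) (simp add: frechet_derivative_works[symmetric])
  then show "frechet_derivative (\<lambda>x. \<phi> (x - v)) (at x) = frechet_derivative \<phi> (at (x - v))"
    by (rule frechet_derivative_at[symmetric])
qed

subsection \<open>The estimate against test functions\<close>

lemma integrable_lborel_pairI:
  fixes f :: "'b::euclidean_space \<Rightarrow> 'c::euclidean_space \<Rightarrow> real"
  assumes f [measurable]: "case_prod f \<in> borel_measurable (lborel \<Otimes>\<^sub>M lborel)"
    and fin: "(\<integral>\<^sup>+x. \<integral>\<^sup>+y. ennreal \<bar>f x y\<bar> \<partial>lborel \<partial>lborel) < \<infinity>"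
  shows "integrable (lborel \<Otimes>\<^sub>M lborel) (case_prod f)"
proof (rule integrableI_bounded)
  have "(\<integral>\<^sup>+z. ennreal (norm (case_prod f z)) \<partial>(lborel \<Otimes>\<^sub>M lborel)) = (\<integral>\<^sup>+x. \<integral>\<^sup>+y. ennreal \<bar>f x y\<bar> \<partial>lborel \<partial>lborel)"
    by (subst lborel.nn_integral_fst[symmetric]) auto
  with fin show "(\<integral>\<^sup>+z. ennreal (norm (case_prod f z)) \<partial>(lborel \<Otimes>\<^sub>M lborel)) < \<infinity>" by simp
qed fact

text \<open>For a non-integrable function the left-hand side is 0 by the convention on the integral,
  so the bound persists in that case.\<close>

lemma abs_integral_le_nn_integral: "ennreal \<bar>LINT x|M. f x :: real\<bar> \<le> (\<integral>\<^sup>+x. ennreal \<bar>f x\<bar> \<partial>M)"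
  using integral_norm_bound_ennreal[of M f] by (cases "integrable M f") (auto simp: not_integrable_integral_eq)

lemma frechet_derivative_sum_Basis:
  fixes \<phi> :: "'a::euclidean_space \<Rightarrow> real"
  assumes "\<phi> differentiable (at x)"
  shows "frechet_derivative \<phi> (at x) u = (\<Sum>i\<in>Basis. (u \<bullet> i) * frechet_derivative \<phi> (at x) i)"
proof -
  have lin: "linear (frechet_derivative \<phi> (at x))"
    using assms by (rule linear_frechet_derivative)
  have "frechet_derivative \<phi> (at x) u = frechet_derivative \<phi> (at x) (\<Sum>i\<in>Basis. (u \<bullet> i) *\<^sub>R i)"
    by (simp add: euclidean_representation)
  also have "\<dots> = (\<Sum>i\<in>Basis. (u \<bullet> i) * frechet_derivative \<phi> (at x) i)"
    using lin by (simp add: linear_sum linear_cmul o_def)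
  finally show ?thesis .
qed

text \<open>Both sides are linear in the direction u; expanding u in the basis reduces the claim to
  the coordinate derivatives.\<close>

lemma weak_partial_direction:
  assumes C: "open C" and f: "f \<in> loc_integrable C"
    and G: "\<And>i. i \<in> Basis \<Longrightarrow> weak_partial C f i (\<lambda>x. G x \<bullet> i)" and \<phi>: "\<phi> \<in> test_functions C"
  shows "(LINT x:C|lebesgue. f x * frechet_derivative \<phi> (at x) u) = - (LINT x:C|lebesgue. (G x \<bullet> u) * \<phi> x)"
proof -
  have "(LINT x:C|lebesgue. f x * frechet_derivative \<phi> (at x) u)
      = (LINT x|lebesgue. (\<Sum>i\<in>Basis. (u \<bullet> i) * (indicator C x *\<^sub>R (f x * frechet_derivative \<phi> (at x) i))))"
    unfolding set_lebesgue_integral_def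
    by (subst frechet_derivative_sum_Basis[OF test_function_props(2)[OF \<phi>]])
      (simp add: sum_distrib_left ac_simps)
  also have "\<dots> = (\<Sum>i\<in>Basis. (u \<bullet> i) * (LINT x:C|lebesgue. f x * frechet_derivative \<phi> (at x) i))"
    unfolding set_lebesgue_integral_def
    using loc_integrable_test_function_derivative[OF C f \<phi>] by (subst Bochner_Integration.integral_sum) auto
  also have "\<dots> = (\<Sum>i\<in>Basis. - ((u \<bullet> i) * (LINT x:C|lebesgue. (G x \<bullet> i) * \<phi> x)))"
    using G \<phi> by (intro sum.cong) (auto simp: weak_partial_def)
  also have "\<dots> = - (LINT x|lebesgue. (\<Sum>i\<in>Basis. (u \<bullet> i) * (indicator C x *\<^sub>R ((G x \<bullet> i) * \<phi> x))))"
    unfolding set_lebesgue_integral_def sum_negf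
    using loc_integrable_test_function[OF C _ \<phi>] G
    by (subst Bochner_Integration.integral_sum) (auto simp: weak_partial_def)
  also have "(\<lambda>x. \<Sum>i\<in>Basis. (u \<bullet> i) * (indicator C x *\<^sub>R ((G x \<bullet> i) * \<phi> x))) = (\<lambda>x. indicator C x *\<^sub>R ((G x \<bullet> u) * \<phi> x))"
    by (subst (2) euclidean_inner) (simp add: sum_distrib_left sum_distrib_right ac_simps)
  finally show ?thesis by (simp add: set_lebesgue_integral_def)
qed

lemma continuous_on_frechet_derivative:
  assumes \<phi>: "\<phi> \<in> test_functions C"
  shows "continuous_on UNIV (\<lambda>x. frechet_derivative \<phi> (at x) u)"
  by (subst frechet_derivative_sum_Basis[OF test_function_props(2)[OF \<phi>]])
    (intro continuous_intros test_function_props(3)[OF \<phi>])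

lemma frechet_derivative_bounded:
  assumes \<phi>: "\<phi> \<in> test_functions C"
  obtains B where "B \<ge> 0" "\<And>x. \<bar>frechet_derivative \<phi> (at x) u\<bar> \<le> B"
proof -
  let ?Q = "closure {x. \<phi> x \<noteq> 0}"
  have "bounded ((\<lambda>x. frechet_derivative \<phi> (at x) u) ` ?Q)"
    by (intro compact_imp_bounded compact_continuous_image test_function_props(4)[OF \<phi>]
        continuous_on_subset[OF continuous_on_frechet_derivative[OF \<phi>] subset_UNIV])
  then obtain B where B: "\<And>x. x \<in> ?Q \<Longrightarrow> \<bar>frechet_derivative \<phi> (at x) u\<bar> \<le> B"
    unfolding bounded_iff by auto
  have "\<bar>frechet_derivative \<phi> (at x) u\<bar> \<le> \<bar>B\<bar>" for x
    using order_trans[OF B abs_ge_self] frechet_derivative_outside_support[OF \<phi>, of x] by (cases "x \<in> ?Q") auto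
  then show thesis using that[of "\<bar>B\<bar>"] by auto
qed

lemma integral_translation:
  fixes f :: "'a::euclidean_space \<Rightarrow> real"
  assumes [measurable]: "f \<in> borel_measurable borel"
  shows "(LINT x|lborel. f (x + v)) = (LINT x|lborel. f x)"
  by (subst (2) lborel_distr_plus[of v, symmetric]) (simp add: integral_distr add.commute)

lemma nn_integral_translation:
  fixes f :: "'a::euclidean_space \<Rightarrow> ennreal"
  assumes [measurable]: "f \<in> borel_measurable borel"
  shows "(\<integral>\<^sup>+x. f (x + v) \<partial>lborel) = (\<integral>\<^sup>+x. f x \<partial>lborel)"
  by (subst (2) lborel_distr_plus[of v, symmetric]) (simp add: nn_integral_distr add.commute)

text \<open>Writing \<open>\<Psi> (y - u) - \<Psi> y\<close> as an integral of directional derivatives moves all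
  differentiation onto the test function, so that the weak gradient can be used directly and
  no mollification of \<open>f\<close> is needed.\<close>

lemma weak_difference_bound:
  fixes f :: "'a::euclidean_space \<Rightarrow> real" and G :: "'a \<Rightarrow> 'a"
  assumes C: "open C" and f [measurable]: "f \<in> borel_measurable borel" and floc: "f \<in> loc_integrable C"
    and G [measurable]: "G \<in> borel_measurable borel"
    and wp: "\<And>i. i \<in> Basis \<Longrightarrow> weak_partial C f i (\<lambda>x. G x \<bullet> i)"
    and f0: "\<And>x. x \<notin> C \<Longrightarrow> f x = 0" and G0: "\<And>x. x \<notin> C \<Longrightarrow> G x = 0"
    and \<Psi>: "\<Psi> \<in> test_functions C" and u: "\<And>x t. x \<in> C \<Longrightarrow> 0 \<le> t \<Longrightarrow> x + t *\<^sub>R u \<in> C"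
  shows "ennreal \<bar>LINT y|lborel. f y * (\<Psi> (y - u) - \<Psi> y)\<bar>
    \<le> (\<integral>\<^sup>+t. (\<integral>\<^sup>+y. ennreal (\<bar>G y \<bullet> u\<bar> * \<bar>\<Psi> (y - t *\<^sub>R u)\<bar>) \<partial>lborel) * indicator {0..1} t \<partial>lborel)"
proof -
  define D where "D x = frechet_derivative \<Psi> (at x) u" for x
  have Dc: "continuous_on UNIV D"
    unfolding D_def[abs_def] by (rule continuous_on_frechet_derivative[OF \<Psi>])
  then have [measurable]: "D \<in> borel_measurable borel" by (rule borel_measurable_continuous_onI)
  have [measurable]: "\<Psi> \<in> borel_measurable borel" by (rule test_function_measurable[OF \<Psi>])
  obtain B where B: "B \<ge> 0" "\<And>x. \<bar>D x\<bar> \<le> B"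
    unfolding D_def using frechet_derivative_bounded[OF \<Psi>] by metis
  define S where "S = closure {x. \<Psi> x \<noteq> 0}"
  have S: "compact S" "S \<subseteq> C" using test_function_props(4,5)[OF \<Psi>] by (auto simp: S_def)
  have D0: "D x = 0" if "x \<notin> S" for x
    using frechet_derivative_outside_support[OF \<Psi>] that by (simp add: D_def S_def)
  \<comment> \<open>The supports of all shifts of \<Psi> by t u with 0 \<le> t \<le> 1 lie in this
    compact subset of C, on which f is integrable; this yields the integrable majorant of F.\<close>
  define Q where "Q = (\<lambda>(t, x). x + t *\<^sub>R u) ` ({0..1::real} \<times> S)"
  have Q: "compact Q" "Q \<subseteq> C"
    using S u by (auto simp: Q_def split_beta intro!: compact_continuous_image compact_Times continuous_intros)
  have [measurable]: "Q \<in> sets borel" using Q(1) by (simp add: borel_compact)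
  have fQ: "integrable lborel (\<lambda>y. indicator Q y * f y)"
    using floc Q by (auto simp: loc_integrable_def set_integrable_def integrable_completion)
  have weak: "(LINT y|lborel. f y * D (y - t *\<^sub>R u)) = - (LINT y|lborel. (G y \<bullet> u) * \<Psi> (y - t *\<^sub>R u))" if t: "t \<ge> 0" for t
  proof -
    have tr: "(\<lambda>x. \<Psi> (x - t *\<^sub>R u)) \<in> test_functions C"
      "frechet_derivative (\<lambda>x. \<Psi> (x - t *\<^sub>R u)) (at y) = frechet_derivative \<Psi> (at (y - t *\<^sub>R u))" for y
      using test_function_translate[OF \<Psi>] u t by blast+
    have "(LINT y:C|lebesgue. f y * frechet_derivative (\<lambda>x. \<Psi> (x - t *\<^sub>R u)) (at y) u)
        = - (LINT y:C|lebesgue. (G y \<bullet> u) * \<Psi> (y - t *\<^sub>R u))"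
      by (rule weak_partial_direction[OF C floc wp tr(1)])
    also have "(LINT y:C|lebesgue. f y * frechet_derivative (\<lambda>x. \<Psi> (x - t *\<^sub>R u)) (at y) u)
        = (LINT y|lebesgue. f y * D (y - t *\<^sub>R u))"
      unfolding set_lebesgue_integral_def tr(2) D_def
      by (rule Bochner_Integration.integral_cong) (auto simp: f0 indicator_def)
    also have "(LINT y:C|lebesgue. (G y \<bullet> u) * \<Psi> (y - t *\<^sub>R u)) = (LINT y|lebesgue. (G y \<bullet> u) * \<Psi> (y - t *\<^sub>R u))"
      unfolding set_lebesgue_integral_def
      by (rule Bochner_Integration.integral_cong) (auto simp: G0 indicator_def)
    finally show ?thesis by (simp add: integral_completion)
  qed
  \<comment> \<open>Integrated over t this is the negative of f times the difference of \<Psi>;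
    integrated over y it is, for t in [0, 1], the left side of the identity \<open>weak\<close>.
    Fubini joins the two.\<close>
  define F where "F t y = indicator {0..1} t * (f y * D (y - t *\<^sub>R u))" for t :: real and y
  have F_meas [measurable]: "case_prod F \<in> borel_measurable (lborel \<Otimes>\<^sub>M lborel)"
    unfolding F_def[abs_def] by measurable
  have Fb: "\<bar>F t y\<bar> \<le> indicator {0..1} t * (B * \<bar>indicator Q y * f y\<bar>)" for t y
  proof (cases "t \<in> {0..1} \<and> y - t *\<^sub>R u \<in> S")
    case True
    then have "(\<lambda>(t, x). x + t *\<^sub>R u) (t, y - t *\<^sub>R u) \<in> Q" unfolding Q_def by (intro imageI) auto
    then have "y \<in> Q" by simp
    with True B(2)[of "y - t *\<^sub>R u"] show ?thesis
      by (auto simp: F_def abs_mult mult.commute[of B] intro!: mult_left_mono)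
  qed (use D0 B in \<open>auto simp: F_def indicator_def\<close>)
  have F_int: "integrable (lborel \<Otimes>\<^sub>M lborel) (case_prod F)"
  proof (rule integrable_lborel_pairI[OF F_meas])
    have "(\<integral>\<^sup>+t. \<integral>\<^sup>+y. ennreal \<bar>F t y\<bar> \<partial>lborel \<partial>lborel)
        \<le> (\<integral>\<^sup>+(t::real). \<integral>\<^sup>+y. ennreal (B * \<bar>indicator Q y * f y\<bar>) * indicator {0..1} t \<partial>lborel \<partial>lborel)"
    proof (rule nn_integral_mono, rule nn_integral_mono)
      fix t y
      show "ennreal \<bar>F t y\<bar> \<le> ennreal (B * \<bar>indicator Q y * f y\<bar>) * indicator {0..1} t"
        using Fb[of t y] by (cases "t \<in> {0..1}") (auto intro!: ennreal_leI)
    qed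
    also have "\<dots> = (\<integral>\<^sup>+y. ennreal (B * \<bar>indicator Q y * f y\<bar>) \<partial>lborel)"
      by (simp add: nn_integral_multc nn_integral_cmult)
    also have "\<dots> < \<infinity>"
    proof -
      have "integrable lborel (\<lambda>y. B * \<bar>indicator Q y * f y\<bar>)" using fQ by auto
      then show ?thesis unfolding integrable_iff_bounded using B(1) by (auto simp: abs_mult)
    qed
    finally show "(\<integral>\<^sup>+t. \<integral>\<^sup>+y. ennreal \<bar>F t y\<bar> \<partial>lborel \<partial>lborel) < \<infinity>" .
  qed
  have ftc: "(LINT t|lborel. F t y) = - (f y * (\<Psi> (y - u) - \<Psi> y))" for y
  proof -
    have der: "((\<lambda>t. \<Psi> (y - t *\<^sub>R u)) has_vector_derivative - D (y - t *\<^sub>R u)) (at t within {0..1})" for t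
    proof -
      have 1: "((\<lambda>t. y - t *\<^sub>R u) has_derivative (\<lambda>s. - (s *\<^sub>R u))) (at t within {0..1})"
        by (auto intro!: derivative_eq_intros)
      have 2: "(\<Psi> has_derivative frechet_derivative \<Psi> (at (y - t *\<^sub>R u))) (at (y - t *\<^sub>R u))"
        using test_function_props(2)[OF \<Psi>] by (simp add: frechet_derivative_works[symmetric])
      have lin: "linear (frechet_derivative \<Psi> (at (y - t *\<^sub>R u)))"
        using test_function_props(2)[OF \<Psi>] by (rule linear_frechet_derivative)
      show ?thesis using has_derivative_compose[OF 1 2] lin
        by (simp add: has_vector_derivative_def D_def linear_neg linear_cmul)
    qed
    have "(LINT t|lborel. indicator {0..1} t *\<^sub>R (- D (y - t *\<^sub>R u))) = \<Psi> (y - 1 *\<^sub>R u) - \<Psi> (y - 0 *\<^sub>R u)"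
      by (rule integral_FTC_Icc[OF _ der])
        (auto intro!: continuous_intros continuous_on_compose2[OF Dc])
    then have "\<Psi> (y - u) - \<Psi> y = - (LINT t|lborel. indicator {0..1} t * D (y - t *\<^sub>R u))" by simp
    moreover have "(LINT t|lborel. F t y) = f y * (LINT t|lborel. indicator {0..1} t * D (y - t *\<^sub>R u))"
      unfolding F_def by (subst integral_mult_right_zero[symmetric]) (simp add: ac_simps)
    ultimately show ?thesis by simp
  qed
  have "(LINT y|lborel. f y * (\<Psi> (y - u) - \<Psi> y)) = - (LINT y|lborel. LINT t|lborel. F t y)"
    by (simp add: ftc)
  also have "\<dots> = - (LINT t|lborel. LINT y|lborel. F t y)"
    using lborel_pair.Fubini_integral[OF F_int] by simp
  finally have "ennreal \<bar>LINT y|lborel. f y * (\<Psi> (y - u) - \<Psi> y)\<bar> = ennreal \<bar>LINT t|lborel. LINT y|lborel. F t y\<bar>"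
    by simp
  also have "\<dots> \<le> (\<integral>\<^sup>+t. ennreal \<bar>LINT y|lborel. F t y\<bar> \<partial>lborel)"
    by (rule abs_integral_le_nn_integral)
  also have "\<dots> \<le> (\<integral>\<^sup>+t. (\<integral>\<^sup>+y. ennreal (\<bar>G y \<bullet> u\<bar> * \<bar>\<Psi> (y - t *\<^sub>R u)\<bar>) \<partial>lborel) * indicator {0..1} t \<partial>lborel)"
  proof (rule nn_integral_mono)
    fix t :: real
    show "ennreal \<bar>LINT y|lborel. F t y\<bar>
      \<le> (\<integral>\<^sup>+y. ennreal (\<bar>G y \<bullet> u\<bar> * \<bar>\<Psi> (y - t *\<^sub>R u)\<bar>) \<partial>lborel) * indicator {0..1} t"
    proof (cases "t \<in> {0..1}")
      case True
      then have "\<bar>LINT y|lborel. F t y\<bar> = \<bar>LINT y|lborel. (G y \<bullet> u) * \<Psi> (y - t *\<^sub>R u)\<bar>"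
        using weak[of t] by (simp add: F_def)
      with True show ?thesis
        using abs_integral_le_nn_integral[of lborel "\<lambda>y. (G y \<bullet> u) * \<Psi> (y - t *\<^sub>R u)"] by (simp add: abs_mult)
    qed (simp add: F_def)
  qed
  finally show ?thesis .
qed

section \<open>The kernel and the averaged estimate\<close>

context cone_body
begin

lemma g_fun_nonneg: "h > 0 \<Longrightarrow> 0 < u \<Longrightarrow> u \<le> h \<Longrightarrow> 0 \<le> g h u"
proof -
  assume *: "h > 0" "0 < u" "u \<le> h"
  have "u / h ^ DIM('a) \<le> 1 / u ^ (DIM('a) - 1)"
    using * power_mono[of u h "DIM('a)"] by (simp add: field_simps power_eq_if[of u "DIM('a)"])
  then show ?thesis using measure_section_pos by (simp add: g_fun_def)
qed

lemma borel_measurable_g_fun [measurable]: "g h \<in> borel_measurable borel"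
  unfolding g_fun_def[abs_def] by measurable

text \<open>Fubini, the substitution w = t u for fixed t, and the integral in t for fixed w. With r
  = N w, the integral of r / t^(d + 1) over r / h < t < 1 is exactly what \<open>g_fun\<close>
  encodes, up to the factor \<mu> h^d.\<close>

lemma kernel_integral:
  fixes n :: "'a \<Rightarrow> ennreal"
  assumes h: "h > 0" and [measurable]: "n \<in> borel_measurable borel"
  shows "(\<integral>\<^sup>+u. (\<integral>\<^sup>+t. n (t *\<^sub>R u) * ennreal (N u) * indicator {0..1} t \<partial>lborel) * indicator (V h) u \<partial>lborel)
    = ennreal (\<mu> * h ^ DIM('a)) * (\<integral>\<^sup>+w. n w * ennreal (g h (N w)) * indicator (V h) w \<partial>lborel)"
proof -
  have [measurable]: "V h \<in> sets borel" using h by (rule section_borel)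
  have dim: "DIM('a) > 0" by simp
  have inner: "(\<integral>\<^sup>+u. n (t *\<^sub>R u) * ennreal (N u) * indicator (V h) u \<partial>lborel)
      = (\<integral>\<^sup>+w. n w * ennreal (N w * (1 / t ^ (DIM('a) + 1))) * indicator {w\<in>C. N w < t * h} w \<partial>lborel)"
    if t: "t > 0" for t
  proof -
    have "(\<integral>\<^sup>+u. n (t *\<^sub>R u) * ennreal (N u) * indicator (V h) u \<partial>lborel)
      = (\<integral>\<^sup>+u. n (t *\<^sub>R u) * ennreal (N (t *\<^sub>R u) / t) * indicator {w\<in>C. N w < t * h} (t *\<^sub>R u) \<partial>lborel)"
    proof (rule nn_integral_cong)
      fix u :: 'a
      have "t *\<^sub>R u \<in> C \<longleftrightarrow> u \<in> C"
        using scaleR_cone[of u t] scaleR_cone[of "t *\<^sub>R u" "1 / t"] t by auto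
      then have "t *\<^sub>R u \<in> {w\<in>C. N w < t * h} \<longleftrightarrow> u \<in> V h"
        using t h by (simp add: section_eq body_norm_scaleR)
      then show "n (t *\<^sub>R u) * ennreal (N u) * indicator (V h) u
          = n (t *\<^sub>R u) * ennreal (N (t *\<^sub>R u) / t) * indicator {w\<in>C. N w < t * h} (t *\<^sub>R u)"
        using t by (simp add: body_norm_scaleR indicator_def)
    qed
    also have "\<dots> = ennreal (1 / t ^ DIM('a)) * (\<integral>\<^sup>+w. n w * ennreal (N w / t) * indicator {w\<in>C. N w < t * h} w \<partial>lborel)"
      using t by (subst nn_integral_scaleR[symmetric]) auto
    also have "\<dots> = (\<integral>\<^sup>+w. ennreal (1 / t ^ DIM('a)) * (n w * ennreal (N w / t) * indicator {w\<in>C. N w < t * h} w) \<partial>lborel)"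
      by (rule nn_integral_cmult[symmetric]) measurable
    also have "\<dots> = (\<integral>\<^sup>+w. n w * ennreal (N w * (1 / t ^ (DIM('a) + 1))) * indicator {w\<in>C. N w < t * h} w \<partial>lborel)"
    proof (rule nn_integral_cong)
      fix w :: 'a
      have eq: "ennreal (1 / t ^ DIM('a)) * ennreal (N w / t) = ennreal (N w * (1 / t ^ (DIM('a) + 1)))"
        using t by (simp add: ennreal_mult'[symmetric] mult.commute)
      have "ennreal (1 / t ^ DIM('a)) * (n w * ennreal (N w / t) * indicator {w\<in>C. N w < t * h} w)
         = n w * (ennreal (1 / t ^ DIM('a)) * ennreal (N w / t)) * indicator {w\<in>C. N w < t * h} w"
        by (simp only: ac_simps)
      then show "ennreal (1 / t ^ DIM('a)) * (n w * ennreal (N w / t) * indicator {w\<in>C. N w < t * h} w)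
         = n w * ennreal (N w * (1 / t ^ (DIM('a) + 1))) * indicator {w\<in>C. N w < t * h} w"
        unfolding eq .
    qed
    finally show ?thesis .
  qed
  have rad: "(\<integral>\<^sup>+t. ennreal (N w * (1 / t ^ (DIM('a) + 1))) * indicator {w\<in>C. N w < t * h} w * indicator {0<..1} t \<partial>lborel)
     = ennreal (\<mu> * h ^ DIM('a)) * ennreal (g h (N w)) * indicator (V h) w" if w: "w \<noteq> 0" for w
  proof (cases "w \<in> V h")
    case True
    define r where "r = N w"
    have r: "r > 0" "r < h" "w \<in> C"
      using True w h body_norm_nonneg[of w] by (auto simp: section_eq r_def order_less_le)
    have "(\<integral>\<^sup>+t. ennreal (r * (1 / t ^ (DIM('a) + 1))) * indicator {w\<in>C. N w < t * h} w * indicator {0<..1} t \<partial>lborel)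
        = (\<integral>\<^sup>+t. ennreal (r * (1 / t ^ (DIM('a) + 1))) * indicator {r / h..1} t \<partial>lborel)"
    proof (rule nn_integral_cong_AE)
      show "AE t in lborel. ennreal (r * (1 / t ^ (DIM('a) + 1))) * indicator {w\<in>C. N w < t * h} w * indicator {0<..1} t
         = ennreal (r * (1 / t ^ (DIM('a) + 1))) * indicator {r / h..1} t"
        using AE_lborel_singleton[of "r / h"]
      proof eventually_elim
        case (elim t)
        have "0 < r / h" using r h by simp
        moreover have "r < t * h \<longleftrightarrow> r / h < t" using h by (simp add: field_simps)
        ultimately have "r < t * h \<longleftrightarrow> r / h < t" "r / h < t \<Longrightarrow> 0 < t" by auto
        then show ?case using r elim by (auto simp: indicator_def r_def[symmetric])
      qed
    qed
    also have "\<dots> = ennreal (- r / (real DIM('a) * 1 ^ DIM('a)) - (- r / (real DIM('a) * (r / h) ^ DIM('a))))"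
    proof (rule nn_integral_FTC_Icc[where F="\<lambda>t. - r / (real DIM('a) * t ^ DIM('a))"])
      fix t assume t: "t \<in> {r / h..1}"
      moreover have "0 < r / h" using r h by simp
      ultimately have "t > 0" by (auto intro: less_le_trans)
      then show "((\<lambda>t. - r / (real DIM('a) * t ^ DIM('a))) has_real_derivative r * (1 / t ^ (DIM('a) + 1))) (at t)"
        by (auto intro!: derivative_eq_intros simp: field_simps power_eq_if[of t "DIM('a)"])
      show "0 \<le> r * (1 / t ^ (DIM('a) + 1))" using \<open>t > 0\<close> r by auto
    qed (use r h in auto)
    also have "- r / (real DIM('a) * 1 ^ DIM('a)) - (- r / (real DIM('a) * (r / h) ^ DIM('a))) = \<mu> * h ^ DIM('a) * g h r"
      using r h measure_section_pos dim by (simp add: g_fun_def field_simps power_eq_if[of r "DIM('a)"])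
    also have "ennreal \<dots> = ennreal (\<mu> * h ^ DIM('a)) * ennreal (g h r)"
      using h r measure_section_pos g_fun_nonneg[of h r] by (intro ennreal_mult) auto
    finally show ?thesis using True by (simp add: r_def)
  next
    case False
    have z: "ennreal (N w * (1 / t ^ (DIM('a) + 1))) * indicator {w\<in>C. N w < t * h} w * indicator {0<..1} t = 0" for t
    proof (cases "w \<in> C \<and> N w < t * h \<and> 0 < t \<and> t \<le> 1")
      case True
      then have "t * h \<le> 1 * h" using h by (intro mult_right_mono) auto
      with True have "N w < h" by linarith
      with False True h show ?thesis by (simp add: section_eq)
    qed (auto simp: indicator_def)
    show ?thesis unfolding z using False by simp
  qed
  have "(\<integral>\<^sup>+u. (\<integral>\<^sup>+t. n (t *\<^sub>R u) * ennreal (N u) * indicator {0..1} t \<partial>lborel) * indicator (V h) u \<partial>lborel)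
     = (\<integral>\<^sup>+u. \<integral>\<^sup>+t. n (t *\<^sub>R u) * ennreal (N u) * indicator {0..1} t * indicator (V h) u \<partial>lborel \<partial>lborel)"
    by (intro nn_integral_cong nn_integral_multc[symmetric]) measurable
  also have "\<dots> = (\<integral>\<^sup>+t. \<integral>\<^sup>+u. n (t *\<^sub>R u) * ennreal (N u) * indicator {0..1} t * indicator (V h) u \<partial>lborel \<partial>lborel)"
    by (rule lborel_pair.Fubini') measurable
  also have "\<dots> = (\<integral>\<^sup>+t. \<integral>\<^sup>+w. n w * (ennreal (N w * (1 / t ^ (DIM('a) + 1))) * indicator {w\<in>C. N w < t * h} w * indicator {0<..1} t) \<partial>lborel \<partial>lborel)"
  proof (rule nn_integral_cong_AE)
    show "AE t in lborel. (\<integral>\<^sup>+u. n (t *\<^sub>R u) * ennreal (N u) * indicator {0..1} t * indicator (V h) u \<partial>lborel) =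
      (\<integral>\<^sup>+w. n w * (ennreal (N w * (1 / t ^ (DIM('a) + 1))) * indicator {w\<in>C. N w < t * h} w * indicator {0<..1} t) \<partial>lborel)"
      using AE_lborel_singleton[of 0]
    proof eventually_elim
      case (elim t)
      show ?case
      proof (cases "t \<in> {0<..1}")
        case True
        then show ?thesis using inner[of t] by (simp add: ac_simps)
      next
        case False
        then have "t \<notin> {0..1}" using elim by auto
        then show ?thesis using False by simp
      qed
    qed
  qed
  also have "\<dots> = (\<integral>\<^sup>+w. \<integral>\<^sup>+t. n w * (ennreal (N w * (1 / t ^ (DIM('a) + 1))) * indicator {w\<in>C. N w < t * h} w * indicator {0<..1} t) \<partial>lborel \<partial>lborel)"
  proof (rule lborel_pair.Fubini')
    show "(\<lambda>(w, t). n w * (ennreal (N w * (1 / t ^ (DIM('a) + 1))) * indicator {w\<in>C. N w < t * h} w * indicator {0<..1} t))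
       \<in> borel_measurable (lborel \<Otimes>\<^sub>M lborel)"
      unfolding indicator_def split_beta by measurable
  qed
  also have "\<dots> = (\<integral>\<^sup>+w. n w * (\<integral>\<^sup>+t. ennreal (N w * (1 / t ^ (DIM('a) + 1))) * indicator {w\<in>C. N w < t * h} w * indicator {0<..1} t \<partial>lborel) \<partial>lborel)"
  proof (rule nn_integral_cong, rule nn_integral_cmult)
    fix w :: 'a
    show "(\<lambda>t. ennreal (N w * (1 / t ^ (DIM('a) + 1))) * indicator {w\<in>C. N w < t * h} w * indicator {0<..1} t) \<in> borel_measurable lborel"
      unfolding indicator_def by simp measurable
  qed
  also have "\<dots> = (\<integral>\<^sup>+w. ennreal (\<mu> * h ^ DIM('a)) * (n w * ennreal (g h (N w)) * indicator (V h) w) \<partial>lborel)"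
  proof (rule nn_integral_cong_AE)
    have "n w * (\<integral>\<^sup>+t. ennreal (N w * (1 / t ^ (DIM('a) + 1))) * indicator {w\<in>C. N w < t * h} w * indicator {0<..1} t \<partial>lborel)
        = ennreal (\<mu> * h ^ DIM('a)) * (n w * ennreal (g h (N w)) * indicator (V h) w)" if "w \<noteq> 0" for w
      unfolding rad[OF that] by (simp only: ac_simps)
    then show "AE w in lborel. n w * (\<integral>\<^sup>+t. ennreal (N w * (1 / t ^ (DIM('a) + 1))) * indicator {w\<in>C. N w < t * h} w * indicator {0<..1} t \<partial>lborel)
        = ennreal (\<mu> * h ^ DIM('a)) * (n w * ennreal (g h (N w)) * indicator (V h) w)"
      using AE_lborel_singleton[of "0 :: 'a"] by (auto elim: eventually_mono)
  qed
  also have "\<dots> = ennreal (\<mu> * h ^ DIM('a)) * (\<integral>\<^sup>+w. n w * ennreal (g h (N w)) * indicator (V h) w \<partial>lborel)"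
    by (rule nn_integral_cmult) measurable
  finally show ?thesis .
qed

text \<open>The pointwise bound |f| \<le> M1 + S / (\<mu> h^d) in weak form. The integral of f
  \<Psi> is compared with its average over shifts u in V h: the average of f (y + u) contributes S,
  and the difference \<open>J u\<close> is controlled through the gradient and the kernel.\<close>

lemma test_function_average_bound:
  fixes f :: "'a \<Rightarrow> real" and G :: "'a \<Rightarrow> 'a"
  assumes h: "h > 0"
    and f [measurable]: "f \<in> borel_measurable borel" and floc: "f \<in> loc_integrable C"
    and G [measurable]: "G \<in> borel_measurable borel"
    and wp: "\<And>i. i \<in> Basis \<Longrightarrow> weak_partial C f i (\<lambda>x. G x \<bullet> i)"
    and f0: "\<And>x. x \<notin> C \<Longrightarrow> f x = 0" and G0: "\<And>x. x \<notin> C \<Longrightarrow> G x = 0"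
    and avg: "\<And>x. x \<in> C \<Longrightarrow> \<bar>LINT u|lborel. indicator (V h) u * f (x + u)\<bar> \<le> S"
    and M1: "M1 \<ge> 0" and grad: "\<And>y. y \<in> C \<Longrightarrow>
      (\<integral>\<^sup>+w. ennreal (N\<^sub>d (G (y + w))) * ennreal (g h (N w)) * indicator (V h) w \<partial>lborel) \<le> ennreal M1"
    and \<Psi>: "\<Psi> \<in> test_functions C" and \<Psi>_nonneg: "\<And>x. 0 \<le> \<Psi> x"
  shows "\<bar>LINT y|lborel. f y * \<Psi> y\<bar> \<le> (M1 + S / (\<mu> * h ^ DIM('a))) * (LINT y|lborel. \<Psi> y)"
proof -
  define W where "W = V h"
  have [measurable]: "W \<in> sets borel" using section_borel[OF h] by (simp add: W_def)
  have WC: "u \<in> C" if "u \<in> W" for u using that by (simp add: W_def)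
  have W_em: "emeasure lborel W = ennreal (\<mu> * h ^ DIM('a))" using emeasure_section[OF h] by (simp add: W_def)
  define m where "m = \<mu> * h ^ DIM('a)"
  have m: "m > 0" using measure_section_pos h by (simp add: m_def)
  have Wm: "measure lborel W = m" using W_em m by (simp add: m_def measure_def)
  have W_int: "integrable lborel (indicator W :: 'a \<Rightarrow> real)"
    using W_em by (intro integrable_real_indicator) auto
  have [measurable]: "\<Psi> \<in> borel_measurable borel" by (rule test_function_measurable[OF \<Psi>])
  define T where "T = closure {x. \<Psi> x \<noteq> 0}"
  have T: "compact T" "T \<subseteq> C" using test_function_props(4,5)[OF \<Psi>] by (auto simp: T_def)
  have \<Psi>0: "\<Psi> y = 0" if "y \<notin> T" for y using that closure_subset[of "{x. \<Psi> x \<noteq> 0}"] by (auto simp: T_def)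
  have \<Psi>_int: "integrable lborel \<Psi>"
  proof -
    have "(\<lambda>_. 1) \<in> loc_integrable C"
      by (auto simp: loc_integrable_def set_integrable_def borel_compact emeasure_bounded_finite[OF compact_imp_bounded, unfolded infinity_ennreal_def] intro!: integrable_real_indicator)
    from loc_integrable_test_function[OF open_cone this \<Psi>]
    have "integrable lebesgue (\<lambda>x. indicator C x *\<^sub>R (1 * \<Psi> x))" .
    also have "(\<lambda>x. indicator C x *\<^sub>R (1 * \<Psi> x)) = \<Psi>" using \<Psi>0 T(2) by (auto simp: indicator_def fun_eq_iff)
    finally show ?thesis by (simp add: integrable_completion)
  qed
  define P where "P = (LINT y|lborel. \<Psi> y)"
  have P: "(\<integral>\<^sup>+y. ennreal (\<Psi> y) \<partial>lborel) = ennreal P" "P \<ge> 0"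
    using \<Psi>_int \<Psi>_nonneg by (auto simp: P_def nn_integral_eq_integral)
  have translate_C: "x + t *\<^sub>R u \<in> C" if "x \<in> C" "u \<in> W" "0 \<le> t" for x t u
    using that add_cone[OF that(1) scaleR_cone[OF WC[OF that(2)], of t]] by (cases "t = 0") auto
  have f\<Psi>_int: "integrable lborel (\<lambda>y. f y * \<Psi> (y - u))" if "u \<in> W \<or> u = 0" for u
  proof -
    have "(\<lambda>x. \<Psi> (x - u)) \<in> test_functions C"
      using that translate_C[of _ u 1] by (intro test_function_translate(1)[OF \<Psi>]) auto
    from loc_integrable_test_function[OF open_cone floc this]
    have "integrable lebesgue (\<lambda>x. indicator C x *\<^sub>R (f x * \<Psi> (x - u)))" .
    also have "(\<lambda>x. indicator C x *\<^sub>R (f x * \<Psi> (x - u))) = (\<lambda>x. f x * \<Psi> (x - u))"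
      using f0 by (auto simp: indicator_def fun_eq_iff)
    finally show ?thesis by (simp add: integrable_completion)
  qed
  \<comment> \<open>The difference is put on \<Psi> so that \<open>weak_difference_bound\<close>
    applies; a translation turns it back into a shift of f in \<open>J_eq\<close>.\<close>
  define J where "J u = (LINT y|lborel. f y * (\<Psi> (y - u) - \<Psi> y))" for u
  have J_bound: "ennreal \<bar>J u\<bar> \<le> (\<integral>\<^sup>+y. ennreal (\<Psi> y) *
      (\<integral>\<^sup>+t. ennreal (N\<^sub>d (G (y + t *\<^sub>R u))) * ennreal (N u) * indicator {0..1} t \<partial>lborel) \<partial>lborel)" if u: "u \<in> W" for u
  proof -
    have "ennreal \<bar>J u\<bar> \<le> (\<integral>\<^sup>+t. (\<integral>\<^sup>+y. ennreal (\<bar>G y \<bullet> u\<bar> * \<bar>\<Psi> (y - t *\<^sub>R u)\<bar>) \<partial>lborel) * indicator {0..1} t \<partial>lborel)"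
      unfolding J_def using u by (intro weak_difference_bound[OF open_cone f floc G wp f0 G0 \<Psi> translate_C])
    also have "\<dots> \<le> (\<integral>\<^sup>+t. (\<integral>\<^sup>+y. ennreal (\<Psi> y) * (ennreal (N\<^sub>d (G (y + t *\<^sub>R u))) * ennreal (N u)) \<partial>lborel) * indicator {0..1} t \<partial>lborel)"
    proof (rule nn_integral_mono, rule mult_right_mono)
      fix t :: real
      have "(\<integral>\<^sup>+y. ennreal (\<bar>G y \<bullet> u\<bar> * \<bar>\<Psi> (y - t *\<^sub>R u)\<bar>) \<partial>lborel) = (\<integral>\<^sup>+y. ennreal (\<bar>G (y + t *\<^sub>R u) \<bullet> u\<bar> * \<bar>\<Psi> y\<bar>) \<partial>lborel)"
        by (subst nn_integral_translation[of _ "t *\<^sub>R u", symmetric]) auto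
      also have "\<dots> \<le> (\<integral>\<^sup>+y. ennreal (\<Psi> y) * (ennreal (N\<^sub>d (G (y + t *\<^sub>R u))) * ennreal (N u)) \<partial>lborel)"
      proof (rule nn_integral_mono)
        fix y
        have "\<bar>G (y + t *\<^sub>R u) \<bullet> u\<bar> * \<bar>\<Psi> y\<bar> \<le> \<Psi> y * (N\<^sub>d (G (y + t *\<^sub>R u)) * N u)"
          using abs_inner_le_dual[of u "G (y + t *\<^sub>R u)"] \<Psi>_nonneg[of y]
          by (simp add: inner_commute mult.commute mult_left_mono)
        then show "ennreal (\<bar>G (y + t *\<^sub>R u) \<bullet> u\<bar> * \<bar>\<Psi> y\<bar>)
            \<le> ennreal (\<Psi> y) * (ennreal (N\<^sub>d (G (y + t *\<^sub>R u))) * ennreal (N u))"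
          using \<Psi>_nonneg[of y] by (simp add: ennreal_mult'[symmetric] ennreal_leI)
      qed
      finally show "(\<integral>\<^sup>+y. ennreal (\<bar>G y \<bullet> u\<bar> * \<bar>\<Psi> (y - t *\<^sub>R u)\<bar>) \<partial>lborel)
         \<le> (\<integral>\<^sup>+y. ennreal (\<Psi> y) * (ennreal (N\<^sub>d (G (y + t *\<^sub>R u))) * ennreal (N u)) \<partial>lborel)" .
    qed simp
    also have "\<dots> = (\<integral>\<^sup>+t. \<integral>\<^sup>+y. ennreal (\<Psi> y) * (ennreal (N\<^sub>d (G (y + t *\<^sub>R u))) * ennreal (N u) * indicator {0..1} t) \<partial>lborel \<partial>lborel)"
      by (subst nn_integral_multc[symmetric]) (simp_all add: ac_simps)
    also have "\<dots> = (\<integral>\<^sup>+y. \<integral>\<^sup>+t. ennreal (\<Psi> y) * (ennreal (N\<^sub>d (G (y + t *\<^sub>R u))) * ennreal (N u) * indicator {0..1} t) \<partial>lborel \<partial>lborel)"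
      by (rule lborel_pair.Fubini') measurable
    also have "\<dots> = (\<integral>\<^sup>+y. ennreal (\<Psi> y) *
      (\<integral>\<^sup>+t. ennreal (N\<^sub>d (G (y + t *\<^sub>R u))) * ennreal (N u) * indicator {0..1} t \<partial>lborel) \<partial>lborel)"
      by (intro nn_integral_cong nn_integral_cmult) measurable
    finally show ?thesis .
  qed
  have J_total: "(\<integral>\<^sup>+u. ennreal \<bar>indicator W u * J u\<bar> \<partial>lborel) \<le> ennreal (m * M1 * P)"
  proof -
    have "(\<integral>\<^sup>+u. ennreal \<bar>indicator W u * J u\<bar> \<partial>lborel)
       \<le> (\<integral>\<^sup>+u. \<integral>\<^sup>+y. ennreal (\<Psi> y) * ((\<integral>\<^sup>+t. ennreal (N\<^sub>d (G (y + t *\<^sub>R u))) * ennreal (N u) * indicator {0..1} t \<partial>lborel) * indicator W u) \<partial>lborel \<partial>lborel)"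
    proof (rule nn_integral_mono)
      fix u :: 'a
      show "ennreal \<bar>indicator W u * J u\<bar> \<le>
         (\<integral>\<^sup>+y. ennreal (\<Psi> y) * ((\<integral>\<^sup>+t. ennreal (N\<^sub>d (G (y + t *\<^sub>R u))) * ennreal (N u) * indicator {0..1} t \<partial>lborel) * indicator W u) \<partial>lborel)"
        using J_bound[of u] by (cases "u \<in> W") auto
    qed
    also have "\<dots> = (\<integral>\<^sup>+y. \<integral>\<^sup>+u. ennreal (\<Psi> y) * ((\<integral>\<^sup>+t. ennreal (N\<^sub>d (G (y + t *\<^sub>R u))) * ennreal (N u) * indicator {0..1} t \<partial>lborel) * indicator W u) \<partial>lborel \<partial>lborel)"
      by (rule lborel_pair.Fubini') measurable
    also have "\<dots> = (\<integral>\<^sup>+y. ennreal (\<Psi> y) * (\<integral>\<^sup>+u. (\<integral>\<^sup>+t. ennreal (N\<^sub>d (G (y + t *\<^sub>R u))) * ennreal (N u) * indicator {0..1} t \<partial>lborel) * indicator W u \<partial>lborel) \<partial>lborel)"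
      by (intro nn_integral_cong nn_integral_cmult) measurable
    also have "\<dots> \<le> (\<integral>\<^sup>+y. ennreal (\<Psi> y) * ennreal (m * M1) \<partial>lborel)"
    proof (rule nn_integral_mono)
      fix y :: 'a
      show "ennreal (\<Psi> y) * (\<integral>\<^sup>+u. (\<integral>\<^sup>+t. ennreal (N\<^sub>d (G (y + t *\<^sub>R u))) * ennreal (N u) * indicator {0..1} t \<partial>lborel) * indicator W u \<partial>lborel)
          \<le> ennreal (\<Psi> y) * ennreal (m * M1)"
      proof (cases "y \<in> T")
        case True
        have "(\<integral>\<^sup>+u. (\<integral>\<^sup>+t. ennreal (N\<^sub>d (G (y + t *\<^sub>R u))) * ennreal (N u) * indicator {0..1} t \<partial>lborel) * indicator W u \<partial>lborel)
            = ennreal m * (\<integral>\<^sup>+w. ennreal (N\<^sub>d (G (y + w))) * ennreal (g h (N w)) * indicator W w \<partial>lborel)"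
          unfolding W_def m_def by (rule kernel_integral[OF h]) measurable
        also have "\<dots> \<le> ennreal m * ennreal M1"
          using grad[of y] True T(2) by (intro mult_left_mono) (auto simp: W_def[symmetric])
        also have "\<dots> = ennreal (m * M1)" using m M1 by (simp add: ennreal_mult)
        finally show ?thesis by (intro mult_left_mono) auto
      qed (simp add: \<Psi>0)
    qed
    also have "\<dots> = ennreal P * ennreal (m * M1)" by (simp add: nn_integral_multc P)
    also have "\<dots> = ennreal (m * M1 * P)" using P m M1 by (simp add: ennreal_mult'[symmetric] ennreal_mult''[symmetric] mult.commute)
    finally show ?thesis .
  qed
  define F where "F y u = indicator W u * (f (y + u) * \<Psi> y)" for y u
  have F_meas: "case_prod F \<in> borel_measurable (lborel \<Otimes>\<^sub>M lborel)"
    unfolding F_def[abs_def] by measurable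
  \<comment> \<open>Contains every y + u with y in the support of \<Psi> and u in the section. It is
    compact, and inside C by \<open>add_closure_cone\<close>, which makes the double integral of F
    finite.\<close>
  define Q where "Q = (\<lambda>(x, y). x + y) ` (T \<times> closure W)"
  have Q: "compact Q" "Q \<subseteq> C"
  proof -
    have "compact (closure W)" using bounded_section[of h] by (simp add: W_def compact_closure)
    then show "compact Q" unfolding Q_def split_beta
      by (intro compact_continuous_image compact_Times T continuous_intros)
    have "closure W \<subseteq> closure C" by (simp add: W_def closure_mono)
    then show "Q \<subseteq> C" using T(2) add_closure_cone by (auto simp: Q_def)
  qed
  have [measurable]: "Q \<in> sets borel" using Q(1) by (simp add: borel_compact)
  have fQ: "(\<integral>\<^sup>+y. ennreal \<bar>indicator Q y * f y\<bar> \<partial>lborel) < \<infinity>"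
    using floc Q by (auto simp: loc_integrable_def set_integrable_def integrable_completion integrable_iff_bounded nn_integral_completion)
  have F_int: "integrable (lborel \<Otimes>\<^sub>M lborel) (case_prod F)"
  proof (rule integrable_lborel_pairI[OF F_meas])
    have "(\<integral>\<^sup>+y. \<integral>\<^sup>+u. ennreal \<bar>F y u\<bar> \<partial>lborel \<partial>lborel)
       \<le> (\<integral>\<^sup>+y. ennreal (\<Psi> y) * (\<integral>\<^sup>+z. ennreal \<bar>indicator Q z * f z\<bar> \<partial>lborel) \<partial>lborel)"
    proof (rule nn_integral_mono)
      fix y :: 'a
      have "(\<integral>\<^sup>+u. ennreal \<bar>F y u\<bar> \<partial>lborel) \<le> (\<integral>\<^sup>+u. ennreal (\<Psi> y) * ennreal \<bar>indicator Q (u + y) * f (u + y)\<bar> \<partial>lborel)"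
      proof (rule nn_integral_mono)
        fix u :: 'a
        show "ennreal \<bar>F y u\<bar> \<le> ennreal (\<Psi> y) * ennreal \<bar>indicator Q (u + y) * f (u + y)\<bar>"
        proof (cases "y \<in> T \<and> u \<in> W")
          case True
          then have "(\<lambda>(x, y). x + y) (y, u) \<in> Q"
            unfolding Q_def using closure_subset by (intro imageI) auto
          then show ?thesis using True \<Psi>_nonneg[of y]
            by (simp add: F_def abs_mult add.commute ennreal_mult'[symmetric] mult.commute)
        qed (auto simp: F_def \<Psi>0)
      qed
      also have "\<dots> = ennreal (\<Psi> y) * (\<integral>\<^sup>+u. ennreal \<bar>indicator Q (u + y) * f (u + y)\<bar> \<partial>lborel)"
        by (rule nn_integral_cmult) measurable
      also have "(\<integral>\<^sup>+u. ennreal \<bar>indicator Q (u + y) * f (u + y)\<bar> \<partial>lborel) = (\<integral>\<^sup>+z. ennreal \<bar>indicator Q z * f z\<bar> \<partial>lborel)"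
        by (rule nn_integral_translation) measurable
      finally show "(\<integral>\<^sup>+u. ennreal \<bar>F y u\<bar> \<partial>lborel) \<le> ennreal (\<Psi> y) * (\<integral>\<^sup>+z. ennreal \<bar>indicator Q z * f z\<bar> \<partial>lborel)" .
    qed
    also have "\<dots> = ennreal P * (\<integral>\<^sup>+z. ennreal \<bar>indicator Q z * f z\<bar> \<partial>lborel)"
      by (simp add: nn_integral_multc P)
    also have "\<dots> < \<infinity>" using fQ by (auto simp: ennreal_mult_less_top)
    finally show "(\<integral>\<^sup>+y. \<integral>\<^sup>+u. ennreal \<bar>F y u\<bar> \<partial>lborel \<partial>lborel) < \<infinity>" .
  qed
  define I where "I = (LINT y|lborel. f y * \<Psi> y)"
  have J_eq: "indicator W u * J u = (LINT y|lborel. F y u) - indicator W u * I" for u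
  proof (cases "u \<in> W")
    case True
    have "J u = (LINT y|lborel. f y * \<Psi> (y - u)) - I"
      unfolding J_def I_def right_diff_distrib
      using f\<Psi>_int[of u] f\<Psi>_int[of 0] True by (intro Bochner_Integration.integral_diff) auto
    also have "(LINT y|lborel. f y * \<Psi> (y - u)) = (LINT y|lborel. f (y + u) * \<Psi> (y + u - u))"
      by (rule integral_translation[symmetric]) measurable
    finally show ?thesis using True by (simp add: F_def)
  qed (simp add: F_def)
  have "(LINT u|lborel. indicator W u * J u) = (LINT u|lborel. LINT y|lborel. F y u) - (LINT u|lborel. indicator W u * I)"
    unfolding J_eq using lborel_pair.integrable_snd[OF F_int] W_int by (intro Bochner_Integration.integral_diff) auto
  also have "(LINT u|lborel. LINT y|lborel. F y u) = (LINT y|lborel. LINT u|lborel. F y u)"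
    by (rule lborel_pair.Fubini_integral[OF F_int])
  also have "(LINT u|lborel. indicator W u * I) = m * I" using Wm by simp
  finally have eq: "m * I = (LINT y|lborel. LINT u|lborel. F y u) - (LINT u|lborel. indicator W u * J u)" by simp
  have "\<bar>LINT y|lborel. LINT u|lborel. F y u\<bar> \<le> (LINT y|lborel. S * \<Psi> y)"
  proof (rule order_trans[OF integral_abs_bound integral_mono])
    show "integrable lborel (\<lambda>y. \<bar>LINT u|lborel. F y u\<bar>)" using lborel_pair.integrable_fst[OF F_int] by simp
    show "integrable lborel (\<lambda>y. S * \<Psi> y)" using \<Psi>_int by simp
    fix y :: 'a
    have "(LINT u|lborel. F y u) = \<Psi> y * (LINT u|lborel. indicator W u * f (y + u))"
      unfolding F_def by (subst integral_mult_right_zero[symmetric]) (simp add: ac_simps)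
    then show "\<bar>LINT u|lborel. F y u\<bar> \<le> S * \<Psi> y"
      using avg[of y] \<Psi>_nonneg[of y] \<Psi>0[of y] T(2)
      by (cases "y \<in> T") (auto simp: abs_mult mult.commute[of S] W_def[symmetric] subset_iff intro!: mult_left_mono)
  qed
  then have 1: "\<bar>LINT y|lborel. LINT u|lborel. F y u\<bar> \<le> S * P" by (simp add: P_def)
  have 2: "\<bar>LINT u|lborel. indicator W u * J u\<bar> \<le> m * M1 * P"
    using order_trans[OF abs_integral_le_nn_integral J_total] m M1 P(2) by (simp add: ennreal_le_iff)
  have "m * \<bar>I\<bar> = \<bar>m * I\<bar>" using m by (simp add: abs_mult)
  also have "\<dots> \<le> S * P + m * M1 * P" unfolding eq using 1 2 by linarith
  also have "\<dots> = m * ((M1 + S / m) * P)" using m by (simp add: field_simps)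
  finally have "\<bar>I\<bar> \<le> (M1 + S / m) * P" using m by simp
  then show ?thesis by (simp add: I_def P_def m_def)
qed

end

section \<open>Hoelder's inequality for translated functions\<close>

lemma nn_integral_Holder:
  fixes u v :: "'b \<Rightarrow> real"
  assumes [measurable]: "u \<in> borel_measurable M" "v \<in> borel_measurable M"
    and nonneg: "\<And>x. 0 \<le> u x" "\<And>x. 0 \<le> v x"
    and pq: "p > 1" "q > 1" "1 / p + 1 / q = 1" and AB: "0 \<le> A" "0 \<le> B"
    and u: "(\<integral>\<^sup>+x. ennreal (u x powr p) \<partial>M) \<le> ennreal (A powr p)"
    and v: "(\<integral>\<^sup>+x. ennreal (v x powr q) \<partial>M) \<le> ennreal (B powr q)"
  shows "(\<integral>\<^sup>+x. ennreal (u x * v x) \<partial>M) \<le> ennreal (A * B)"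
\<comment> \<open>The normalization by A and B needs both positive; a zero bound forces one factor
  to vanish almost everywhere.\<close>
proof (cases "A = 0 \<or> B = 0")
  case True
  have z: "AE x in M. w x = 0" if "w \<in> borel_measurable M" "(\<integral>\<^sup>+x. ennreal (w x powr s) \<partial>M) \<le> ennreal (0 powr s)" "\<And>x. 0 \<le> w x"
    for w :: "'b \<Rightarrow> real" and s
  proof -
    have [measurable]: "w \<in> borel_measurable M" by fact
    have "(\<integral>\<^sup>+x. ennreal (w x powr s) \<partial>M) = 0" using that(2) by simp
    then have "AE x in M. ennreal (w x powr s) = 0" by (subst (asm) nn_integral_0_iff_AE) auto
    then show ?thesis by eventually_elim (auto simp: ennreal_eq_0_iff)
  qed
  have "AE x in M. u x * v x = 0"
    using True
  proof
    assume "A = 0"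
    then have "AE x in M. u x = 0" using u by (intro z[of u p]) (use nonneg in auto)
    then show ?thesis by eventually_elim auto
  next
    assume "B = 0"
    then have "AE x in M. v x = 0" using v by (intro z[of v q]) (use nonneg in auto)
    then show ?thesis by eventually_elim auto
  qed
  then have "(\<integral>\<^sup>+x. ennreal (u x * v x) \<partial>M) = 0" by (subst nn_integral_0_iff_AE) auto
  then show ?thesis by simp
next
  case False
  then have AB: "A > 0" "B > 0" using AB by auto
  have "(\<integral>\<^sup>+x. ennreal (u x * v x) \<partial>M)
      \<le> (\<integral>\<^sup>+x. ennreal (A * B * A powr (- p) / p) * ennreal (u x powr p) + ennreal (A * B * B powr (- q) / q) * ennreal (v x powr q) \<partial>M)"
  proof (rule nn_integral_mono)
    fix x
    \<comment> \<open>Young's inequality for the normalized functions; integrated and multiplied by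
      A B, its right-hand side is at most A B (1 / p + 1 / q).\<close>
    have "u x / A * (v x / B) \<le> (u x / A) powr p / p + (v x / B) powr q / q"
      using pq nonneg AB by (intro Youngs_inequality) auto
    then have "A * B * (u x / A * (v x / B)) \<le> A * B * ((u x / A) powr p / p + (v x / B) powr q / q)"
      using AB by (intro mult_left_mono) auto
    also have "A * B * (u x / A * (v x / B)) = u x * v x" using AB by simp
    also have "A * B * ((u x / A) powr p / p + (v x / B) powr q / q)
        = A * B * A powr (- p) / p * u x powr p + A * B * B powr (- q) / q * v x powr q"
      using AB nonneg by (simp add: powr_divide powr_minus field_simps)
    finally show "ennreal (u x * v x) \<le> ennreal (A * B * A powr (- p) / p) * ennreal (u x powr p) + ennreal (A * B * B powr (- q) / q) * ennreal (v x powr q)"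
      using AB pq by (simp add: ennreal_mult'[symmetric] ennreal_plus[symmetric] ennreal_leI del: ennreal_plus)
  qed
  also have "\<dots> = ennreal (A * B * A powr (- p) / p) * (\<integral>\<^sup>+x. ennreal (u x powr p) \<partial>M) + ennreal (A * B * B powr (- q) / q) * (\<integral>\<^sup>+x. ennreal (v x powr q) \<partial>M)"
    by (simp add: nn_integral_add nn_integral_cmult)
  also have "\<dots> \<le> ennreal (A * B * A powr (- p) / p) * ennreal (A powr p) + ennreal (A * B * B powr (- q) / q) * ennreal (B powr q)"
    by (intro add_mono mult_left_mono u v) auto
  also have "\<dots> = ennreal (A * B * A powr (- p) / p * A powr p + A * B * B powr (- q) / q * B powr q)"
    using AB pq by (simp add: ennreal_mult'[symmetric] ennreal_plus[symmetric] del: ennreal_plus)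
  also have "A * B * A powr (- p) / p * A powr p + A * B * B powr (- q) / q * B powr q = A * B * (1 / p + 1 / q)"
    using AB by (simp add: powr_minus field_simps)
  also have "\<dots> = A * B" using pq by simp
  finally show ?thesis .
qed

lemma lebesgue_translation_measurable [measurable]: "(\<lambda>u. x + u) \<in> lebesgue \<rightarrow>\<^sub>M (lebesgue :: 'a::euclidean_space measure)"
  using lebesgue_affine_measurable[of "\<lambda>_. 1" x] by (simp add: euclidean_representation)

lemma AE_lborel_translation:
  fixes x :: "'a::euclidean_space"
  assumes "AE y in lborel. P y" shows "AE u in lborel. P (x + u)"
proof -
  obtain Z where Z: "Z \<in> null_sets lborel" "{y. \<not> P y} \<subseteq> Z" using assms by (auto simp: eventually_ae_filter)
  have "{u. u - (- x) \<in> Z} \<in> null_sets lborel" by (rule null_sets_translation[OF Z(1)])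
  then show ?thesis by (rule AE_I') (use Z(2) in \<open>auto simp: add.commute\<close>)
qed

text \<open>Since y + W stays in C, the norm of m over y + W is at most its norm over C, which makes
  the bound uniform in y.\<close>

lemma translated_Holder:
  fixes m k :: "'a::euclidean_space \<Rightarrow> real"
  assumes [measurable]: "m \<in> borel_measurable borel" "k \<in> borel_measurable borel" "W \<in> sets borel" "C \<in> sets borel"
    and m: "\<And>x. 0 \<le> m x" and WC: "\<And>w. w \<in> W \<Longrightarrow> y + w \<in> C"
    and pq: "q > 1" "r > 1" "1 / q + 1 / r = 1" and AB: "0 \<le> A" "0 \<le> B"
    and k: "(\<integral>\<^sup>+w. ennreal (\<bar>k w\<bar> powr q) * indicator W w \<partial>lborel) \<le> ennreal (A powr q)"
    and mr: "(\<integral>\<^sup>+z. ennreal (m z powr r) * indicator C z \<partial>lborel) \<le> ennreal (B powr r)"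
  shows "(\<integral>\<^sup>+w. ennreal (m (y + w)) * ennreal (k w) * indicator W w \<partial>lborel) \<le> ennreal (A * B)"
proof -
  have "(\<integral>\<^sup>+w. ennreal (m (y + w)) * ennreal (k w) * indicator W w \<partial>lborel)
     \<le> (\<integral>\<^sup>+w. ennreal ((\<bar>k w\<bar> * indicator W w) * (m (y + w) * indicator W w)) \<partial>lborel)"
  proof (rule nn_integral_mono)
    fix w :: 'a
    have "m (y + w) * k w \<le> \<bar>k w\<bar> * m (y + w)" using m[of "y + w"] by (simp add: mult.commute[of "\<bar>_\<bar>"] mult_left_mono)
    then show "ennreal (m (y + w)) * ennreal (k w) * indicator W w \<le> ennreal ((\<bar>k w\<bar> * indicator W w) * (m (y + w) * indicator W w))"
      using m[of "y + w"] by (cases "w \<in> W") (auto simp: ennreal_mult'[symmetric] ennreal_leI)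
  qed
  also have "\<dots> \<le> ennreal (A * B)"
  proof (rule nn_integral_Holder[OF _ _ _ _ pq AB])
    have "(\<integral>\<^sup>+w. ennreal ((\<bar>k w\<bar> * indicator W w) powr q) \<partial>lborel) = (\<integral>\<^sup>+w. ennreal (\<bar>k w\<bar> powr q) * indicator W w \<partial>lborel)"
      by (intro nn_integral_cong) (simp split: split_indicator)
    then show "(\<integral>\<^sup>+w. ennreal ((\<bar>k w\<bar> * indicator W w) powr q) \<partial>lborel) \<le> ennreal (A powr q)" using k by simp
    have "(\<integral>\<^sup>+w. ennreal ((m (y + w) * indicator W w) powr r) \<partial>lborel)
      \<le> (\<integral>\<^sup>+w. ennreal (m (w + y) powr r) * indicator C (w + y) \<partial>lborel)"
      using WC by (intro nn_integral_mono) (auto simp: add.commute split: split_indicator)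
    also have "\<dots> = (\<integral>\<^sup>+z. ennreal (m z powr r) * indicator C z \<partial>lborel)"
      by (rule nn_integral_translation) measurable
    finally show "(\<integral>\<^sup>+w. ennreal ((m (y + w) * indicator W w) powr r) \<partial>lborel) \<le> ennreal (B powr r)"
      using mr by simp
  qed (use m in \<open>auto intro!: mult_nonneg_nonneg\<close>)
  finally show ?thesis .
qed

section \<open>Changing representatives almost everywhere\<close>

lemma AE_lebesgue_iff: "(AE x in lebesgue. P x) \<longleftrightarrow> (AE x in lborel. P x)"
  by (rule AE_completion_iff)

lemma loc_integrable_cong_AE:
  fixes f f' :: "'a::euclidean_space \<Rightarrow> real"
  assumes f: "f \<in> loc_integrable C" and f' [measurable]: "f' \<in> borel_measurable lebesgue"
    and eq: "AE x in lebesgue. x \<in> C \<longrightarrow> f x = f' x"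
  shows "f' \<in> loc_integrable C"
  unfolding loc_integrable_def set_integrable_def
proof safe
  fix Q assume Q: "compact Q" "Q \<subseteq> C"
  have [measurable]: "Q \<in> sets lebesgue" using Q(1) by (simp add: borel_compact)
  have 1: "integrable lebesgue (\<lambda>x. indicator Q x *\<^sub>R f x)"
    using f Q by (auto simp: loc_integrable_def set_integrable_def)
  have 2: "(\<lambda>x. indicator Q x *\<^sub>R f' x) \<in> borel_measurable lebesgue" by measurable
  have 3: "AE x in lebesgue. indicator Q x *\<^sub>R f x = indicator Q x *\<^sub>R f' x"
    using eq by eventually_elim (use Q(2) in \<open>auto simp: indicator_def\<close>)
  show "integrable lebesgue (\<lambda>x. indicator Q x *\<^sub>R f' x)"
    by (rule integrable_cong_AE_imp[OF 1 2 3])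
qed

lemma set_integral_cong_AE_mult:
  fixes f f' :: "'a::euclidean_space \<Rightarrow> real"
  assumes C: "open C" and f: "f \<in> loc_integrable C" and f': "f' \<in> loc_integrable C"
    and \<psi>: "\<psi> \<in> borel_measurable borel" and eq: "AE x in lebesgue. x \<in> C \<longrightarrow> f x = f' x"
  shows "(LINT x:C|lebesgue. f x * \<psi> x) = (LINT x:C|lebesgue. f' x * \<psi> x)"
  unfolding set_lebesgue_integral_def
proof (rule integral_cong_AE)
  have [measurable]: "\<psi> \<in> borel_measurable lebesgue" using \<psi> by (simp add: measurable_completion)
  note [measurable] = loc_integrable_measurable[OF C f] loc_integrable_measurable[OF C f']
  have "(\<lambda>x. (indicator C x * f x) * \<psi> x) \<in> borel_measurable lebesgue" "(\<lambda>x. (indicator C x * f' x) * \<psi> x) \<in> borel_measurable lebesgue"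
    by measurable
  then show "(\<lambda>x. indicator C x *\<^sub>R (f x * \<psi> x)) \<in> borel_measurable lebesgue"
    "(\<lambda>x. indicator C x *\<^sub>R (f' x * \<psi> x)) \<in> borel_measurable lebesgue" by (simp_all add: ac_simps)
  show "AE x in lebesgue. indicator C x *\<^sub>R (f x * \<psi> x) = indicator C x *\<^sub>R (f' x * \<psi> x)"
    using eq by eventually_elim (auto simp: indicator_def)
qed

text \<open>Allows f and its derivatives to be replaced by Borel functions, for which product
  measurability and Fubini are available.\<close>

lemma weak_partial_cong_AE:
  assumes C: "open C" and f: "f \<in> loc_integrable C" and w: "weak_partial C f i g" and i: "i \<in> Basis"
    and f': "f' \<in> borel_measurable lebesgue" "AE x in lebesgue. x \<in> C \<longrightarrow> f x = f' x"
    and g': "g' \<in> borel_measurable lebesgue" "AE x in lebesgue. x \<in> C \<longrightarrow> g x = g' x"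
  shows "weak_partial C f' i g'"
proof -
  have g: "g \<in> loc_integrable C" using w by (simp add: weak_partial_def)
  have g'l: "g' \<in> loc_integrable C" by (rule loc_integrable_cong_AE[OF g g'])
  have f'l: "f' \<in> loc_integrable C" by (rule loc_integrable_cong_AE[OF f f'])
  have "(LINT x:C|lebesgue. f' x * frechet_derivative \<phi> (at x) i) = - (LINT x:C|lebesgue. g' x * \<phi> x)"
    if \<phi>: "\<phi> \<in> test_functions C" for \<phi>
  proof -
    have "(LINT x:C|lebesgue. f x * frechet_derivative \<phi> (at x) i) = (LINT x:C|lebesgue. f' x * frechet_derivative \<phi> (at x) i)"
      by (intro set_integral_cong_AE_mult[OF C f f'l _ f'(2)]
          borel_measurable_continuous_onI[OF continuous_on_frechet_derivative[OF \<phi>]])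
    moreover have "(LINT x:C|lebesgue. g x * \<phi> x) = (LINT x:C|lebesgue. g' x * \<phi> x)"
      by (rule set_integral_cong_AE_mult[OF C g g'l test_function_measurable[OF \<phi>] g'(2)])
    ultimately show ?thesis using w \<phi> by (auto simp: weak_partial_def)
  qed
  then show ?thesis using g'l by (simp add: weak_partial_def)
qed

lemma weak_gradient_weak_partial:
  assumes "f \<in> W1p p C" "i \<in> Basis"
  shows "weak_partial C f i (\<lambda>x. weak_gradient C f x \<bullet> i)"
proof -
  have eq: "(\<lambda>x. weak_gradient C f x \<bullet> i) = (SOME g. weak_partial C f i g)"
    unfolding weak_gradient_def by (rule ext) (rule inner_sum_left_Basis[OF assms(2)])
  have "\<exists>g. weak_partial C f i g" using assms(1)[unfolded W1p_def] assms(2) by blast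
  then show ?thesis unfolding eq by (rule someI_ex)
qed

subsection \<open>Lebesgue norms\<close>

lemma AE_lebesgue_on_iff:
  "S \<in> sets lebesgue \<Longrightarrow> (AE x in lebesgue_on S. P x) \<longleftrightarrow> (AE x in lebesgue. x \<in> S \<longrightarrow> P x)"
  by (subst AE_restrict_space_iff) auto

text \<open>A negative essential supremum would make every point of S exceptional, but a nonempty
  open set is not null. Together with finiteness this makes the conversion to a real number
  faithful.\<close>

lemma esssup_abs_nonneg:
  fixes f :: "'a::euclidean_space \<Rightarrow> real"
  assumes S: "open S" "S \<noteq> {}"
  shows "0 \<le> esssup (lebesgue_on S) (\<lambda>x. ereal \<bar>f x\<bar>)"
proof (rule ccontr)
  assume neg: "\<not> 0 \<le> esssup (lebesgue_on S) (\<lambda>x. ereal \<bar>f x\<bar>)"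
  have "AE x in lebesgue_on S. False"
    using esssup_AE[of "\<lambda>x. ereal \<bar>f x\<bar>" "lebesgue_on S"]
  proof eventually_elim
    case (elim x)
    have "(0::ereal) \<le> ereal \<bar>f x\<bar>" by simp
    with elim have "0 \<le> esssup (lebesgue_on S) (\<lambda>x. ereal \<bar>f x\<bar>)" by (rule order_trans[rotated])
    with neg show False by simp
  qed
  then have "AE x in lebesgue. x \<notin> S" using S(1) by (subst (asm) AE_lebesgue_on_iff) auto
  then have "negligible S" using S(1) by (subst (asm) AE_iff_null_sets[symmetric]) (auto simp: negligible_iff_null_sets)
  with open_not_negligible[OF S] show False by simp
qed

lemma Lp_infinity_AE:
  assumes "f \<in> Lp_space \<infinity> S" "open S" "S \<noteq> {}"
  shows "AE x in lebesgue. x \<in> S \<longrightarrow> \<bar>f x\<bar> \<le> Lp_norm \<infinity> S f"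
proof -
  let ?e = "esssup (lebesgue_on S) (\<lambda>x. ereal \<bar>f x\<bar>)"
  have "?e < \<infinity>" "0 \<le> ?e" using assms esssup_abs_nonneg by (auto simp: Lp_space_def)
  then have e: "?e = ereal (Lp_norm \<infinity> S f)" by (cases ?e) (auto simp: Lp_norm_def)
  have "AE x in lebesgue_on S. ereal \<bar>f x\<bar> \<le> ?e" by (rule esssup_AE)
  then show ?thesis unfolding e using assms(2) by (subst (asm) AE_lebesgue_on_iff) auto
qed

lemma Lp_infinityI:
  assumes f: "f \<in> borel_measurable (lebesgue_on S)" and S: "open S" "S \<noteq> {}"
    and le: "AE x in lebesgue. x \<in> S \<longrightarrow> \<bar>f x\<bar> \<le> c"
  shows "f \<in> Lp_space \<infinity> S" "Lp_norm \<infinity> S f \<le> c"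
proof -
  let ?e = "esssup (lebesgue_on S) (\<lambda>x. ereal \<bar>f x\<bar>)"
  have "AE x in lebesgue_on S. ereal \<bar>f x\<bar> \<le> ereal c"
    using le S(1) by (subst AE_lebesgue_on_iff) auto
  then have e: "?e \<le> ereal c" using f by (intro esssup_I) auto
  then show "f \<in> Lp_space \<infinity> S" using f by (auto simp: Lp_space_def le_less_trans)
  show "Lp_norm \<infinity> S f \<le> c" using e esssup_abs_nonneg[OF S, of f] by (cases ?e) (auto simp: Lp_norm_def)
qed

lemma Lp_norm_nonneg: "open S \<Longrightarrow> S \<noteq> {} \<Longrightarrow> 0 \<le> Lp_norm p S f"
  by (simp add: Lp_norm_def real_of_ereal_pos[OF esssup_abs_nonneg])

lemma Lp_norm_finite_nonneg: "0 \<le> Lp_norm (ereal r) S f"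
  by (simp add: Lp_norm_def)

lemma Lp_finite_nn_integral:
  assumes f: "f \<in> Lp_space (ereal r) S" and r: "r > 0" and S: "S \<in> sets lebesgue"
  shows "(\<integral>\<^sup>+x. ennreal (\<bar>f x\<bar> powr r) * indicator S x \<partial>lebesgue) = ennreal (Lp_norm (ereal r) S f powr r)"
proof -
  have int: "integrable (lebesgue_on S) (\<lambda>x. \<bar>f x\<bar> powr r)" using f by (auto simp: Lp_space_def)
  have "(\<integral>\<^sup>+x. ennreal (\<bar>f x\<bar> powr r) * indicator S x \<partial>lebesgue) = (\<integral>\<^sup>+x. ennreal (\<bar>f x\<bar> powr r) \<partial>lebesgue_on S)"
    using S by (subst nn_integral_restrict_space) auto
  also have "\<dots> = ennreal (LINT x|lebesgue_on S. \<bar>f x\<bar> powr r)"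
    using int by (rule nn_integral_eq_integral) auto
  also have "(LINT x|lebesgue_on S. \<bar>f x\<bar> powr r) = Lp_norm (ereal r) S f powr r"
    using r by (simp add: Lp_norm_def powr_powr integral_nonneg_AE)
  finally show ?thesis .
qed

lemma Lp_finiteI:
  fixes f :: "'a::euclidean_space \<Rightarrow> real"
  assumes f: "f \<in> borel_measurable (lebesgue_on S)" and r: "r > 0" and S: "S \<in> sets lebesgue" and A: "A \<ge> 0"
    and le: "(\<integral>\<^sup>+x. ennreal (\<bar>f x\<bar> powr r) * indicator S x \<partial>lebesgue) \<le> ennreal (A powr r)"
  shows "f \<in> Lp_space (ereal r) S" "Lp_norm (ereal r) S f \<le> A"
proof -
  note [measurable] = f
  have "(\<integral>\<^sup>+x. ennreal (\<bar>f x\<bar> powr r) * indicator S x \<partial>lebesgue) = (\<integral>\<^sup>+x. ennreal (\<bar>f x\<bar> powr r) \<partial>lebesgue_on S)"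
    using S by (subst nn_integral_restrict_space) auto
  then have le': "(\<integral>\<^sup>+x. ennreal (norm (\<bar>f x\<bar> powr r)) \<partial>lebesgue_on S) \<le> ennreal (A powr r)" using le by simp
  then have "integrable (lebesgue_on S) (\<lambda>x. \<bar>f x\<bar> powr r)"
    by (intro integrableI_bounded) (auto simp: le_less_trans)
  then show mem: "f \<in> Lp_space (ereal r) S" using f by (auto simp: Lp_space_def)
  have "ennreal (Lp_norm (ereal r) S f powr r) \<le> ennreal (A powr r)"
    using le Lp_finite_nn_integral[OF mem r S] by simp
  then have "Lp_norm (ereal r) S f powr r \<le> A powr r" by (simp add: ennreal_le_iff)
  then show "Lp_norm (ereal r) S f \<le> A"
    using r A Lp_norm_finite_nonneg powr_less_mono2[of r A "Lp_norm (ereal r) S f"] by (meson not_le)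
qed

lemma measurable_lebesgue_on_iff:
  "S \<in> sets lebesgue \<Longrightarrow> f \<in> borel_measurable (lebesgue_on S) \<longleftrightarrow> (\<lambda>x. indicator S x * f x :: real) \<in> borel_measurable lebesgue"
  by (subst borel_measurable_restrict_space_iff) auto

text \<open>Comparison with the largest term: the sum is at most \<open>card I\<close> times it, and
  its power is one of the summands on the right.\<close>

lemma powr_sum_le:
  fixes a :: "'i \<Rightarrow> real"
  assumes I: "finite I" and a: "\<And>i. i \<in> I \<Longrightarrow> 0 \<le> a i" and r: "r > 0"
  shows "(\<Sum>i\<in>I. a i) powr r \<le> real (card I) powr r * (\<Sum>i\<in>I. a i powr r)"
proof (cases "I = {}")
  case False
  define m where "m = Max (a ` I)"
  have m: "m \<in> a ` I" "\<And>i. i \<in> I \<Longrightarrow> a i \<le> m" using I False by (auto simp: m_def)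
  then have m0: "m \<ge> 0" using a by auto
  have "(\<Sum>i\<in>I. a i) \<le> real (card I) * m" using m(2) sum_bounded_above[of I a m] by simp
  then have "(\<Sum>i\<in>I. a i) powr r \<le> (real (card I) * m) powr r" using a r by (intro powr_mono2) (auto intro: sum_nonneg)
  also have "\<dots> = real (card I) powr r * m powr r" using m0 by (simp add: powr_mult)
  also have "m powr r \<le> (\<Sum>i\<in>I. a i powr r)" using m(1) I by (auto intro!: member_le_sum)
  finally show ?thesis by (simp add: mult_left_mono)
qed simp

section \<open>From test functions to the supremum bound\<close>

context cone_body
begin

lemma measurable_weak_gradient:
  assumes f: "f \<in> W1p p C"
  shows "(\<lambda>x. indicator C x *\<^sub>R weak_gradient C f x) \<in> borel_measurable lebesgue"
proof -
  have "(\<lambda>x. indicator C x * (weak_gradient C f x \<bullet> i)) \<in> borel_measurable lebesgue" if "i \<in> Basis" for i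
    using weak_gradient_weak_partial[OF f that] by (intro loc_integrable_measurable[OF open_cone]) (simp add: weak_partial_def)
  then have "(\<lambda>x. \<Sum>i\<in>Basis. (indicator C x * (weak_gradient C f x \<bullet> i)) *\<^sub>R i) \<in> borel_measurable lebesgue"
    by (intro borel_measurable_sum borel_measurable_scaleR) auto
  also have "(\<lambda>x. \<Sum>i\<in>Basis. (indicator C x * (weak_gradient C f x \<bullet> i)) *\<^sub>R i) = (\<lambda>x. indicator C x *\<^sub>R weak_gradient C f x)"
    by (simp add: scaleR_scaleR[symmetric] scaleR_sum_right[symmetric] euclidean_representation del: scaleR_scaleR)
  finally show ?thesis .
qed

lemma measurable_dual_gradient:
  assumes f: "f \<in> W1p p C"
  shows "(\<lambda>x. N\<^sub>d (weak_gradient C f x)) \<in> borel_measurable (lebesgue_on C)"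
proof -
  have [simp]: "N\<^sub>d 0 = 0" using dual_body_norm_le[of 0 0] dual_body_norm_nonneg[of 0] by simp
  have "(\<lambda>x. N\<^sub>d (indicator C x *\<^sub>R weak_gradient C f x)) \<in> borel_measurable lebesgue"
    by (rule measurable_compose[OF measurable_weak_gradient[OF f] borel_measurable_dual_body_norm])
  also have "(\<lambda>x. N\<^sub>d (indicator C x *\<^sub>R weak_gradient C f x)) = (\<lambda>x. indicator C x * N\<^sub>d (weak_gradient C f x))"
    by (auto simp: indicator_def fun_eq_iff)
  finally show ?thesis by (subst measurable_lebesgue_on_iff) auto
qed

text \<open>By uniqueness each component of \<open>weak_gradient\<close> agrees almost everywhere
  with a weak derivative in L_p, and the dual norm is at most a multiple of the sum of the absolute
  values of the components.\<close>

lemma dual_gradient_Lp: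
  assumes p: "ereal DIM('a) < p" and f: "f \<in> W1p p C"
  shows "(\<lambda>x. N\<^sub>d (weak_gradient C f x)) \<in> Lp_space p C"
proof -
  obtain R where R: "R > 0" "\<And>z. N\<^sub>d z \<le> R * norm z" using dual_body_norm_le_norm by blast
  have le: "N\<^sub>d z \<le> R * (\<Sum>i\<in>Basis. \<bar>z \<bullet> i\<bar>)" for z
    using R(2)[of z] mult_left_mono[OF norm_le_l1[of z], of R] R(1) by linarith
  have "\<exists>v. v \<in> Lp_space p C \<and> (AE x in lebesgue. x \<in> C \<longrightarrow> weak_gradient C f x \<bullet> i = v x)" if i: "i \<in> Basis" for i
  proof -
    obtain v where "v \<in> Lp_space p C" "weak_partial C f i v" using f i by (auto simp: W1p_def)
    with weak_partial_AE_unique[OF open_cone weak_gradient_weak_partial[OF f i]] show ?thesis by blast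
  qed
  then obtain v where v: "\<And>i. i \<in> Basis \<Longrightarrow> v i \<in> Lp_space p C"
    "\<And>i. i \<in> Basis \<Longrightarrow> AE x in lebesgue. x \<in> C \<longrightarrow> weak_gradient C f x \<bullet> i = v i x" by metis
  have vAE: "AE x in lebesgue. \<forall>i\<in>Basis. x \<in> C \<longrightarrow> weak_gradient C f x \<bullet> i = v i x"
    using v(2) by (intro AE_finite_allI) auto
  note meas = measurable_dual_gradient[OF f]
  show ?thesis
  proof (cases p)
    case PInf
    have "AE x in lebesgue. \<forall>i\<in>Basis. x \<in> C \<longrightarrow> \<bar>v i x\<bar> \<le> Lp_norm \<infinity> C (v i)"
      using v(1) PInf Lp_infinity_AE[OF _ open_cone cone_nonempty] by (intro AE_finite_allI) auto
    with vAE have "AE x in lebesgue. x \<in> C \<longrightarrow> \<bar>N\<^sub>d (weak_gradient C f x)\<bar> \<le> R * (\<Sum>i\<in>Basis. Lp_norm \<infinity> C (v i))"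
    proof eventually_elim
      case (elim x)
      show ?case
      proof
        assume "x \<in> C"
        with elim have "(\<Sum>i\<in>Basis. \<bar>weak_gradient C f x \<bullet> i\<bar>) \<le> (\<Sum>i\<in>Basis. Lp_norm \<infinity> C (v i))"
          by (intro sum_mono) auto
        then have "R * (\<Sum>i\<in>Basis. \<bar>weak_gradient C f x \<bullet> i\<bar>) \<le> R * (\<Sum>i\<in>Basis. Lp_norm \<infinity> C (v i))"
          using R(1) by (intro mult_left_mono) auto
        with le[of "weak_gradient C f x"] show "\<bar>N\<^sub>d (weak_gradient C f x)\<bar> \<le> R * (\<Sum>i\<in>Basis. Lp_norm \<infinity> C (v i))"
          by simp
      qed
    qed
    then show ?thesis using Lp_infinityI(1)[OF meas open_cone cone_nonempty] PInf by simp
  next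
    case (real r)
    then have r: "r > 0" using p by simp
    have int: "integrable (lebesgue_on C) (\<lambda>x. \<bar>v i x\<bar> powr r)" if "i \<in> Basis" for i
      using v(1)[OF that] real by (auto simp: Lp_space_def)
    have vm: "v i \<in> borel_measurable (lebesgue_on C)" if "i \<in> Basis" for i
      using v(1)[OF that] by (auto simp: Lp_space_def)
    have "integrable (lebesgue_on C) (\<lambda>x. \<bar>N\<^sub>d (weak_gradient C f x)\<bar> powr r)"
    proof (rule Bochner_Integration.integrable_bound)
      show "integrable (lebesgue_on C) (\<lambda>x. R powr r * (real DIM('a) powr r * (\<Sum>i\<in>Basis. \<bar>v i x\<bar> powr r)))"
        using int by (intro integrable_mult_right Bochner_Integration.integrable_sum)
      show "(\<lambda>x. \<bar>N\<^sub>d (weak_gradient C f x)\<bar> powr r) \<in> borel_measurable (lebesgue_on C)"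
        using meas by measurable
      have "AE x in lebesgue. x \<in> C \<longrightarrow> norm (\<bar>N\<^sub>d (weak_gradient C f x)\<bar> powr r) \<le> norm (R powr r * (real DIM('a) powr r * (\<Sum>i\<in>Basis. \<bar>v i x\<bar> powr r)))"
        using vAE
      proof eventually_elim
        case (elim x)
        show ?case
        proof
          assume "x \<in> C"
          then have "N\<^sub>d (weak_gradient C f x) \<le> R * (\<Sum>i\<in>Basis. \<bar>v i x\<bar>)"
            using le[of "weak_gradient C f x"] elim by simp
          then have "N\<^sub>d (weak_gradient C f x) powr r \<le> (R * (\<Sum>i\<in>Basis. \<bar>v i x\<bar>)) powr r"
            using r by (intro powr_mono2) auto
          also have "\<dots> = R powr r * (\<Sum>i\<in>Basis. \<bar>v i x\<bar>) powr r" using R by (simp add: powr_mult sum_nonneg)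
          also have "\<dots> \<le> R powr r * (real DIM('a) powr r * (\<Sum>i\<in>Basis. \<bar>v i x\<bar> powr r))"
            using r by (intro mult_left_mono powr_sum_le) auto
          finally show "norm (\<bar>N\<^sub>d (weak_gradient C f x)\<bar> powr r) \<le> norm (R powr r * (real DIM('a) powr r * (\<Sum>i\<in>Basis. \<bar>v i x\<bar> powr r)))"
            by (simp add: sum_nonneg)
        qed
      qed
      then show "AE x in lebesgue_on C. norm (\<bar>N\<^sub>d (weak_gradient C f x)\<bar> powr r) \<le> norm (R powr r * (real DIM('a) powr r * (\<Sum>i\<in>Basis. \<bar>v i x\<bar> powr r)))"
        by (subst AE_lebesgue_on_iff) auto
    qed
    then show ?thesis using meas real by (simp add: Lp_space_def)
  qed (use p in auto)
qed

text \<open>The test function estimate is applied to Borel representatives F and G of f and its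
  gradient, with Hoelder's inequality bounding the kernel integral by \<open>A * B\<close> uniformly
  in the base point. Testing against nonnegative functions then gives both f \<le> M and - f \<le>
  M.\<close>

lemma sup_bound:
  assumes p: "ereal DIM('a) < p" and h: "h > 0" and f: "f \<in> W1p p C"
    and avg: "\<And>x. x \<in> C \<Longrightarrow> \<bar>LINT u:V h|lebesgue. f (x + u)\<bar> \<le> S"
    and g: "(\<lambda>y. g h (N y)) \<in> Lp_space (conj_exp p) (V h)"
  shows "AE x in lebesgue. x \<in> C \<longrightarrow> \<bar>f x\<bar> \<le> Lp_norm (conj_exp p) (V h) (\<lambda>y. g h (N y))
    * Lp_norm p C (\<lambda>x. N\<^sub>d (weak_gradient C f x)) + S / (\<mu> * h ^ DIM('a))"
proof -
  define A B where "A = Lp_norm (conj_exp p) (V h) (\<lambda>y. g h (N y))"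
    and "B = Lp_norm p C (\<lambda>x. N\<^sub>d (weak_gradient C f x))"
  have A: "A \<ge> 0" by (simp add: A_def Lp_norm_finite_nonneg)
  have B: "B \<ge> 0" unfolding B_def by (rule Lp_norm_nonneg[OF open_cone cone_nonempty])
  have V_meas [measurable]: "V h \<in> sets borel" by (rule section_borel[OF h])
  have floc: "f \<in> loc_integrable C" using f by (simp add: W1p_def)
  obtain f0 where f0 [measurable]: "f0 \<in> borel_measurable borel" and f0_eq: "AE x in lborel. indicator C x * f x = f0 x"
    using completion_ex_borel_measurable_real[OF loc_integrable_measurable[OF open_cone floc]] by auto
  have "\<exists>v\<in>borel_measurable borel. AE x in lborel. indicator C x * (weak_gradient C f x \<bullet> i) = v x" if "i \<in> Basis" for i
  proof -
    have "(\<lambda>x. indicator C x * (weak_gradient C f x \<bullet> i)) \<in> borel_measurable lebesgue"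
      using weak_gradient_weak_partial[OF f that] by (intro loc_integrable_measurable[OF open_cone]) (simp add: weak_partial_def)
    from completion_ex_borel_measurable_real[OF this] show ?thesis by auto
  qed
  then obtain v where v: "\<And>i. i \<in> Basis \<Longrightarrow> v i \<in> borel_measurable borel"
    "\<And>i. i \<in> Basis \<Longrightarrow> AE x in lborel. indicator C x * (weak_gradient C f x \<bullet> i) = v i x" by metis
  \<comment> \<open>Both representatives are cut to 0 outside C, as the test function estimate,
    which integrates over the whole space, requires.\<close>
  define F where "F x = indicator C x * f0 x" for x
  define G where "G x = (\<Sum>i\<in>Basis. (indicator C x * v i x) *\<^sub>R i)" for x
  have F_meas [measurable]: "F \<in> borel_measurable borel" unfolding F_def[abs_def] by measurable
  have G_meas [measurable]: "G \<in> borel_measurable borel" unfolding G_def[abs_def] using v(1) by measurable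
  have F_eq: "AE x in lborel. x \<in> C \<longrightarrow> f x = F x" using f0_eq by eventually_elim (auto simp: F_def)
  have Gi: "G x \<bullet> i = indicator C x * v i x" if "i \<in> Basis" for i x
    using that by (simp add: G_def inner_sum_left_Basis)
  have Gi_eq: "AE x in lborel. x \<in> C \<longrightarrow> weak_gradient C f x \<bullet> i = G x \<bullet> i" if "i \<in> Basis" for i
    using v(2)[OF that] by eventually_elim (auto simp: Gi[OF that])
  have "AE x in lborel. \<forall>i\<in>Basis. x \<in> C \<longrightarrow> weak_gradient C f x \<bullet> i = G x \<bullet> i"
    using Gi_eq by (intro AE_finite_allI) auto
  then have G_eq: "AE x in lborel. x \<in> C \<longrightarrow> weak_gradient C f x = G x"
    by eventually_elim (auto intro: euclidean_eqI)
  have F_loc: "F \<in> loc_integrable C"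
    using F_eq by (intro loc_integrable_cong_AE[OF floc]) (auto simp: measurable_completion AE_lebesgue_iff)
  have wp: "weak_partial C F i (\<lambda>x. G x \<bullet> i)" if "i \<in> Basis" for i
    using F_eq Gi_eq[OF that] that
    by (intro weak_partial_cong_AE[OF open_cone floc weak_gradient_weak_partial[OF f]]) (auto simp: measurable_completion AE_lebesgue_iff)
  have avgF: "\<bar>LINT u|lborel. indicator (V h) u * F (x + u)\<bar> \<le> S" if x: "x \<in> C" for x
  proof -
    have xu: "x + u \<in> C" if "u \<in> V h" for u using add_cone x that by auto
    have "(LINT u|lborel. indicator (V h) u * F (x + u)) = (LINT u|lebesgue. indicator (V h) u * F (x + u))"
      by (rule integral_completion[symmetric]) measurable
    also have "\<dots> = (LINT u|lebesgue. indicator (V h) u *\<^sub>R f (x + u))"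
    proof (rule integral_cong_AE)
      have "(\<lambda>u. indicator (V h) u * F (x + u)) \<in> borel_measurable borel" by measurable
      then show "(\<lambda>u. indicator (V h) u * F (x + u)) \<in> borel_measurable lebesgue" by (simp add: measurable_completion)
      have "indicator (V h) \<in> borel_measurable lebesgue" using V_meas by (intro borel_measurable_indicator) simp
      moreover have "(\<lambda>u. indicator C (x + u) * f (x + u)) \<in> borel_measurable lebesgue"
        by (rule measurable_compose[OF lebesgue_translation_measurable loc_integrable_measurable[OF open_cone floc]])
      ultimately have "(\<lambda>u. indicator (V h) u * (indicator C (x + u) * f (x + u))) \<in> borel_measurable lebesgue"
        by (rule borel_measurable_times)
      also have "(\<lambda>u. indicator (V h) u * (indicator C (x + u) * f (x + u))) = (\<lambda>u. indicator (V h) u *\<^sub>R f (x + u))"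
        using xu by (auto simp: indicator_def fun_eq_iff)
      finally show "(\<lambda>u. indicator (V h) u *\<^sub>R f (x + u)) \<in> borel_measurable lebesgue" .
      have "AE u in lebesgue. x + u \<in> C \<longrightarrow> f (x + u) = F (x + u)"
        unfolding AE_lebesgue_iff by (rule AE_lborel_translation[OF F_eq])
      then show "AE u in lebesgue. indicator (V h) u * F (x + u) = indicator (V h) u *\<^sub>R f (x + u)"
        by eventually_elim (use xu in \<open>auto simp: indicator_def\<close>)
    qed
    finally show ?thesis using avg[OF x] by (simp add: set_lebesgue_integral_def)
  qed
  have dg: "(\<lambda>x. N\<^sub>d (weak_gradient C f x)) \<in> Lp_space p C" by (rule dual_gradient_Lp[OF p f])
  have grad: "(\<integral>\<^sup>+w. ennreal (N\<^sub>d (G (y + w))) * ennreal (g h (N w)) * indicator (V h) w \<partial>lborel) \<le> ennreal (A * B)"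
    if y: "y \<in> C" for y
  proof -
    consider (PInf) "p = \<infinity>" | (real) r where "p = ereal r" using p by (cases p) auto
    then show ?thesis
    proof cases
      case PInf
      \<comment> \<open>At p = \<infinity> the conjugate exponent is 1, and the essential supremum
        of the gradient is pulled out of the kernel integral.\<close>
      then have c1: "conj_exp p = 1" by (simp add: conj_exp_def)
      have "AE x in lborel. x \<in> C \<longrightarrow> N\<^sub>d (weak_gradient C f x) \<le> B"
        using Lp_infinity_AE[OF _ open_cone cone_nonempty, of "\<lambda>x. N\<^sub>d (weak_gradient C f x)"] dg PInf
        by (simp add: B_def AE_lebesgue_iff)
      with G_eq have "AE x in lborel. x \<in> C \<longrightarrow> N\<^sub>d (G x) \<le> B" by eventually_elim auto
      then have "AE w in lborel. y + w \<in> C \<longrightarrow> N\<^sub>d (G (y + w)) \<le> B" by (rule AE_lborel_translation)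
      then have "(\<integral>\<^sup>+w. ennreal (N\<^sub>d (G (y + w))) * ennreal (g h (N w)) * indicator (V h) w \<partial>lborel)
        \<le> (\<integral>\<^sup>+w. ennreal B * (ennreal (\<bar>g h (N w)\<bar> powr 1) * indicator (V h) w) \<partial>lborel)"
      proof (intro nn_integral_mono_AE, eventually_elim)
        case (elim w)
        show ?case
        proof (cases "w \<in> V h")
          case True
          then have "N\<^sub>d (G (y + w)) \<le> B" using elim add_cone[OF y, of w] by auto
          then have "ennreal (N\<^sub>d (G (y + w))) * ennreal (g h (N w)) \<le> ennreal B * ennreal \<bar>g h (N w)\<bar>"
            by (intro mult_mono ennreal_leI) auto
          with True show ?thesis by simp
        next
          case False
          then show ?thesis by (auto simp: indicator_def)
        qed
      qed
      also have "\<dots> = ennreal B * (\<integral>\<^sup>+w. ennreal (\<bar>g h (N w)\<bar> powr 1) * indicator (V h) w \<partial>lborel)"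
        by (rule nn_integral_cmult) measurable
      also have "(\<integral>\<^sup>+w. ennreal (\<bar>g h (N w)\<bar> powr 1) * indicator (V h) w \<partial>lborel) = ennreal (A powr 1)"
        using Lp_finite_nn_integral[of "\<lambda>y. g h (N y)" 1 "V h"] g V_meas c1
        by (simp add: A_def nn_integral_completion del: powr_one_gt_zero_iff powr_one)
      finally show ?thesis using A B by (simp add: ennreal_mult'[symmetric] mult.commute)
    next
      case (real r)
      then have r: "r > 1" using p DIM_positive[where 'a='a] by (auto simp: le_less_trans simp del: DIM_positive)
      define q where "q = r / (r - 1)"
      have q: "q > 1" "1 / q + 1 / r = 1" "conj_exp p = q"
        using r by (simp_all add: q_def conj_exp_def real diff_divide_distrib)
      show ?thesis
      proof (rule translated_Holder[OF _ _ V_meas cone_borel _ _ q(1) r q(2) A B])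
        show "y + w \<in> C" if "w \<in> V h" for w using add_cone[OF y] that by blast
        show "(\<integral>\<^sup>+w. ennreal (\<bar>g h (N w)\<bar> powr q) * indicator (V h) w \<partial>lborel) \<le> ennreal (A powr q)"
          using Lp_finite_nn_integral[of "\<lambda>y. g h (N y)" q "V h"] g V_meas q
          by (simp add: A_def nn_integral_completion)
        have "(\<integral>\<^sup>+z. ennreal (N\<^sub>d (G z) powr r) * indicator C z \<partial>lborel)
            = (\<integral>\<^sup>+z. ennreal (\<bar>N\<^sub>d (weak_gradient C f z)\<bar> powr r) * indicator C z \<partial>lborel)"
          using G_eq by (intro nn_integral_cong_AE) (auto elim!: eventually_mono split: split_indicator)
        also have "\<dots> = ennreal (B powr r)"
          using Lp_finite_nn_integral[of "\<lambda>x. N\<^sub>d (weak_gradient C f x)" r C] dg real r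
          by (simp add: B_def nn_integral_completion)
        finally show "(\<integral>\<^sup>+z. ennreal (N\<^sub>d (G z) powr r) * indicator C z \<partial>lborel) \<le> ennreal (B powr r)" by simp
      qed (auto intro: measurable_compose[OF G_meas borel_measurable_dual_body_norm]
            measurable_compose[OF borel_measurable_body_norm borel_measurable_g_fun])
    qed
  qed
  define M where "M = A * B + S / (\<mu> * h ^ DIM('a))"
  have test: "\<bar>LINT x:C|lebesgue. F x * \<Psi> x\<bar> \<le> M * (LINT x|lebesgue. \<Psi> x)"
    if \<Psi>: "\<Psi> \<in> test_functions C" "\<And>x. 0 \<le> \<Psi> x" for \<Psi>
  proof -
    have [measurable]: "\<Psi> \<in> borel_measurable borel" by (rule test_function_measurable[OF \<Psi>(1)])
    have "(LINT x:C|lebesgue. F x * \<Psi> x) = (LINT x|lebesgue. F x * \<Psi> x)"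
      unfolding set_lebesgue_integral_def by (intro Bochner_Integration.integral_cong) (auto simp: F_def indicator_def)
    moreover have "\<bar>LINT x|lborel. F x * \<Psi> x\<bar> \<le> M * (LINT x|lborel. \<Psi> x)"
      unfolding M_def
      by (rule test_function_average_bound[OF h F_meas F_loc G_meas wp _ _ avgF _ grad \<Psi>])
        (use A B in \<open>auto simp: F_def G_def\<close>)
    ultimately show ?thesis by (simp add: integral_completion)
  qed
  have "AE x in lebesgue. x \<in> C \<longrightarrow> F x \<le> M"
    using test by (intro AE_le_of_test_functions[OF open_cone F_loc]) (auto simp: abs_le_iff)
  moreover have "AE x in lebesgue. x \<in> C \<longrightarrow> - F x \<le> M"
  proof (rule AE_le_of_test_functions[OF open_cone])
    show "(\<lambda>x. - F x) \<in> loc_integrable C"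
      using loc_integrable_diff[of "\<lambda>_. 0" C F] F_loc by (auto simp: loc_integrable_def)
    show "(LINT x:C|lebesgue. - F x * \<Psi> x) \<le> M * (LINT x|lebesgue. \<Psi> x)"
      if "\<Psi> \<in> test_functions C" "\<And>x. 0 \<le> \<Psi> x" for \<Psi>
      using test[OF that] by (auto simp: abs_le_iff set_lebesgue_integral_def)
  qed
  moreover have "AE x in lebesgue. x \<in> C \<longrightarrow> f x = F x" unfolding AE_lebesgue_iff by (rule F_eq)
  ultimately have "AE x in lebesgue. x \<in> C \<longrightarrow> \<bar>f x\<bar> \<le> M"
    by eventually_elim auto
  then show ?thesis by (simp add: M_def A_def B_def)
qed

end

subsection \<open>The constants\<close>

text \<open>In terms of \<open>q = 1 / p\<close> the case \<open>p = \<infinity>\<close> is just \<open>q = 0\<close>.\<close>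

definition A_recip :: "nat \<Rightarrow> real \<Rightarrow> real" where
  "A_recip d q = 1 / real d * Beta (1 - (real d - 1) / (real d * (1 - q))) (1 / (1 - q) + 1) powr (1 - q)"

definition alpha_recip :: "nat \<Rightarrow> real \<Rightarrow> real" where
  "alpha_recip d q = real d / (real d + (1 - real d * q))"

definition a_recip :: "nat \<Rightarrow> real \<Rightarrow> real" where
  "a_recip d q = ((1 - real d * q) * A_recip d q / real d) powr alpha_recip d q * (real d / (1 - real d * q) + 1)"

definition recip_exp :: "ereal \<Rightarrow> real" where
  "recip_exp p = (if p = \<infinity> then 0 else 1 / real_of_ereal p)"

lemma fin_recip:
  assumes "d \<ge> 1" "real d < p"
  shows "A_fin d p = A_recip d (1 / p)" "alpha_fin d p = alpha_recip d (1 / p)" "a_fin d p = a_recip d (1 / p)"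
proof -
  have p: "p > 1" using assms by linarith
  have "(real d - 1) * (p / (p - 1)) / real d = (real d - 1) / (real d * (1 - 1 / p))" "p / (p - 1) = 1 / (1 - 1 / p)"
    using p assms by (auto simp: field_simps)
  then show A: "A_fin d p = A_recip d (1 / p)"
    by (simp add: A_fin_def A_recip_def Let_def mult.commute)
  have n: "p + (p - 1) * real d = p * (real d + (1 - real d * (1 / p)))" "p - real d = p * (1 - real d * (1 / p))"
    using p by (simp_all add: field_simps)
  show al: "alpha_fin d p = alpha_recip d (1 / p)"
    unfolding alpha_fin_def alpha_recip_def n(1) using p by simp
  have "(p - real d) * A_fin d p / (p * real d) = (1 - real d * (1 / p)) * A_recip d (1 / p) / real d"
    unfolding A n(2) using p by simp
  moreover have "p * real d / (p - real d) = real d / (1 - real d * (1 / p))"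
    unfolding n(2) using p by simp
  ultimately show "a_fin d p = a_recip d (1 / p)"
    by (simp only: a_fin_def a_recip_def al)
qed

lemma Beta_real_pos: "0 < x \<Longrightarrow> 0 < y \<Longrightarrow> 0 < Beta x (y :: real)"
  by (simp add: Beta_def)

lemma pos_notin_nonpos_Ints: "0 < x \<Longrightarrow> (x :: real) \<notin> \<int>\<^sub>\<le>\<^sub>0"
  by (auto elim!: nonpos_Ints_cases')

text \<open>At q = 0 the arguments of \<open>Beta\<close> are 1 / d and 2, hence positive, so the
  Gamma functions involved are continuous and nonzero there.\<close>

lemma recip_tendsto:
  assumes "d \<ge> 1"
  shows "(alpha_recip d \<longlongrightarrow> alpha_recip d 0) (at 0)" "(a_recip d \<longlongrightarrow> a_recip d 0) (at 0)"
proof -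
  have d: "real d \<ge> 1" using assms by simp
  show al: "(alpha_recip d \<longlongrightarrow> alpha_recip d 0) (at 0)"
    unfolding alpha_recip_def using d by (auto intro!: tendsto_eq_intros)
  have pos: "1 - (real d - 1) / (real d * (1 - 0)) > 0" using d by (simp add: field_simps)
  have pos2: "1 - (real d - 1) / (real d * (1 - 0)) + (1 / (1 - 0) + 1) > (0::real)"
    by (intro add_pos_pos pos) auto
  have G: "Gamma (1 - (real d - 1) / (real d * (1 - 0)) + (1 / (1 - 0) + 1)) \<noteq> (0::real)"
    by (rule less_imp_neq[THEN not_sym, OF Gamma_real_pos[OF pos2]])
  have B: "((\<lambda>q. Beta (1 - (real d - 1) / (real d * (1 - q))) (1 / (1 - q) + 1)) \<longlongrightarrow>
      Beta (1 - (real d - 1) / (real d * (1 - 0))) (1 / (1 - 0) + 1)) (at (0::real))"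
    unfolding Beta_def
    by (intro tendsto_intros pos_notin_nonpos_Ints pos pos2 G) (use d in auto)
  have Bpos: "Beta (1 - (real d - 1) / (real d * (1 - 0))) (1 / (1 - 0) + 1) \<noteq> (0::real)"
    by (rule less_imp_neq[THEN not_sym, OF Beta_real_pos[OF pos]]) simp
  have A: "(A_recip d \<longlongrightarrow> A_recip d 0) (at 0)"
    unfolding A_recip_def using B Bpos by (intro tendsto_intros) auto
  have "A_recip d 0 \<noteq> 0" using Bpos d by (simp add: A_recip_def)
  then show "(a_recip d \<longlongrightarrow> a_recip d 0) (at 0)"
    unfolding a_recip_def using d by (intro tendsto_intros A al) auto
qed

text \<open>Under q = 1 / r the limit at infinity in the definition becomes continuity of G at
  0.\<close>

lemma extend_to_infinity_recip:
  assumes d: "d \<ge> 1" and p: "ereal (real d) < p"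
    and F: "\<And>r. real d < r \<Longrightarrow> F r = G (1 / r)" and G: "(G \<longlongrightarrow> G 0) (at 0)"
  shows "extend_to_infinity F p = G (recip_exp p)"
proof (cases p)
  case PInf
  have "filterlim (\<lambda>r::real. 1 / r) (at 0) at_top"
    using filterlim_inverse_at_right_top by (auto simp: divide_inverse intro: filterlim_mono at_le)
  from filterlim_compose[OF G this] have "((\<lambda>r. G (1 / r)) \<longlongrightarrow> G 0) at_top" .
  moreover have "\<forall>\<^sub>F r in at_top. G (1 / r) = F r"
    using eventually_gt_at_top[of "real d"] by eventually_elim (simp add: F)
  ultimately have "(F \<longlongrightarrow> G 0) at_top" by (rule Lim_transform_eventually)
  then have "Lim at_top F = G 0" by (intro tendsto_Lim) auto
  then show ?thesis using PInf by (simp add: extend_to_infinity_def recip_exp_def)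
qed (use p F in \<open>auto simp: extend_to_infinity_def recip_exp_def\<close>)

lemma alpha_eq_recip: "d \<ge> 1 \<Longrightarrow> ereal (real d) < p \<Longrightarrow> alpha d p = alpha_recip d (recip_exp p)"
  unfolding alpha_def by (rule extend_to_infinity_recip) (auto simp: fin_recip recip_tendsto)

lemma a_const_eq_recip: "d \<ge> 1 \<Longrightarrow> ereal (real d) < p \<Longrightarrow> a_const d p = a_recip d (recip_exp p)"
  unfolding a_const_def by (rule extend_to_infinity_recip) (auto simp: fin_recip recip_tendsto)

lemma recip_exp_bounds:
  assumes "d \<ge> 1" "ereal (real d) < p" shows "0 \<le> recip_exp p" "real d * recip_exp p < 1" "recip_exp p < 1"
proof -
  show 1: "0 \<le> recip_exp p" "real d * recip_exp p < 1"
    using assms by (cases p; simp add: recip_exp_def)+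
  have "recip_exp p \<le> real d * recip_exp p" using assms(1) 1 by (simp add: mult_le_cancel_right1)
  with 1 show "recip_exp p < 1" by simp
qed

lemma conj_exp_recip:
  assumes "ereal 1 < p" shows "conj_exp p = 1 / (1 - recip_exp p)"
  using assms by (cases p) (auto simp: conj_exp_def recip_exp_def field_simps)

text \<open>For q < 1 the first argument of \<open>Beta\<close> is positive exactly when d q < 1,
  which is the condition p > d.\<close>

lemma A_recip_pos:
  assumes d: "d \<ge> 1" and q: "0 \<le> q" "real d * q < 1" shows "A_recip d q > 0"
proof -
  have dr: "real d \<ge> 1" using d by simp
  have "q \<le> real d * q" using dr q by (simp add: mult_le_cancel_right1)
  then have "q < 1" using q by simp
  have "(real d - 1) / (real d * (1 - q)) < 1" using dr q \<open>q < 1\<close> by (simp add: field_simps)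
  moreover have "1 / (1 - q) + 1 > 0" using \<open>q < 1\<close> by (simp add: add_pos_pos)
  ultimately have "Beta (1 - (real d - 1) / (real d * (1 - q))) (1 / (1 - q) + 1) > 0"
    by (intro Beta_real_pos) auto
  then show ?thesis using dr by (simp add: A_recip_def)
qed

subsection \<open>Optimizing over \<open>h\<close>\<close>

text \<open>The additive bound as a function of h alone: \<open>T\<^sub>1\<close> is the gradient
  term, proportional to h^\<gamma>, and \<open>T\<^sub>2\<close> the average term, proportional to
  h^(-d). S stands for whichever of the averaged seminorm and the L_1 norm is in use, D for the
  gradient norm, q for 1 / p, and R for the multiplicative bound.\<close>

locale additive_optimization =
  fixes d :: nat and q \<mu> S D :: real
  assumes d: "d \<ge> 1" and q: "0 \<le> q" "real d * q < 1" and \<mu>: "\<mu> > 0" and S: "S \<ge> 0" and D: "D \<ge> 0"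
begin

definition "\<gamma> = 1 - real d * q"
abbreviation "\<alpha> \<equiv> alpha_recip d q"
definition "T\<^sub>1 h = \<mu> powr (- q) * A_recip d q * h powr \<gamma> * D"
definition "T\<^sub>2 h = 1 / (\<mu> * h ^ d) * S"
definition "R = a_recip d q * \<mu> powr (- \<alpha> / real d) * S powr (1 - \<alpha>) * D powr \<alpha>"

lemma \<gamma>: "\<gamma> > 0" using q by (simp add: \<gamma>_def)

lemma d_pos: "real d > 0" using d by simp

lemma alpha_eq: "\<alpha> = real d / (real d + \<gamma>)" "1 - \<alpha> = \<gamma> / (real d + \<gamma>)"
proof -
  show a: "\<alpha> = real d / (real d + \<gamma>)" by (simp add: alpha_recip_def \<gamma>_def)
  show "1 - \<alpha> = \<gamma> / (real d + \<gamma>)" unfolding a using \<gamma> d_pos by (simp add: field_simps)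
qed

lemma alpha_pos: "\<alpha> > 0" "1 - \<alpha> > 0"
  unfolding alpha_eq using \<gamma> d_pos by auto

lemma T_nonneg: "h > 0 \<Longrightarrow> 0 \<le> T\<^sub>1 h" "h > 0 \<Longrightarrow> 0 \<le> T\<^sub>2 h"
  using A_recip_pos[OF d q] S D \<mu> by (auto simp: T\<^sub>1_def T\<^sub>2_def)

text \<open>The exponents of \<open>h\<close> cancel in this weighted geometric mean.\<close>

lemma weighted_mean:
  assumes h: "h > 0" and SD: "S > 0" "D > 0"
  shows "(T\<^sub>1 h / \<alpha>) powr \<alpha> * (T\<^sub>2 h / (1 - \<alpha>)) powr (1 - \<alpha>) = R"
proof -
  note pos = h SD \<mu> A_recip_pos[OF d q] \<gamma> d_pos alpha_pos
  \<comment> \<open>Both sides are positive, so it suffices to compare logarithms, where each factor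
    enters linearly.\<close>
  have ln: "ln ((T\<^sub>1 h / \<alpha>) powr \<alpha> * (T\<^sub>2 h / (1 - \<alpha>)) powr (1 - \<alpha>)) = ln R"
  proof -
    have T: "ln (T\<^sub>1 h) = - q * ln \<mu> + ln (A_recip d q) + \<gamma> * ln h + ln D" "ln (T\<^sub>2 h) = ln S - ln \<mu> - real d * ln h"
      using pos by (simp_all add: T\<^sub>1_def T\<^sub>2_def ln_mult ln_div ln_powr ln_realpow)
    have la: "ln \<alpha> = ln (real d) - ln (real d + \<gamma>)" "ln (1 - \<alpha>) = ln \<gamma> - ln (real d + \<gamma>)"
      by (simp only: alpha_eq(1), use pos in \<open>simp add: ln_div\<close>)
        (simp only: alpha_eq(2), use pos in \<open>simp add: ln_div\<close>)
    have Tp: "T\<^sub>1 h > 0" "T\<^sub>2 h > 0" using pos by (simp_all add: T\<^sub>1_def T\<^sub>2_def)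
    have l: "ln ((T\<^sub>1 h / \<alpha>) powr \<alpha> * (T\<^sub>2 h / (1 - \<alpha>)) powr (1 - \<alpha>))
       = \<alpha> * (- q * ln \<mu> + ln (A_recip d q) + \<gamma> * ln h + ln D - (ln (real d) - ln (real d + \<gamma>)))
         + (1 - \<alpha>) * (ln S - ln \<mu> - real d * ln h - (ln \<gamma> - ln (real d + \<gamma>)))"
      using pos Tp by (simp add: ln_mult ln_powr ln_div T la)
    have "real d / \<gamma> + 1 = (real d + \<gamma>) / \<gamma>" using pos by (simp add: field_simps)
    then have r: "ln R = \<alpha> * (ln \<gamma> + ln (A_recip d q) - ln (real d)) + (ln (real d + \<gamma>) - ln \<gamma>)
        + (- \<alpha> / real d) * ln \<mu> + (1 - \<alpha>) * ln S + \<alpha> * ln D"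
      using pos by (simp add: R_def a_recip_def \<gamma>_def[symmetric] ln_mult ln_powr ln_div)
    \<comment> \<open>The coefficient of ln h vanishes, and \<open>m0\<close> reduces the
      coefficient of ln \<mu> to - \<alpha> / d; the remaining terms match by rearrangement.\<close>
    have h0: "\<alpha> * \<gamma> - (1 - \<alpha>) * real d = 0" unfolding alpha_eq using pos by (simp add: field_simps)
    have "\<alpha> * (1 - q + 1 / real d) = 1"
    proof -
      have "real d * (1 - q + 1 / real d) = real d + \<gamma>" using pos by (simp add: \<gamma>_def field_simps)
      moreover have "\<alpha> * (1 - q + 1 / real d) = real d * (1 - q + 1 / real d) / (real d + \<gamma>)" by (simp add: alpha_eq(1))
      ultimately show ?thesis using pos by simp
    qed
    then have m0: "- \<alpha> * q - (1 - \<alpha>) = - \<alpha> / real d" by (simp add: algebra_simps)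
    have "\<alpha> * (- q * ln \<mu> + ln (A_recip d q) + \<gamma> * ln h + ln D - (ln (real d) - ln (real d + \<gamma>)))
         + (1 - \<alpha>) * (ln S - ln \<mu> - real d * ln h - (ln \<gamma> - ln (real d + \<gamma>)))
       = (- \<alpha> * q - (1 - \<alpha>)) * ln \<mu> + (\<alpha> * \<gamma> - (1 - \<alpha>) * real d) * ln h
         + \<alpha> * (ln \<gamma> + ln (A_recip d q) - ln (real d)) + (ln (real d + \<gamma>) - ln \<gamma>) + (1 - \<alpha>) * ln S + \<alpha> * ln D"
      by (simp add: algebra_simps)
    then show ?thesis unfolding l r h0 m0 by simp
  qed
  have "T\<^sub>1 h > 0" "T\<^sub>2 h > 0" "R > 0"
    using pos by (simp_all add: T\<^sub>1_def T\<^sub>2_def R_def a_recip_def \<gamma>_def[symmetric] add_pos_pos)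
  then show ?thesis using ln pos by (subst (asm) ln_inj_iff) auto
qed

text \<open>The weighted arithmetic-geometric mean inequality with weights \<alpha> and 1 -
  \<alpha>; if S or D is 0 then R is 0, since both exponents are positive.\<close>

lemma multiplicative_le: assumes h: "h > 0" shows "R \<le> T\<^sub>1 h + T\<^sub>2 h"
proof (cases "S = 0 \<or> D = 0")
  case True
  then have "R = 0" unfolding R_def using alpha_pos by auto
  then show ?thesis using T_nonneg[OF h] by simp
next
  case False
  then have SD: "S > 0" "D > 0" using S D by auto
  have "R = (T\<^sub>1 h / \<alpha>) powr \<alpha> * (T\<^sub>2 h / (1 - \<alpha>)) powr (1 - \<alpha>)"
    by (rule weighted_mean[OF h SD, symmetric])
  also have "\<dots> \<le> \<alpha> * (T\<^sub>1 h / \<alpha>) + (1 - \<alpha>) * (T\<^sub>2 h / (1 - \<alpha>))"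
    using h SD \<mu> A_recip_pos[OF d q] alpha_pos
    by (intro Youngs_inequality_0) (auto simp: T\<^sub>1_def T\<^sub>2_def)
  also have "\<dots> = T\<^sub>1 h + T\<^sub>2 h" using alpha_pos by simp
  finally show ?thesis .
qed

text \<open>The weighted mean inequality is an equality where
  \<open>T\<^sub>1 h / \<alpha> = T\<^sub>2 h / (1 - \<alpha>)\<close>, and some h achieves this
  when S and D are positive. If D = 0 or S = 0 the bound 0 is obtained in the limit of h to infinity
  or to 0 instead.\<close>

lemma le_multiplicative:
  assumes L: "\<And>h. h > 0 \<Longrightarrow> L \<le> T\<^sub>1 h + T\<^sub>2 h" shows "L \<le> R"
proof -
  consider "D = 0" | "S = 0" | "S > 0" "D > 0" using S D by linarith
  then show ?thesis
  proof cases
    case 1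
    have "((\<lambda>h. 1 / (\<mu> * h ^ d) * S) \<longlongrightarrow> 0) at_top"
    proof -
      have "filterlim (\<lambda>h. \<mu> * h ^ d) at_top at_top"
        using d \<mu> by (intro filterlim_tendsto_pos_mult_at_top[OF tendsto_const] filterlim_pow_at_top filterlim_ident) auto
      then have "((\<lambda>h. 1 / (\<mu> * h ^ d)) \<longlongrightarrow> 0) at_top"
        by (rule tendsto_divide_0[OF tendsto_const filterlim_mono[OF _ at_top_le_at_infinity order_refl]])
      from tendsto_mult_right[OF this, of S] show ?thesis by simp
    qed
    moreover have "\<forall>\<^sub>F h in at_top. L \<le> 1 / (\<mu> * h ^ d) * S"
      using eventually_gt_at_top[of 0]
    proof eventually_elim
      case (elim h)
      then show ?case using L[of h] unfolding T\<^sub>1_def T\<^sub>2_def unfolding 1 by simp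
    qed
    ultimately have "L \<le> 0" by (rule tendsto_lowerbound) auto
    then show ?thesis unfolding R_def unfolding 1 using alpha_pos by simp
  next
    case 2
    have "((\<lambda>h. \<mu> powr (- q) * A_recip d q * h powr \<gamma> * D) \<longlongrightarrow> \<mu> powr (- q) * A_recip d q * 0 powr \<gamma> * D) (at_right 0)"
      using \<gamma> by (intro tendsto_intros tendsto_powr') (auto simp: eventually_at_right_field intro!: exI[of _ 1])
    then have "((\<lambda>h. \<mu> powr (- q) * A_recip d q * h powr \<gamma> * D) \<longlongrightarrow> 0) (at_right 0)" using \<gamma> by simp
    moreover have "\<forall>\<^sub>F h in at_right 0. L \<le> \<mu> powr (- q) * A_recip d q * h powr \<gamma> * D"
    proof (rule eventually_at_rightI[of 0 1])
      fix h :: real assume "h \<in> {0<..<1}"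
      then show "L \<le> \<mu> powr (- q) * A_recip d q * h powr \<gamma> * D" using L[of h] unfolding T\<^sub>1_def T\<^sub>2_def unfolding 2 by simp
    qed simp
    ultimately have "L \<le> 0" by (rule tendsto_lowerbound) auto
    then show ?thesis unfolding R_def unfolding 2 using alpha_pos by simp
  next
    case 3
    note pos = 3 \<mu> A_recip_pos[OF d q] \<gamma> d_pos alpha_pos
    define X where "X = \<mu> powr (- q) * A_recip d q * D"
    have X: "X > 0" using pos by (simp add: X_def)
    \<comment> \<open>The critical point of \<open>T\<^sub>1 h + T\<^sub>2 h\<close>: the derivative
      vanishes when \<open>\<gamma> * T\<^sub>1 h = d * T\<^sub>2 h\<close>, that is, h^(d +
      \<gamma>) = d S / (\<gamma> \<mu> X).\<close>
    define h where "h = (real d * S / (\<gamma> * \<mu> * X)) powr (1 / (real d + \<gamma>))"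
    have h: "h > 0" using pos X by (simp add: h_def)
    have "h powr \<gamma> * h ^ d = h powr (real d + \<gamma>)" using h by (simp add: powr_add powr_realpow)
    also have "\<dots> = real d * S / (\<gamma> * \<mu> * X)" using pos X by (simp add: h_def powr_powr)
    finally have "T\<^sub>1 h * \<gamma> = T\<^sub>2 h * real d"
      using pos X h by (simp add: T\<^sub>1_def T\<^sub>2_def X_def field_simps)
    then have eq: "T\<^sub>1 h / \<alpha> = T\<^sub>2 h / (1 - \<alpha>)"
      unfolding alpha_eq using pos by (simp add: field_simps)
    have Tp: "T\<^sub>1 h > 0" using pos h by (simp add: T\<^sub>1_def)
    have "R = (T\<^sub>1 h / \<alpha>) powr \<alpha> * (T\<^sub>1 h / \<alpha>) powr (1 - \<alpha>)"
      using weighted_mean[OF h 3] eq by simp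
    also have "\<dots> = T\<^sub>1 h / \<alpha>" using Tp alpha_pos by (simp add: powr_add[symmetric])
    also have "\<dots> = \<alpha> * (T\<^sub>1 h / \<alpha>) + (1 - \<alpha>) * (T\<^sub>2 h / (1 - \<alpha>))" unfolding eq[symmetric] by (simp only: distrib_right[symmetric]) simp
    also have "\<dots> = T\<^sub>1 h + T\<^sub>2 h" using alpha_pos by simp
    finally show ?thesis using L[OF h] by simp
  qed
qed

end

section \<open>The exact norm of the kernel\<close>

lemma powr_prod:
  fixes A B E D a b e s :: real
  shows "0 < A \<Longrightarrow> 0 < B \<Longrightarrow> 0 < E \<Longrightarrow> 0 < D \<Longrightarrow>
    (A powr a * B powr b * (E powr e * D)) powr s = A powr (a * s) * B powr (b * s) * (E powr (e * s) * D powr s)"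
  by (simp add: powr_mult powr_powr)

lemma powr_prod':
  fixes A B E D a b e s :: real
  shows "0 < A \<Longrightarrow> 0 < B \<Longrightarrow> 0 < E \<Longrightarrow> 0 < D \<Longrightarrow>
    (A powr a * (B powr b * E powr e) * D powr d) powr s = A powr (a * s) * (B powr (b * s) * E powr (e * s)) * D powr (d * s)"
  by (simp add: powr_mult powr_powr)

context cone_body
begin

lemma powr_minus_DIM:
  assumes "x > 0" shows "x powr (- (real DIM('a) - 1)) = 1 / x ^ (DIM('a) - 1)"
proof -
  have "- (real DIM('a) - 1) = - real (DIM('a) - 1)" by (simp add: of_nat_diff Suc_leI)
  then show ?thesis using assms by (simp only: powr_minus powr_realpow inverse_eq_divide)
qed

text \<open>Isolates the ratio u / h, whose d-th power is the variable of the Beta integral.\<close>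

lemma g_fun_scaled:
  assumes u: "0 < u" "u < h"
  shows "g h u = 1 / (DIM('a) * \<mu>) * (1 / h ^ (DIM('a) - 1)) * ((u / h) powr (- (real DIM('a) - 1)) * (1 - (u / h) ^ DIM('a)))"
proof -
  have h: "h > 0" using u by simp
  have hd: "h ^ DIM('a) = h * h ^ (DIM('a) - 1)" by (simp add: power_eq_if)
  have ud: "u ^ DIM('a) = u * u ^ (DIM('a) - 1)" by (simp add: power_eq_if)
  have "(u / h) powr (- (real DIM('a) - 1)) = 1 / (u / h) ^ (DIM('a) - 1)"
    using u h by (intro powr_minus_DIM) simp
  also have "1 / h ^ (DIM('a) - 1) * (1 / (u / h) ^ (DIM('a) - 1) * (1 - (u / h) ^ DIM('a)))
      = 1 / u ^ (DIM('a) - 1) - u / h ^ DIM('a)"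
    unfolding power_divide hd ud using u h by (simp add: field_simps)
  finally have e: "1 / h ^ (DIM('a) - 1) * ((u / h) powr (- (real DIM('a) - 1)) * (1 - (u / h) ^ DIM('a)))
      = 1 / u ^ (DIM('a) - 1) - u / h ^ DIM('a)" .
  show ?thesis unfolding g_fun_def e[symmetric] by (simp only: mult.assoc)
qed

lemma g_fun_pos: assumes u: "0 < u" "u < h" shows "0 < g h u"
proof -
  have "(u / h) ^ DIM('a) < 1" using u by (intro power_Suc_less_one[where n="DIM('a) - 1", simplified]) auto
  then show ?thesis unfolding g_fun_scaled[OF u] using u measure_section_pos by (intro mult_pos_pos) auto
qed

text \<open>Polar coordinates reduce the norm to an integral over (0, h), and x = (u / h)^d turns it
  into the Beta integral of \<open>A_recip\<close>; the polar density u^(d - 1) is absorbed by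
  dx.\<close>

lemma nn_integral_g_fun_powr:
  assumes h: "h > 0" and q: "0 \<le> q" "real DIM('a) * q < 1" and s: "s = 1 / (1 - q)"
  shows "(\<integral>\<^sup>+y. ennreal (\<bar>g h (N y)\<bar> powr s) * indicator (V h) y \<partial>lborel)
    = ennreal ((\<mu> powr (- q) * A_recip DIM('a) q * h powr (1 - real DIM('a) * q)) powr s)"
proof -
  define n where "n = real DIM('a)"
  have n: "n \<ge> 1" by (simp add: n_def Suc_leI)
  have "q \<le> n * q" using n q by (simp add: mult_le_cancel_right1)
  then have q1: "q < 1" using q by (simp add: n_def)
  have s1: "s > 0" "s * (1 - q) = 1" using q1 s by auto
  define a where "a = 1 - (n - 1) / (n * (1 - q))"
  define b where "b = 1 / (1 - q) + 1"
  have a: "a > 0" using n q q1 by (simp add: a_def field_simps n_def)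
  have b: "b > 0" using q1 by (simp add: b_def add_pos_pos)
  have bs: "b - 1 = s" by (simp add: b_def s)
  \<comment> \<open>Says that (u / h)^(- (d - 1) s), the singular factor of g to the power s, is
    x^(a - 1) in the new variable.\<close>
  have as: "n * (a - 1) = - (n - 1) * s" using n q1 by (simp add: a_def s field_simps)
  define f where "f t = t powr (a - 1) * (1 - t) powr (b - 1)" for t
  define c where "c = (n * \<mu>) powr (1 - s) * h powr (- (n - 1) * s) * h powr n / n"
  have c: "c > 0" using n measure_section_pos h by (simp add: c_def)
  have pw: "n * \<mu> * u ^ (DIM('a) - 1) * \<bar>g h u\<bar> powr s = c * (f ((u / h) ^ DIM('a)) * (n * u ^ (DIM('a) - 1) / h powr n))"
    if u: "0 < u" "u < h" for u
  proof -
    have x: "0 < u / h" using u by simp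
    have x1: "(u / h) ^ DIM('a) < 1" using u by (intro power_Suc_less_one[where n="DIM('a) - 1", simplified]) auto
    have hp: "1 / h ^ (DIM('a) - 1) = h powr (- (n - 1))" unfolding n_def using h by (rule powr_minus_DIM[symmetric])
    have "\<bar>g h u\<bar> powr s = ((n * \<mu>) powr (- 1) * h powr (- (n - 1)) * ((u / h) powr (- (n - 1)) * (1 - (u / h) ^ DIM('a)))) powr s"
    proof -
      have i: "1 / (n * \<mu>) = (n * \<mu>) powr (- 1)" using n measure_section_pos by (simp add: powr_minus divide_inverse)
      have "g h u = (n * \<mu>) powr (- 1) * h powr (- (n - 1)) * ((u / h) powr (- (n - 1)) * (1 - (u / h) ^ DIM('a)))"
        unfolding g_fun_scaled[OF u] n_def[symmetric] i hp by (rule refl)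
      then show ?thesis using abs_of_pos[OF g_fun_pos[OF u]] by (simp only:)
    qed
    also have "\<dots> = (n * \<mu>) powr (- s) * h powr (- (n - 1) * s) * ((u / h) powr (- (n - 1) * s) * (1 - (u / h) ^ DIM('a)) powr s)"
      using powr_prod[of "n * \<mu>" h "u / h" "1 - (u / h) ^ DIM('a)" "- 1" "- (n - 1)" "- (n - 1)" s] x x1 n u measure_section_pos
      by simp
    also have "(u / h) powr (- (n - 1) * s) = ((u / h) ^ DIM('a)) powr (a - 1)"
      using x by (simp add: powr_realpow[symmetric] powr_powr n_def[symmetric] as)
    finally have "\<bar>g h u\<bar> powr s = (n * \<mu>) powr (- s) * h powr (- (n - 1) * s) * f ((u / h) ^ DIM('a))"
      by (simp add: f_def bs)
    moreover have "n * \<mu> * (n * \<mu>) powr (- s) = (n * \<mu>) powr (1 - s)"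
      using n measure_section_pos by (simp add: powr_diff powr_minus divide_inverse)
    ultimately show ?thesis using h n by (simp add: c_def)
  qed
  have "(\<integral>\<^sup>+y. ennreal (\<bar>g h (N y)\<bar> powr s) * indicator (V h) y \<partial>lborel)
    = (\<integral>\<^sup>+u. ennreal (DIM('a) * \<mu> * u ^ (DIM('a) - 1)) * ennreal (\<bar>g h u\<bar> powr s) * indicator {0<..<h} u \<partial>lborel)"
    by (rule nn_integral_section_polar[OF h]) measurable
  also have "\<dots> = (\<integral>\<^sup>+u. ennreal c * (ennreal (f ((u / h) ^ DIM('a)) * (n * u ^ (DIM('a) - 1) / h powr n)) * indicator {0..h} u) \<partial>lborel)"
  proof (rule nn_integral_cong_AE)
    show "AE u in lborel. ennreal (DIM('a) * \<mu> * u ^ (DIM('a) - 1)) * ennreal (\<bar>g h u\<bar> powr s) * indicator {0<..<h} u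
      = ennreal c * (ennreal (f ((u / h) ^ DIM('a)) * (n * u ^ (DIM('a) - 1) / h powr n)) * indicator {0..h} u)"
      using AE_lborel_singleton[of 0] AE_lborel_singleton[of h]
    proof eventually_elim
      case (elim u)
      show ?case
      proof (cases "0 < u \<and> u < h")
        case True
        have "ennreal (DIM('a) * \<mu> * u ^ (DIM('a) - 1)) * ennreal (\<bar>g h u\<bar> powr s) = ennreal (n * \<mu> * u ^ (DIM('a) - 1) * \<bar>g h u\<bar> powr s)"
          using True measure_section_pos by (simp add: ennreal_mult'[symmetric] n_def)
        also have "\<dots> = ennreal c * ennreal (f ((u / h) ^ DIM('a)) * (n * u ^ (DIM('a) - 1) / h powr n))"
          unfolding pw[OF True[THEN conjunct1] True[THEN conjunct2]] by (rule ennreal_mult'[OF less_imp_le[OF c]])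
        finally show ?thesis using True by simp
      qed (use elim in \<open>auto simp: indicator_def\<close>)
    qed
  qed
  also have "\<dots> = ennreal c * (\<integral>\<^sup>+u. ennreal (f ((u / h) ^ DIM('a)) * (n * u ^ (DIM('a) - 1) / h powr n)) * indicator {0..h} u \<partial>lborel)"
    unfolding f_def by (rule nn_integral_cmult) measurable
  also have "(\<integral>\<^sup>+u. ennreal (f ((u / h) ^ DIM('a)) * (n * u ^ (DIM('a) - 1) / h powr n)) * indicator {0..h} u \<partial>lborel)
     = (\<integral>\<^sup>+u. ennreal (f ((u / h) ^ DIM('a)) * (n * u ^ (DIM('a) - 1) / h powr n) * indicator {0..h} u) \<partial>lborel)"
    by (rule nn_integral_set_ennreal)
  also have "\<dots> = (\<integral>\<^sup>+x. ennreal (f x * indicator {(0 / h) ^ DIM('a)..(h / h) ^ DIM('a)} x) \<partial>lborel)"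
  proof (rule nn_integral_substitution[symmetric])
    show "((\<lambda>u. (u / h) ^ DIM('a)) has_real_derivative n * u ^ (DIM('a) - 1) / h powr n) (at u)" for u
      using h by (auto intro!: derivative_eq_intros simp: n_def powr_realpow power_divide field_simps power_eq_if[of h "DIM('a)"])
    show "continuous_on {0..h} (\<lambda>u. n * u ^ (DIM('a) - 1) / h powr n)" using h by (intro continuous_intros) auto
    show "set_borel_measurable borel {(0 / h) ^ DIM('a)..(h / h) ^ DIM('a)} f"
      unfolding set_borel_measurable_def f_def by measurable
  qed (use h n in auto)
  also have "\<dots> = (\<integral>\<^sup>+x. ennreal (f x) * indicator {0..1} x \<partial>lborel)"
    using h by (simp add: nn_integral_set_ennreal zero_power)
  also have "\<dots> = ennreal (Beta a b)"
    unfolding f_def by (rule nn_integral_has_integral_lebesgue'[OF _ has_integral_Beta_real[OF a b]]) auto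
  also have "ennreal c * ennreal (Beta a b) = ennreal (c * Beta a b)"
    using c by (simp add: ennreal_mult')
  also have "c * Beta a b = (\<mu> powr (- q) * A_recip DIM('a) q * h powr (1 - real DIM('a) * q)) powr s"
  proof -
    have A: "A_recip DIM('a) q = n powr (- 1) * Beta a b powr (1 - q)"
      using n by (simp add: A_recip_def a_def b_def n_def powr_minus divide_inverse)
    have B: "Beta a b > 0" by (rule Beta_real_pos[OF a b])
    note pos = B n measure_section_pos h c s1(1)
    \<comment> \<open>The relation s (1 - q) = 1 converts the powers of n \<mu> and h collected in c
      into those of the claimed norm.\<close>
    have ss: "1 - s = - q * s" using s1(2) by (simp add: algebra_simps)
    have k: "n * (1 - s) = n * (- q * s)" unfolding ss ..
    have "(1 - n * q) * s = n - (n - 1) * s" using k by (simp add: algebra_simps)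
    note e1 = ss this
    have e2: "n - (n - 1) * s = (1 - n) * s + n" by (simp add: algebra_simps)
    have "(\<mu> powr (- q) * A_recip DIM('a) q * h powr (1 - real DIM('a) * q)) powr s
      = \<mu> powr (- q * s) * (n powr (- s) * Beta a b powr ((1 - q) * s)) * h powr ((1 - n * q) * s)"
      unfolding A n_def[symmetric] using powr_prod'[of \<mu> n "Beta a b" h "- q" "- 1" "1 - q" "1 - n * q" s] pos by simp
    also have "\<dots> = \<mu> powr (1 - s) * (n powr (- s) * Beta a b) * (h powr (- (n - 1) * s) * h powr n)"
      unfolding e1(2) e1(1)[symmetric] using s1(2) pos by (simp add: mult.commute[of "1 - q"] powr_add[symmetric] e2)
    also have "\<dots> = c * Beta a b"
      using pos by (simp add: c_def powr_mult powr_diff powr_minus divide_inverse)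
    finally show ?thesis ..
  qed
  finally show ?thesis .
qed

lemma g_fun_Lp:
  assumes h: "h > 0" and p: "ereal DIM('a) < p"
  shows "(\<lambda>y. g h (N y)) \<in> Lp_space (conj_exp p) (V h)"
    "Lp_norm (conj_exp p) (V h) (\<lambda>y. g h (N y))
      = \<mu> powr (- recip_exp p) * A_recip DIM('a) (recip_exp p) * h powr (1 - real DIM('a) * recip_exp p)"
proof -
  let ?q = "recip_exp p" and ?s = "conj_exp p"
  let ?X = "\<mu> powr (- ?q) * A_recip DIM('a) ?q * h powr (1 - real DIM('a) * ?q)"
  have D: "DIM('a) \<ge> 1" by (simp add: Suc_leI)
  note q = recip_exp_bounds[OF D p]
  have "ereal 1 < p" by (rule order.strict_trans1[OF _ p]) (simp add: Suc_leI)
  then have s: "?s = 1 / (1 - ?q)" by (rule conj_exp_recip)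
  have s0: "?s > 0" using q(3) s by simp
  have X: "?X \<ge> 0" using A_recip_pos[OF D q(1,2)] by simp
  have V_meas: "V h \<in> sets borel" by (rule section_borel[OF h])
  have meas: "(\<lambda>y. g h (N y)) \<in> borel_measurable (lebesgue_on (V h))"
    by (intro measurable_restrict_space1 measurable_completion) simp
  have int: "(\<integral>\<^sup>+y. ennreal (\<bar>g h (N y)\<bar> powr ?s) * indicator (V h) y \<partial>lebesgue) = ennreal (?X powr ?s)"
    using nn_integral_g_fun_powr[OF h q(1,2) s] by (simp add: nn_integral_completion)
  show mem: "(\<lambda>y. g h (N y)) \<in> Lp_space ?s (V h)"
    by (rule Lp_finiteI(1)[OF meas s0 _ X]) (use V_meas int in auto)
  have "ennreal (Lp_norm ?s (V h) (\<lambda>y. g h (N y)) powr ?s) = ennreal (?X powr ?s)"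
    using Lp_finite_nn_integral[OF mem s0] V_meas int by simp
  then have "Lp_norm ?s (V h) (\<lambda>y. g h (N y)) powr ?s = ?X powr ?s" by simp
  then have "(Lp_norm ?s (V h) (\<lambda>y. g h (N y)) powr ?s) powr (1 / ?s) = (?X powr ?s) powr (1 / ?s)" by simp
  then show "Lp_norm ?s (V h) (\<lambda>y. g h (N y)) = ?X"
    using s0 X Lp_norm_finite_nonneg[of ?s "V h" "\<lambda>y. g h (N y)"] by (simp only: powr_powr) simp
qed

end

subsection \<open>The extremal function\<close>

locale extremal_function = cone_body K C for K C :: "'a::euclidean_space set" +
  fixes p :: ereal and h :: real
  assumes p: "ereal DIM('a) < p" and h: "h > 0"
begin

abbreviation "s \<equiv> conj_exp p"
definition "w u = g h u powr (s - 1)"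
definition "F u = (LINT t:{u<..<h}|lborel. w t)"
abbreviation "fe \<equiv> f_ext C K p h"
abbreviation "X \<equiv> Lp_norm s (V h) (\<lambda>y. g h (N y))"
text \<open>This one number is the p'-th power integral of the kernel and, because (s - 1) p = s for
  finite p, also bounds the p-th power integral of the extremal slope.\<close>

definition "I = X powr s"

lemma s_recip: "s = 1 / (1 - recip_exp p)"
proof -
  have "ereal 1 < p" by (rule order.strict_trans1[OF _ p]) (simp add: Suc_leI)
  then show ?thesis by (rule conj_exp_recip)
qed

lemma q_bounds: "0 \<le> recip_exp p" "real DIM('a) * recip_exp p < 1" "recip_exp p < 1"
  using recip_exp_bounds[OF _ p] by (simp_all add: Suc_leI)

lemma s_ge_1: "s \<ge> 1"
  using q_bounds by (simp add: s_recip)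

lemma w_measurable [measurable]: "w \<in> borel_measurable borel"
  unfolding w_def[abs_def] by measurable

lemma w_nonneg: "0 \<le> w u"
  by (simp add: w_def)

lemma w_pos: "0 < u \<Longrightarrow> u < h \<Longrightarrow> 0 < w u"
  using g_fun_pos[of u h] by (simp add: w_def)

lemma g_fun_antimono: assumes "0 < u" "u \<le> v" shows "g h v \<le> g h u"
proof -
  have "1 / v ^ (DIM('a) - 1) \<le> 1 / u ^ (DIM('a) - 1)"
    using assms by (intro divide_left_mono power_mono mult_pos_pos) auto
  moreover have "u / h ^ DIM('a) \<le> v / h ^ DIM('a)" using assms h by (intro divide_right_mono) auto
  ultimately show ?thesis using measure_section_pos unfolding g_fun_def by (intro mult_left_mono diff_mono) auto
qed

lemma w_antimono: "0 < u \<Longrightarrow> u \<le> v \<Longrightarrow> v < h \<Longrightarrow> w v \<le> w u"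
  unfolding w_def using g_fun_antimono[of u v] g_fun_pos[of v h] s_ge_1 by (intro powr_mono2) auto

lemma w_continuous: "continuous_on {0<..<h} w"
proof -
  have "continuous_on {0<..<h} (g h)" unfolding g_fun_def[abs_def] using h by (intro continuous_intros) auto
  moreover have "g h u \<noteq> 0" if "u \<in> {0<..<h}" for u using g_fun_pos[of u h] that by simp
  ultimately show ?thesis unfolding w_def[abs_def] by (intro continuous_intros) auto
qed

text \<open>The polar density cancels the singularity of one factor g, leaving the weight 1 - (u /
  h)^d. The complementary weight (u / h)^d turns up in the L_1 norm of the extremal function, and
  the two integrals add up to F 0.\<close>

lemma g_powr_eq: assumes "0 < u" "u < h"
  shows "DIM('a) * \<mu> * u ^ (DIM('a) - 1) * \<bar>g h u\<bar> powr s = (1 - (u / h) ^ DIM('a)) * w u"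
proof -
  have gp: "g h u > 0" by (rule g_fun_pos[OF assms])
  have "\<bar>g h u\<bar> powr s = g h u * w u" using gp by (simp add: w_def powr_diff)
  moreover have "DIM('a) * \<mu> * u ^ (DIM('a) - 1) * g h u = 1 - (u / h) ^ DIM('a)"
  proof -
    have "u ^ (DIM('a) - 1) * (1 / u ^ (DIM('a) - 1) - u / h ^ DIM('a)) = 1 - (u / h) ^ DIM('a)"
      using assms by (simp add: power_divide field_simps power_eq_if[of u "DIM('a)"])
    then show ?thesis using measure_section_pos by (simp add: g_fun_def)
  qed
  ultimately show ?thesis by (simp add: mult.assoc[symmetric])
qed

lemma V_borel [measurable]: "V h \<in> sets borel"
  by (rule section_borel[OF h])

lemma nn_integral_g_powr: "(\<integral>\<^sup>+y. ennreal (\<bar>g h (N y)\<bar> powr s) * indicator (V h) y \<partial>lborel) = ennreal I"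
proof -
  have V: "V h \<in> sets lebesgue" using section_borel[OF h] by simp
  show ?thesis using Lp_finite_nn_integral[OF g_fun_Lp(1)[OF h p] _ V] s_ge_1 by (simp add: I_def nn_integral_completion)
qed

lemma nn_integral_I: "(\<integral>\<^sup>+u. ennreal ((1 - (u / h) ^ DIM('a)) * w u) * indicator {0<..<h} u \<partial>lborel) = ennreal I"
proof -
  have "ennreal I = (\<integral>\<^sup>+u. ennreal (DIM('a) * \<mu> * u ^ (DIM('a) - 1)) * ennreal (\<bar>g h u\<bar> powr s) * indicator {0<..<h} u \<partial>lborel)"
    unfolding nn_integral_g_powr[symmetric] by (rule nn_integral_section_polar[OF h]) measurable
  also have "\<dots> = (\<integral>\<^sup>+u. ennreal ((1 - (u / h) ^ DIM('a)) * w u) * indicator {0<..<h} u \<partial>lborel)"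
  proof (rule nn_integral_cong)
    fix u :: real
    show "ennreal (DIM('a) * \<mu> * u ^ (DIM('a) - 1)) * ennreal (\<bar>g h u\<bar> powr s) * indicator {0<..<h} u
        = ennreal ((1 - (u / h) ^ DIM('a)) * w u) * indicator {0<..<h} u"
    proof (cases "0 < u \<and> u < h")
      case True
      then have "ennreal (DIM('a) * \<mu> * u ^ (DIM('a) - 1)) * ennreal (\<bar>g h u\<bar> powr s) = ennreal (DIM('a) * \<mu> * u ^ (DIM('a) - 1) * \<bar>g h u\<bar> powr s)"
        using measure_section_pos by (intro ennreal_mult'[symmetric]) auto
      then show ?thesis using g_powr_eq[of u] True by simp
    qed auto
  qed
  finally show ?thesis ..
qed

lemma power_ratio_bounds: "0 < u \<Longrightarrow> u < h \<Longrightarrow> 0 \<le> (u / h) ^ DIM('a) \<and> (u / h) ^ DIM('a) \<le> 1"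
  by (auto intro!: power_le_one)

text \<open>The weighted integral I is finite, and the weight 1 - (u / h)^d is at least 1 / 2 on (0,
  h / 2]; beyond h / 2 the decreasing w is at most \<open>w (h / 2)\<close>.\<close>

lemma w_integrable: "set_integrable lborel {0<..<h} w"
proof -
  have e: "\<exists>c\<ge>0. \<forall>u\<in>{0<..<h}. w u \<le> 2 * ((1 - (u / h) ^ DIM('a)) * w u) + c"
  proof (intro exI[of _ "w (h / 2)"] conjI ballI)
    fix u assume u: "u \<in> {0<..<h}"
    show "w u \<le> 2 * ((1 - (u / h) ^ DIM('a)) * w u) + w (h / 2)"
    proof (cases "u \<le> h / 2")
      case True
      have "(u / h) ^ DIM('a) \<le> (u / h) ^ 1" using u by (intro power_decreasing) (auto simp: Suc_leI)
      also have "\<dots> \<le> 1 / 2" using True h by (simp add: field_simps)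
      finally have "1 * w u \<le> (2 * (1 - (u / h) ^ DIM('a))) * w u" by (intro mult_right_mono w_nonneg) simp
      then show ?thesis using w_nonneg[of "h / 2"] by (simp add: algebra_simps)
    next
      case False
      then have "w u \<le> w (h / 2)" using u h by (intro w_antimono) auto
      moreover have "0 \<le> (1 - (u / h) ^ DIM('a)) * w u" using power_ratio_bounds[of u] u w_nonneg[of u] by auto
      ultimately show ?thesis by linarith
    qed
  qed (rule w_nonneg)
  then obtain c where c: "c \<ge> 0" "\<And>u. u \<in> {0<..<h} \<Longrightarrow> w u \<le> 2 * ((1 - (u / h) ^ DIM('a)) * w u) + c" by blast
  have "(\<integral>\<^sup>+u. ennreal (w u) * indicator {0<..<h} u \<partial>lborel)
     \<le> (\<integral>\<^sup>+u. 2 * (ennreal ((1 - (u / h) ^ DIM('a)) * w u) * indicator {0<..<h} u) + ennreal c * indicator {0<..<h} u \<partial>lborel)"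
  proof (rule nn_integral_mono)
    fix u :: real
    show "ennreal (w u) * indicator {0<..<h} u \<le> 2 * (ennreal ((1 - (u / h) ^ DIM('a)) * w u) * indicator {0<..<h} u) + ennreal c * indicator {0<..<h} u"
    proof (cases "u \<in> {0<..<h}")
      case True
      have nn: "0 \<le> (1 - (u / h) ^ DIM('a)) * w u" using power_ratio_bounds[of u] True w_nonneg[of u] by auto
      have "ennreal (w u) \<le> ennreal (2 * ((1 - (u / h) ^ DIM('a)) * w u) + c)" by (rule ennreal_leI[OF c(2)[OF True]])
      also have "\<dots> = ennreal (2 * ((1 - (u / h) ^ DIM('a)) * w u)) + ennreal c"
        using nn c(1) by (intro ennreal_plus) auto
      also have "ennreal (2 * ((1 - (u / h) ^ DIM('a)) * w u)) = 2 * ennreal ((1 - (u / h) ^ DIM('a)) * w u)"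
        by (subst ennreal_mult') auto
      finally show ?thesis using True by simp
    qed simp
  qed
  also have "\<dots> = 2 * ennreal I + ennreal c * ennreal h"
    using h by (subst nn_integral_add) (auto simp: nn_integral_cmult nn_integral_I)
  also have "\<dots> < \<infinity>" by (auto simp: ennreal_mult_less_top ennreal_add_less_top)
  finally have fin: "(\<integral>\<^sup>+u. ennreal (w u) * indicator {0<..<h} u \<partial>lborel) < \<infinity>" .
  show ?thesis unfolding set_integrable_def
  proof (rule integrableI_bounded)
    have "(\<integral>\<^sup>+u. ennreal (norm (indicator {0<..<h} u *\<^sub>R w u)) \<partial>lborel) = (\<integral>\<^sup>+u. ennreal (w u) * indicator {0<..<h} u \<partial>lborel)"
      using w_nonneg by (intro nn_integral_cong) (auto split: split_indicator)
    with fin show "(\<integral>\<^sup>+u. ennreal (norm (indicator {0<..<h} u *\<^sub>R w u)) \<partial>lborel) < \<infinity>" by simp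
  qed measurable
qed

lemma w_integrable_sub: "0 \<le> u \<Longrightarrow> v \<le> h \<Longrightarrow> set_integrable lborel {u<..<v} w"
  by (rule set_integrable_subset[OF w_integrable]) auto

lemma F_eq_lebesgue: "(LINT t:{u<..<h}|lebesgue. g h t powr (s - 1)) = F u"
  unfolding F_def w_def[symmetric] set_lebesgue_integral_def by (rule integral_completion) measurable

lemma fe_eq: "y \<in> C \<Longrightarrow> fe y = F (N y)"
proof (cases "N y < h")
  case False
  then have "{N y<..<h} = {}" by auto
  then show "y \<in> C \<Longrightarrow> fe y = F (N y)" using False section_iff[OF h, of y] by (auto simp: f_ext_def F_def set_lebesgue_integral_def)
qed (auto simp: f_ext_def F_eq_lebesgue section_eq[OF h] mem_scaleR_body[OF h])

lemma F_nonneg: "0 \<le> F u"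
  unfolding F_def set_lebesgue_integral_def by (intro integral_nonneg_AE) (auto simp: w_nonneg)

lemma F_zero: "h \<le> u \<Longrightarrow> F u = 0"
  by (simp add: F_def set_lebesgue_integral_def)

lemma set_integral_w_cong:
  assumes "AE t in lborel. t \<in> A \<longleftrightarrow> t \<in> B" and [measurable]: "A \<in> sets borel" "B \<in> sets borel"
  shows "(LINT t:A|lborel. w t) = (LINT t:B|lborel. w t)"
  unfolding set_lebesgue_integral_def
proof (rule integral_cong_AE)
  show "AE t in lborel. indicator A t *\<^sub>R w t = indicator B t *\<^sub>R w t"
    using assms(1) by eventually_elim (simp add: indicator_def)
qed measurable

lemma F_split: assumes "0 \<le> u" "u \<le> v" "v \<le> h" shows "F u = (LINT t:{u<..<v}|lborel. w t) + F v"
proof -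
  have "F u = (LINT t:{u<..<v} \<union> {v<..<h}|lborel. w t)"
    unfolding F_def
  proof (rule set_integral_w_cong)
    show "AE t in lborel. (t \<in> {u<..<h}) = (t \<in> {u<..<v} \<union> {v<..<h})"
      using AE_lborel_singleton[of v] by eventually_elim (use assms in auto)
  qed auto
  also have "\<dots> = (LINT t:{u<..<v}|lborel. w t) + F v"
    unfolding F_def using assms by (intro set_integral_Un w_integrable_sub) auto
  finally show ?thesis .
qed

lemma F_antimono: assumes "0 \<le> u" "u \<le> v" shows "F v \<le> F u"
proof (cases "v \<le> h")
  case True
  have "0 \<le> (LINT t:{u<..<v}|lborel. w t)"
    unfolding set_lebesgue_integral_def by (intro integral_nonneg_AE) (auto simp: w_nonneg)
  then show ?thesis using F_split[OF assms True] by simp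
qed (use F_zero[of v] F_nonneg in auto)

lemma F_diff_le: assumes "0 < e" "e \<le> u" "u \<le> v" shows "F u - F v \<le> w e * (v - u)"
proof (cases "u < h")
  case True
  define v' where "v' = min v h"
  have v': "u \<le> v'" "v' \<le> h" "v' \<le> v" using True assms by (auto simp: v'_def)
  have Fv: "F v = F v'" using F_zero[of v] F_zero[of h] by (auto simp: v'_def min_def)
  have "(LINT t:{u<..<v'}|lborel. w t) \<le> (LINT t:{u<..<v'}|lborel. w e)"
    using assms v' w_antimono[of e] by (intro set_integral_mono w_integrable_sub) (auto simp: set_integrable_def)
  also have "\<dots> = w e * (v' - u)" using v' by (simp add: set_lebesgue_integral_def)
  also have "\<dots> \<le> w e * (v - u)" using v' by (intro mult_left_mono w_nonneg) auto
  finally show ?thesis using F_split[of u v'] assms v' Fv by simp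
qed (use F_zero[of u] F_zero[of v] assms w_nonneg[of e] in auto)

lemma F_pos: "0 < F 0"
proof -
  have "F (h / 2) \<ge> 0" by (rule F_nonneg)
  have "w (h / 2) * (h / 2 - h / 4) \<le> (LINT t:{h / 4<..<h / 2}|lborel. w t)"
  proof -
    have "(LINT t:{h / 4<..<h / 2}|lborel. w (h / 2)) \<le> (LINT t:{h / 4<..<h / 2}|lborel. w t)"
      using h w_antimono[of _ "h / 2"] by (intro set_integral_mono w_integrable_sub) (auto simp: set_integrable_def)
    then show ?thesis using h by (simp add: set_lebesgue_integral_def mult.commute)
  qed
  moreover have "F (h / 4) = (LINT t:{h / 4<..<h / 2}|lborel. w t) + F (h / 2)" using h by (intro F_split) auto
  moreover have "w (h / 2) * (h / 2 - h / 4) > 0" using h w_pos[of "h / 2"] by simp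
  ultimately show ?thesis using F_antimono[of 0 "h / 4"] F_nonneg[of "h / 2"] h by simp
qed

lemma F_DERIV: assumes u: "0 < u" "u < h" shows "(F has_real_derivative - w u) (at u)"
proof -
  \<comment> \<open>An interval around u away from both 0 and h, on which w is continuous.\<close>
  define a b where "a = u / 2" and "b = (u + h) / 2"
  have ab: "0 < a" "a < u" "u < b" "b < h" using u by (auto simp: a_def b_def)
  have cont: "continuous_on {a..b} w" by (rule continuous_on_subset[OF w_continuous]) (use ab in auto)
  have "((\<lambda>x. integral {a..x} w) has_real_derivative w u) (at u within {a..b})"
    using integral_has_real_derivative[OF cont, of u] ab by auto
  then have "((\<lambda>x. integral {a..x} w) has_real_derivative w u) (at u)"
    using ab by (simp add: at_within_Icc_at)
  then have D: "((\<lambda>x. F a - integral {a..x} w) has_real_derivative - w u) (at u)"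
    by (auto intro!: derivative_eq_intros)
  have eq: "F a - integral {a..x} w = F x" if x: "x \<in> {a<..<b}" for x
  proof -
    have "(LINT t:{a<..<x}|lborel. w t) = (LINT t:{a..x}|lborel. w t)"
    proof (rule set_integral_w_cong)
      show "AE t in lborel. (t \<in> {a<..<x}) = (t \<in> {a..x})"
        using AE_lborel_singleton[of a] AE_lborel_singleton[of x] by eventually_elim auto
    qed auto
    also have "\<dots> = integral {a..x} w"
      by (rule set_borel_integral_eq_integral(2)) (rule set_integrable_subset[OF w_integrable]; use x ab in auto)
    finally show ?thesis using F_split[of a x] x ab by simp
  qed
  show ?thesis
    by (rule DERIV_cong_ev[THEN iffD1, OF refl _ refl D])
      (rule eventually_mono[OF eventually_nhds_in_open[of "{a<..<b}" u]], use ab eq in auto)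
qed

lemma F_tendsto_0: "((\<lambda>n. F (1 / real (Suc n))) \<longlonglongrightarrow> F 0)"
  unfolding F_def set_lebesgue_integral_def
proof (rule integral_dominated_convergence[where w="\<lambda>t. indicator {0<..<h} t *\<^sub>R w t"])
  show "integrable lborel (\<lambda>t. indicator {0<..<h} t *\<^sub>R w t)" using w_integrable by (simp add: set_integrable_def)
  show "AE t in lborel. (\<lambda>n. indicator {1 / real (Suc n)<..<h} t *\<^sub>R w t) \<longlonglongrightarrow> indicator {0<..<h} t *\<^sub>R w t"
  proof (rule AE_I2)
    fix t :: real
    show "(\<lambda>n. indicator {1 / real (Suc n)<..<h} t *\<^sub>R w t) \<longlonglongrightarrow> indicator {0<..<h} t *\<^sub>R w t"
    proof (cases "0 < t")
      case True
      have "\<forall>\<^sub>F n in sequentially. 1 / real (Suc n) < t"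
        using order_tendstoD(2)[OF LIMSEQ_inverse_real_of_nat True] by (simp add: inverse_eq_divide)
      then have "\<forall>\<^sub>F n in sequentially. indicator {0<..<h} t *\<^sub>R w t = indicator {1 / real (Suc n)<..<h} t *\<^sub>R w t"
        by eventually_elim (use True in \<open>auto simp: indicator_def\<close>)
      then show ?thesis by (rule Lim_transform_eventually[OF tendsto_const])
    next
      case False
      have "t \<notin> {1 / real (Suc n)<..<h}" for n
      proof -
        have "0 < 1 / real (Suc n)" by simp
        then have "t \<le> 1 / real (Suc n)" using False by linarith
        then show ?thesis by (simp del: of_nat_Suc)
      qed
      with False show ?thesis by simp
    qed
  qed
  show "AE t in lborel. norm (indicator {1 / real (Suc n)<..<h} t *\<^sub>R w t) \<le> indicator {0<..<h} t *\<^sub>R w t" for n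
  proof (rule AE_I2)
    fix t :: real
    have pos: "0 < 1 / real (Suc n)" by simp
    have "t \<in> {0<..<h}" if "t \<in> {1 / real (Suc n)<..<h}"
      using that order_less_trans[OF pos] unfolding greaterThanLessThan_iff by blast
    then show "norm (indicator {1 / real (Suc n)<..<h} t *\<^sub>R w t) \<le> indicator {0<..<h} t *\<^sub>R w t"
      using w_nonneg[of t] by (auto simp: indicator_def simp del: of_nat_Suc greaterThanLessThan_iff)
  qed
qed measurable

end

subsection \<open>Directional derivatives of the body norm\<close>

text \<open>Caratheodory's form of the derivative asks of u only the limit of its scaled increments
  along the sequence; for the body norm exactly such one-sided limits are at hand.\<close>

lemma chain_rule_sequentially:
  fixes f :: "real \<Rightarrow> real"
  assumes "(f has_real_derivative D) (at x)" "u \<longlonglongrightarrow> x" "(\<lambda>n. r n * (u n - x)) \<longlonglongrightarrow> L"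
  shows "(\<lambda>n. r n * (f (u n) - f x)) \<longlonglongrightarrow> D * L"
proof -
  obtain k where k: "\<And>z. f z - f x = k z * (z - x)" "isCont k x" "k x = D"
    using assms(1) by (auto simp: CARAT_DERIV)
  have "(\<lambda>n. k (u n) * (r n * (u n - x))) \<longlonglongrightarrow> k x * L"
    by (intro tendsto_mult assms(3) isCont_tendsto_compose[OF k(2) assms(2)])
  then show ?thesis by (simp add: k(1,3) ac_simps)
qed

context symmetric_body
begin

text \<open>The one-sided directional derivative of N at y along v, taken along 1 / (n + 1) so that
  it is a pointwise limit of a sequence of continuous functions and therefore Borel.\<close>

definition "dN v y = lim (\<lambda>n. real (Suc n) * (N (y + (1 / real (Suc n)) *\<^sub>R v) - N y))"

lemma dN_quotient_bound: "\<bar>real (Suc n) * (N (y + (1 / real (Suc n)) *\<^sub>R v) - N y)\<bar> \<le> N v"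
proof -
  have "\<bar>N (y + (1 / real (Suc n)) *\<^sub>R v) - N y\<bar> \<le> N ((1 / real (Suc n)) *\<^sub>R v)"
    using body_norm_diff_abs[of "y + (1 / real (Suc n)) *\<^sub>R v" y] by simp
  also have "\<dots> = N v / real (Suc n)" by (simp add: body_norm_scaleR del: of_nat_Suc)
  finally have "real (Suc n) * \<bar>N (y + (1 / real (Suc n)) *\<^sub>R v) - N y\<bar> \<le> real (Suc n) * (N v / real (Suc n))"
    by (intro mult_left_mono) auto
  then show ?thesis unfolding abs_mult by (simp del: of_nat_Suc)
qed

text \<open>Convexity of N: with a = n + 1 and b = n + 2 the point y + v / b lies on the segment
  from y to y + v / a. Monotonicity and the bound \<open>N v\<close> give convergence at every
  y.\<close>

lemma dN_quotient_decseq: "decseq (\<lambda>n. real (Suc n) * (N (y + (1 / real (Suc n)) *\<^sub>R v) - N y))"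
proof (rule decseq_SucI)
  fix n
  define a b where "a = real (Suc n)" and "b = real (Suc (Suc n))"
  have ab: "0 < a" "a < b" by (simp_all add: a_def b_def)
  have "y + (1 / b) *\<^sub>R v = (1 - a / b) *\<^sub>R y + (a / b) *\<^sub>R (y + (1 / a) *\<^sub>R v)"
    using ab by (simp add: algebra_simps)
  then have "N (y + (1 / b) *\<^sub>R v) \<le> N ((1 - a / b) *\<^sub>R y) + N ((a / b) *\<^sub>R (y + (1 / a) *\<^sub>R v))"
    using body_norm_triangle by simp
  also have "\<dots> = (1 - a / b) * N y + (a / b) * N (y + (1 / a) *\<^sub>R v)"
    using ab by (simp add: body_norm_scaleR)
  finally have "b * N (y + (1 / b) *\<^sub>R v) \<le> b * ((1 - a / b) * N y + (a / b) * N (y + (1 / a) *\<^sub>R v))"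
    using ab by (intro mult_left_mono) auto
  also have "\<dots> = (b - a) * N y + a * N (y + (1 / a) *\<^sub>R v)" using ab by (simp add: field_simps)
  finally show "real (Suc (Suc n)) * (N (y + (1 / real (Suc (Suc n))) *\<^sub>R v) - N y) \<le> real (Suc n) * (N (y + (1 / real (Suc n)) *\<^sub>R v) - N y)"
    unfolding a_def[symmetric] b_def[symmetric] by (simp add: algebra_simps)
qed

lemma dN_tendsto: "(\<lambda>n. real (Suc n) * (N (y + (1 / real (Suc n)) *\<^sub>R v) - N y)) \<longlonglongrightarrow> dN v y"
proof -
  have "\<forall>n. - N v \<le> real (Suc n) * (N (y + (1 / real (Suc n)) *\<^sub>R v) - N y)"
  proof
    show "- N v \<le> real (Suc n) * (N (y + (1 / real (Suc n)) *\<^sub>R v) - N y)" for n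
      using dN_quotient_bound[of n y v] by linarith
  qed
  from decseq_convergent[OF dN_quotient_decseq this]
  obtain L where L: "(\<lambda>n. real (Suc n) * (N (y + (1 / real (Suc n)) *\<^sub>R v) - N y)) \<longlonglongrightarrow> L" by blast
  from limI[OF this] have "dN v y = L" by (simp only: dN_def)
  with L show ?thesis by (simp only:)
qed

lemma dN_bound: "\<bar>dN v y\<bar> \<le> N v"
  by (rule tendsto_upperbound[OF tendsto_rabs[OF dN_tendsto]]) (auto simp: dN_quotient_bound simp del: of_nat_Suc)

lemma dN_measurable [measurable]: "dN v \<in> borel_measurable borel"
  unfolding dN_def[abs_def] by (intro borel_measurable_lim_metric) measurable

end

section \<open>Difference quotients of test functions\<close>

lemma test_function_bounded:
  assumes \<phi>: "\<phi> \<in> test_functions C"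
  obtains B where "B \<ge> 0" "\<And>x. \<bar>\<phi> x\<bar> \<le> B"
proof -
  let ?Q = "closure {x. \<phi> x \<noteq> 0}"
  have "bounded (\<phi> ` ?Q)"
    by (intro compact_imp_bounded compact_continuous_image test_function_props(4)[OF \<phi>]
        continuous_on_subset[OF test_function_props(1)[OF \<phi>] subset_UNIV])
  then obtain B where B: "\<And>x. x \<in> ?Q \<Longrightarrow> \<bar>\<phi> x\<bar> \<le> B" unfolding bounded_iff by auto
  have z: "\<phi> x = 0" if "x \<notin> ?Q" for x using that closure_subset[of "{x. \<phi> x \<noteq> 0}"] by auto
  have "\<bar>\<phi> x\<bar> \<le> \<bar>B\<bar>" for x
  proof (cases "x \<in> ?Q")
    case True
    show ?thesis by (rule order_trans[OF B[OF True] abs_ge_self])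
  next
    case False
    show ?thesis unfolding z[OF False] by simp
  qed
  then show thesis using that[of "\<bar>B\<bar>"] by auto
qed

lemma integrable_bounded_compact_support:
  fixes f :: "'a::euclidean_space \<Rightarrow> real"
  assumes [measurable]: "f \<in> borel_measurable borel" and B: "\<And>x. \<bar>f x\<bar> \<le> B" and Q: "compact Q" "\<And>x. x \<notin> Q \<Longrightarrow> f x = 0"
  shows "integrable lborel f"
proof (rule Bochner_Integration.integrable_bound)
  have "emeasure lborel Q < \<infinity>" using Q(1) by (rule emeasure_compact_finite)
  then show "integrable lborel (\<lambda>x. B * indicator Q x)"
    using Q(1) by (intro integrable_mult_right integrable_real_indicator) (auto simp: borel_compact)
  show "AE x in lborel. norm (f x) \<le> norm (B * indicator Q x)"
  proof (rule AE_I2)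
    fix x
    show "norm (f x) \<le> norm (B * indicator Q x)"
      using order_trans[OF B[of x] abs_ge_self] Q(2)[of x] by (cases "x \<in> Q") simp_all
  qed
qed simp

lemma test_function_integrable:
  assumes \<phi>: "\<phi> \<in> test_functions C" shows "integrable lborel \<phi>"
proof -
  obtain B where B: "B \<ge> 0" "\<And>x. \<bar>\<phi> x\<bar> \<le> B" using test_function_bounded[OF \<phi>] by blast
  have z: "\<phi> x = 0" if "x \<notin> closure {x. \<phi> x \<noteq> 0}" for x using that closure_subset[of "{x. \<phi> x \<noteq> 0}"] by auto
  show ?thesis
    by (rule integrable_bounded_compact_support[OF test_function_measurable[OF \<phi>] B(2) test_function_props(4)[OF \<phi>] z])
qed

lemma frechet_derivative_measurable:
  "\<phi> \<in> test_functions C \<Longrightarrow> (\<lambda>x. frechet_derivative \<phi> (at x) v) \<in> borel_measurable borel"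
  by (intro borel_measurable_continuous_onI continuous_on_frechet_derivative)

lemma frechet_derivative_integrable:
  assumes \<phi>: "\<phi> \<in> test_functions C" shows "integrable lborel (\<lambda>x. frechet_derivative \<phi> (at x) v)"
proof -
  obtain B where B: "B \<ge> 0" "\<And>x. \<bar>frechet_derivative \<phi> (at x) v\<bar> \<le> B" using frechet_derivative_bounded[OF \<phi>, of v] by blast
  have z: "frechet_derivative \<phi> (at x) v = 0" if "x \<notin> closure {x. \<phi> x \<noteq> 0}" for x
    unfolding frechet_derivative_outside_support[OF \<phi> that] by (rule refl)
  show ?thesis
    by (rule integrable_bounded_compact_support[OF frechet_derivative_measurable[OF \<phi>] B(2) test_function_props(4)[OF \<phi>] z])
qed

lemma integrable_bounded_mult:
  fixes f k :: "'a::euclidean_space \<Rightarrow> real"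
  assumes [measurable]: "f \<in> borel_measurable borel" and B: "\<And>x. \<bar>f x\<bar> \<le> B" and k: "integrable lborel k"
  shows "integrable lborel (\<lambda>x. f x * k x)"
proof (rule Bochner_Integration.integrable_bound)
  show "integrable lborel (\<lambda>x. B * \<bar>k x\<bar>)" using k by simp
  show "AE x in lborel. norm (f x * k x) \<le> norm (B * \<bar>k x\<bar>)"
  proof (rule AE_I2)
    fix x
    show "norm (f x * k x) \<le> norm (B * \<bar>k x\<bar>)"
      using mult_right_mono[OF order_trans[OF B[of x] abs_ge_self], of "\<bar>k x\<bar>"] by (simp add: abs_mult)
  qed
  show "(\<lambda>x. f x * k x) \<in> borel_measurable lborel" using borel_measurable_integrable[OF k] by measurable
qed

text \<open>Backward quotients, because a translation carries them to forward quotients of the other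
  factor. The uniform bound comes from the mean value theorem.\<close>

lemma test_function_quotient:
  assumes \<phi>: "\<phi> \<in> test_functions C"
  shows "(\<lambda>n. real (Suc n) * (\<phi> y - \<phi> (y - (1 / real (Suc n)) *\<^sub>R v))) \<longlonglongrightarrow> frechet_derivative \<phi> (at y) v"
    and "(\<And>x. \<bar>frechet_derivative \<phi> (at x) v\<bar> \<le> B) \<Longrightarrow> \<bar>real (Suc n) * (\<phi> y - \<phi> (y - (1 / real (Suc n)) *\<^sub>R v))\<bar> \<le> B"
proof -
  define k where "k t = \<phi> (y - t *\<^sub>R v)" for t
  have k: "(k has_real_derivative - frechet_derivative \<phi> (at (y - t *\<^sub>R v)) v) (at t)" for t
  proof -
    have 1: "((\<lambda>t. y - t *\<^sub>R v) has_derivative (\<lambda>s. - (s *\<^sub>R v))) (at t)"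
      by (auto intro!: derivative_eq_intros)
    have 2: "(\<phi> has_derivative frechet_derivative \<phi> (at (y - t *\<^sub>R v))) (at (y - t *\<^sub>R v))"
      using test_function_props(2)[OF \<phi>] by (simp add: frechet_derivative_works[symmetric])
    have lin: "linear (frechet_derivative \<phi> (at (y - t *\<^sub>R v)))"
      using test_function_props(2)[OF \<phi>] by (rule linear_frechet_derivative)
    define c where "c = frechet_derivative \<phi> (at (y - t *\<^sub>R v)) v"
    have "(k has_derivative (\<lambda>x. - (x * c))) (at t)"
      unfolding k_def c_def using has_derivative_compose[OF 1 2] lin by (simp add: linear_neg linear_cmul)
    moreover have "(\<lambda>x. - (x * c)) = (*) (- c)" by (simp add: fun_eq_iff)
    ultimately show ?thesis by (simp add: has_field_derivative_def c_def)
  qed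
  have "(\<lambda>n. real (Suc n) * (k (1 / real (Suc n)) - k 0)) \<longlonglongrightarrow> - frechet_derivative \<phi> (at (y - 0 *\<^sub>R v)) v * 1"
  proof (rule chain_rule_sequentially[OF k])
    show "(\<lambda>n. 1 / real (Suc n)) \<longlonglongrightarrow> 0" using LIMSEQ_inverse_real_of_nat by (simp add: inverse_eq_divide)
  qed (simp del: of_nat_Suc)
  from tendsto_minus[OF this]
  show "(\<lambda>n. real (Suc n) * (\<phi> y - \<phi> (y - (1 / real (Suc n)) *\<^sub>R v))) \<longlonglongrightarrow> frechet_derivative \<phi> (at y) v"
    by (simp add: k_def algebra_simps del: of_nat_Suc)
  assume B: "\<And>x. \<bar>frechet_derivative \<phi> (at x) v\<bar> \<le> B"
  have pos: "0 < 1 / real (Suc n)" by simp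
  obtain z where z: "k (1 / real (Suc n)) - k 0 = (1 / real (Suc n) - 0) * (- frechet_derivative \<phi> (at (y - z *\<^sub>R v)) v)"
    using MVT2[OF pos k] by blast
  have "real (Suc n) * (\<phi> y - \<phi> (y - (1 / real (Suc n)) *\<^sub>R v)) = - (real (Suc n) * (k (1 / real (Suc n)) - k 0))"
    by (simp add: k_def algebra_simps del: of_nat_Suc)
  also have "\<dots> = frechet_derivative \<phi> (at (y - z *\<^sub>R v)) v" unfolding z by (simp del: of_nat_Suc)
  finally show "\<bar>real (Suc n) * (\<phi> y - \<phi> (y - (1 / real (Suc n)) *\<^sub>R v))\<bar> \<le> B" using B by simp
qed

text \<open>A discrete integration by parts: a translation moves the difference from H to \<phi>,
  whose quotients converge boundedly inside a fixed compact set, so boundedness of H suffices for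
  dominated convergence.\<close>

lemma integral_difference_quotient_tendsto:
  fixes H :: "'a::euclidean_space \<Rightarrow> real"
  assumes \<phi>: "\<phi> \<in> test_functions C" and [measurable]: "H \<in> borel_measurable borel" and M: "\<And>y. \<bar>H y\<bar> \<le> M"
  shows "(\<lambda>n. LINT y|lborel. real (Suc n) * (H y - H (y + (1 / real (Suc n)) *\<^sub>R v)) * \<phi> y)
    \<longlonglongrightarrow> (LINT y|lborel. H y * frechet_derivative \<phi> (at y) v)"
proof -
  have [measurable]: "\<phi> \<in> borel_measurable borel" by (rule test_function_measurable[OF \<phi>])
  obtain B where B: "B \<ge> 0" "\<And>x. \<bar>frechet_derivative \<phi> (at x) v\<bar> \<le> B"
    using frechet_derivative_bounded[OF \<phi>] by metis
  define S where "S = closure {x. \<phi> x \<noteq> 0}"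
  have \<phi>0: "\<phi> x = 0" if "x \<notin> S" for x using that closure_subset[of "{x. \<phi> x \<noteq> 0}"] by (auto simp: S_def)
  \<comment> \<open>Carries all the quotients at once, since the step 1 / (n + 1) lies in
    [0, 1].\<close>
  define Q where "Q = (\<lambda>(t, x). x + t *\<^sub>R v) ` ({0..1::real} \<times> S)"
  have Q: "compact Q"
    using test_function_props(4)[OF \<phi>] by (auto simp: Q_def S_def split_beta simp del: compact_closure
        intro!: compact_continuous_image compact_Times continuous_intros)
  define D where "D n y = real (Suc n) * (\<phi> y - \<phi> (y - (1 / real (Suc n)) *\<^sub>R v))" for n y
  have D0: "D n y = 0" if "y \<notin> Q" for n y
  proof -
    have "y \<notin> S"
    proof
      assume "y \<in> S"
      then have "(\<lambda>(t, x). x + t *\<^sub>R v) (0, y) \<in> Q" unfolding Q_def by (intro imageI) auto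
      with that show False by simp
    qed
    moreover have "y - (1 / real (Suc n)) *\<^sub>R v \<notin> S"
    proof
      assume "y - (1 / real (Suc n)) *\<^sub>R v \<in> S"
      then have "(\<lambda>(t, x). x + t *\<^sub>R v) (1 / real (Suc n), y - (1 / real (Suc n)) *\<^sub>R v) \<in> Q" unfolding Q_def by (intro imageI) auto
      with that show False by simp
    qed
    ultimately show ?thesis by (simp add: D_def \<phi>0)
  qed
  have DB: "\<bar>D n y\<bar> \<le> B" for n y unfolding D_def by (rule test_function_quotient(2)[OF \<phi> B(2)])
  have M0: "M \<ge> 0" using M[of 0] by simp
  have "(\<lambda>n. LINT y|lborel. H y * D n y) \<longlonglongrightarrow> (LINT y|lborel. H y * frechet_derivative \<phi> (at y) v)"
  proof (rule integral_dominated_convergence[where w="\<lambda>y. M * (B * indicator Q y)"])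
    show "(\<lambda>y. H y * frechet_derivative \<phi> (at y) v) \<in> borel_measurable lborel"
      using frechet_derivative_measurable[OF \<phi>, of v] by measurable
    show "(\<lambda>y. H y * D n y) \<in> borel_measurable lborel" for n unfolding D_def by measurable
    have "emeasure lborel Q < \<infinity>" using Q by (rule emeasure_compact_finite)
    then show "integrable lborel (\<lambda>y. M * (B * indicator Q y))"
      using Q by (intro integrable_mult_right integrable_real_indicator) (auto simp: borel_compact)
    show "AE y in lborel. (\<lambda>n. H y * D n y) \<longlonglongrightarrow> H y * frechet_derivative \<phi> (at y) v"
      unfolding D_def by (intro AE_I2 tendsto_mult tendsto_const test_function_quotient(1)[OF \<phi>])
    show "AE y in lborel. norm (H y * D n y) \<le> M * (B * indicator Q y)" for n
    proof (rule AE_I2)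
      fix y
      show "norm (H y * D n y) \<le> M * (B * indicator Q y)"
        using mult_mono[OF M[of y] DB[of n y] M0] D0[of y n] by (cases "y \<in> Q") (auto simp: abs_mult)
    qed
  qed
  moreover have "(LINT y|lborel. H y * D n y) = (LINT y|lborel. real (Suc n) * (H y - H (y + (1 / real (Suc n)) *\<^sub>R v)) * \<phi> y)" for n
  proof -
    let ?u = "(1 / real (Suc n)) *\<^sub>R v"
    have \<phi>i: "integrable lborel \<phi>" by (rule test_function_integrable[OF \<phi>])
    have i1: "integrable lborel (\<lambda>y. H y * \<phi> y)" by (rule integrable_bounded_mult[OF _ M \<phi>i]) measurable
    have i2: "integrable lborel (\<lambda>y. H (y + ?u) * \<phi> y)" by (rule integrable_bounded_mult[OF _ M \<phi>i]) measurable
    have i3: "integrable lborel (\<lambda>y. H y * \<phi> (y - ?u))"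
    proof -
      have "integrable lborel (\<lambda>y. H y * (D n y / real (Suc n)))"
      proof (rule integrable_bounded_mult[OF _ M])
        have "integrable lborel (D n)"
        proof (rule integrable_bounded_compact_support[OF _ DB Q D0])
          show "D n \<in> borel_measurable borel" unfolding D_def[abs_def] by measurable
        qed
        then show "integrable lborel (\<lambda>y. D n y / real (Suc n))" by simp
      qed measurable
      then have "integrable lborel (\<lambda>y. H y * \<phi> y - H y * (D n y / real (Suc n)))" by (rule Bochner_Integration.integrable_diff[OF i1])
      also have "(\<lambda>y. H y * \<phi> y - H y * (D n y / real (Suc n))) = (\<lambda>y. H y * \<phi> (y - ?u))"
        by (auto simp: D_def fun_eq_iff field_simps simp del: of_nat_Suc)
      finally show ?thesis .
    qed
    have "(LINT y|lborel. H y * \<phi> (y - ?u)) = (LINT y|lborel. H (y + ?u) * \<phi> (y + ?u - ?u))"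
      by (rule integral_translation[symmetric]) measurable
    then have tr: "(LINT y|lborel. H y * \<phi> (y - ?u)) = (LINT y|lborel. H (y + ?u) * \<phi> y)" by simp
    have "(LINT y|lborel. H y * D n y) = (LINT y|lborel. real (Suc n) * (H y * \<phi> y - H y * \<phi> (y - ?u)))"
      by (rule Bochner_Integration.integral_cong) (simp_all add: D_def algebra_simps)
    also have "\<dots> = real (Suc n) * ((LINT y|lborel. H y * \<phi> y) - (LINT y|lborel. H y * \<phi> (y - ?u)))"
      by (subst integral_mult_right_zero, subst Bochner_Integration.integral_diff[OF i1 i3]) (rule refl)
    also have "\<dots> = (LINT y|lborel. real (Suc n) * (H y * \<phi> y - H (y + ?u) * \<phi> y))"
      unfolding tr by (subst integral_mult_right_zero, subst Bochner_Integration.integral_diff[OF i1 i2]) (rule refl)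
    also have "\<dots> = (LINT y|lborel. real (Suc n) * (H y - H (y + ?u)) * \<phi> y)"
      by (rule Bochner_Integration.integral_cong) (simp_all add: algebra_simps)
    finally show ?thesis .
  qed
  ultimately show ?thesis by simp
qed

section \<open>The weak gradient of the extremal function\<close>

context extremal_function
begin

text \<open>The value - F'(N y), which will bound the dual norm of the gradient; it is set to 0 at
  the origin, where F' may be singular, and where N y \<ge> h.\<close>

definition "slope y = (if 0 < N y \<and> N y < h then w (N y) else 0)"

lemma slope_measurable [measurable]: "slope \<in> borel_measurable borel"
  unfolding slope_def[abs_def] by measurable

lemma slope_nonneg: "0 \<le> slope y"
  by (simp add: slope_def w_nonneg)

lemma F_le: "0 \<le> u \<Longrightarrow> \<bar>F u\<bar> \<le> F 0"
  using F_nonneg[of u] F_antimono[of 0 u] by simp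

text \<open>Since w decreases, freezing F below e caps its slope at \<open>w e\<close>.\<close>

lemma F_max_lipschitz: assumes e: "0 < e" shows "\<bar>F (max e a) - F (max e b)\<bar> \<le> w e * \<bar>a - b\<bar>"
proof -
  have *: "\<bar>F (max e a) - F (max e b)\<bar> \<le> w e * \<bar>a - b\<bar>" if "a \<le> b" for a b
  proof -
    have "F (max e b) \<le> F (max e a)" using e that by (intro F_antimono) auto
    moreover have "F (max e a) - F (max e b) \<le> w e * (max e b - max e a)" using e that by (intro F_diff_le) auto
    moreover have "w e * (max e b - max e a) \<le> w e * (b - a)" using that by (intro mult_left_mono w_nonneg) auto
    ultimately show ?thesis using that by simp
  qed
  show ?thesis
  proof (cases "a \<le> b")
    case False
    then show ?thesis using *[of b a] by (simp add: abs_minus_commute)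
  qed (rule *)
qed

lemma F_max_continuous: assumes e: "0 < e" shows "continuous_on UNIV (\<lambda>u. F (max e u))"
proof (rule lipschitz_on_continuous_on[where L="w e"])
  show "(w e)-lipschitz_on UNIV (\<lambda>u. F (max e u))"
    using F_max_lipschitz[OF e] w_nonneg by (intro lipschitz_onI) (auto simp: dist_real_def)
qed

lemma F_max_DERIV:
  assumes e: "0 < e" and u: "u \<noteq> e" "u \<noteq> h"
  shows "((\<lambda>u. F (max e u)) has_real_derivative (if e < u \<and> u < h then - w u else 0)) (at u)"
proof -
  consider "e < u" "u < h" | "u < e" | "h < u" "e < u" using u by linarith
  then show ?thesis
  proof cases
    case 1
    have "((\<lambda>u. F (max e u)) has_real_derivative - w u) (at u)"
      by (rule DERIV_cong_ev[THEN iffD1, OF refl _ refl F_DERIV])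
        (rule eventually_mono[OF eventually_nhds_in_open[of "{e<..}" u]], use 1 e in auto)
    with 1 show ?thesis by simp
  next
    case 2
    have "((\<lambda>u. F (max e u)) has_real_derivative 0) (at u)"
      by (rule DERIV_cong_ev[THEN iffD1, OF refl _ refl DERIV_const[of "F e"]])
        (rule eventually_mono[OF eventually_nhds_in_open[of "{..<e}" u]], use 2 e in auto)
    with 2 show ?thesis by simp
  next
    case 3
    have z: "0 = F (max e x)" if "x \<in> {h<..}" for x using that F_zero[of "max e x"] by simp
    have "((\<lambda>u. F (max e u)) has_real_derivative 0) (at u)"
      by (rule DERIV_cong_ev[THEN iffD1, OF refl _ refl DERIV_const[of 0]])
        (rule eventually_mono[OF eventually_nhds_in_open[of "{h<..}" u]], use 3 z in auto)
    with 3 show ?thesis by simp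
  qed
qed

lemma F_max_N_measurable [measurable]: "0 < e \<Longrightarrow> (\<lambda>y. F (max e (N y))) \<in> borel_measurable borel"
  by (rule measurable_compose[OF borel_measurable_body_norm borel_measurable_continuous_onI[OF F_max_continuous]])

lemma F_max_le: "0 < e \<Longrightarrow> \<bar>F (max e u)\<bar> \<le> F 0"
  by (intro F_le) auto

text \<open>\<open>F (max e (N y))\<close> is Lipschitz, so its difference quotients are bounded and converge
  almost everywhere; the singularity of \<open>F'\<close> at \<open>0\<close> only enters in the limit \<open>e \<rightarrow> 0\<close>.\<close>

lemma weak_derivative_truncated:
  assumes \<phi>: "\<phi> \<in> test_functions C" and e: "0 < e"
  shows "(LINT y|lborel. F (max e (N y)) * frechet_derivative \<phi> (at y) v)
    = (LINT y|lborel. (if e < N y then slope y else 0) * dN v y * \<phi> y)"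
proof -
  let ?H = "\<lambda>y. F (max e (N y))"
  let ?q = "\<lambda>n y. real (Suc n) * (?H y - ?H (y + (1 / real (Suc n)) *\<^sub>R v))"
  have [measurable]: "\<phi> \<in> borel_measurable borel" by (rule test_function_measurable[OF \<phi>])
  note [measurable] = F_max_N_measurable[OF e]
  have [measurable]: "(\<lambda>y. F (max e (N (y + z)))) \<in> borel_measurable borel" for z
    by (rule measurable_compose[OF _ F_max_N_measurable[OF e]]) measurable
  have qb: "\<bar>?q n y\<bar> \<le> w e * N v" for n y
  proof -
    have "\<bar>?H y - ?H (y + (1 / real (Suc n)) *\<^sub>R v)\<bar> \<le> w e * \<bar>N y - N (y + (1 / real (Suc n)) *\<^sub>R v)\<bar>"
      by (rule F_max_lipschitz[OF e])
    then have "real (Suc n) * \<bar>?H y - ?H (y + (1 / real (Suc n)) *\<^sub>R v)\<bar> \<le> real (Suc n) * (w e * \<bar>N y - N (y + (1 / real (Suc n)) *\<^sub>R v)\<bar>)"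
      by (intro mult_left_mono) auto
    also have "\<dots> = w e * \<bar>real (Suc n) * (N (y + (1 / real (Suc n)) *\<^sub>R v) - N y)\<bar>"
      unfolding abs_mult by (simp add: abs_minus_commute mult.left_commute del: of_nat_Suc)
    also have "\<dots> \<le> w e * N v" by (intro mult_left_mono dN_quotient_bound w_nonneg)
    finally show ?thesis unfolding abs_mult by (simp del: of_nat_Suc)
  qed
  have "(\<lambda>n. LINT y|lborel. ?q n y * \<phi> y) \<longlonglongrightarrow> (LINT y|lborel. (if e < N y then slope y else 0) * dN v y * \<phi> y)"
  proof (rule integral_dominated_convergence[where w="\<lambda>y. w e * N v * \<bar>\<phi> y\<bar>"])
    show "integrable lborel (\<lambda>y. w e * N v * \<bar>\<phi> y\<bar>)" using test_function_integrable[OF \<phi>] by simp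
    show "AE y in lborel. norm (?q n y * \<phi> y) \<le> w e * N v * \<bar>\<phi> y\<bar>" for n
      using mult_right_mono[OF qb abs_ge_zero] by (intro AE_I2) (simp add: abs_mult)
    show "AE y in lborel. (\<lambda>n. ?q n y * \<phi> y) \<longlonglongrightarrow> (if e < N y then slope y else 0) * dN v y * \<phi> y"
      \<comment> \<open>The spheres N y = e and N y = h are the only places where the truncated
        profile may fail to be differentiable.\<close>
      using AE_body_norm_neq[OF less_imp_le[OF e]] AE_body_norm_neq[OF less_imp_le[OF h]]
    proof eventually_elim
      case (elim y)
      show ?case
      proof (cases "y \<in> C")
        case True
        then have y: "N y \<noteq> e" "N y \<noteq> h" using elim by auto
        have lim: "(\<lambda>n. N (y + (1 / real (Suc n)) *\<^sub>R v)) \<longlonglongrightarrow> N y"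
        proof -
          have "(\<lambda>n. y + (1 / real (Suc n)) *\<^sub>R v) \<longlonglongrightarrow> y + 0 *\<^sub>R v"
            using LIMSEQ_inverse_real_of_nat by (intro tendsto_intros) (simp add: inverse_eq_divide)
          then show ?thesis
            using continuous_on_tendsto_compose[OF continuous_on_body_norm[OF continuous_on_id, of UNIV]] by auto
        qed
        have "(\<lambda>n. real (Suc n) * (?H (y + (1 / real (Suc n)) *\<^sub>R v) - ?H y)) \<longlonglongrightarrow> (if e < N y \<and> N y < h then - w (N y) else 0) * dN v y"
          by (rule chain_rule_sequentially[OF F_max_DERIV[OF e y] lim dN_tendsto])
        from tendsto_mult_right[OF tendsto_minus[OF this], of "\<phi> y"]
        have "(\<lambda>n. - (real (Suc n) * (?H (y + (1 / real (Suc n)) *\<^sub>R v) - ?H y)) * \<phi> y)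
           \<longlonglongrightarrow> - ((if e < N y \<and> N y < h then - w (N y) else 0) * dN v y) * \<phi> y" .
        also have "(\<lambda>n. - (real (Suc n) * (?H (y + (1 / real (Suc n)) *\<^sub>R v) - ?H y)) * \<phi> y) = (\<lambda>n. ?q n y * \<phi> y)"
          by (simp add: fun_eq_iff right_diff_distrib)
        also have "- ((if e < N y \<and> N y < h then - w (N y) else 0) * dN v y) * \<phi> y = (if e < N y then slope y else 0) * dN v y * \<phi> y"
          using e by (simp add: slope_def)
        finally show ?thesis .
      next
        case False
        then have "\<phi> y = 0" using test_function_props(5)[OF \<phi>] closure_subset[of "{x. \<phi> x \<noteq> 0}"] by auto
        then show ?thesis by simp
      qed
    qed
  qed measurable
  moreover have "(\<lambda>n. LINT y|lborel. ?q n y * \<phi> y) \<longlonglongrightarrow> (LINT y|lborel. ?H y * frechet_derivative \<phi> (at y) v)"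
    by (rule integral_difference_quotient_tendsto[OF \<phi> _ F_max_le[OF e]]) measurable
  ultimately show ?thesis by (rule LIMSEQ_unique[rotated])
qed

lemma F_max_tendsto: assumes u: "0 \<le> u" shows "(\<lambda>n. F (max (1 / real (Suc n)) u)) \<longlonglongrightarrow> F u"
proof (cases "u = 0")
  case True
  have "max (1 / real (Suc n)) 0 = 1 / real (Suc n)" for n by simp
  then show ?thesis using F_tendsto_0 True by (simp only:)
next
  case False
  then have "\<forall>\<^sub>F n in sequentially. 1 / real (Suc n) < u"
    using order_tendstoD(2)[OF LIMSEQ_inverse_real_of_nat, of u] u by (simp add: inverse_eq_divide)
  then have "\<forall>\<^sub>F n in sequentially. F u = F (max (1 / real (Suc n)) u)"
    by eventually_elim (simp add: max_absorb2 del: of_nat_Suc)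
  then show ?thesis by (rule Lim_transform_eventually[OF tendsto_const])
qed

lemma FN_measurable [measurable]: "(\<lambda>y. F (N y)) \<in> borel_measurable borel"
  by (rule borel_measurable_LIMSEQ_real[OF F_max_tendsto[OF body_norm_nonneg] F_max_N_measurable]) simp

lemma I_pos: "I > 0"
proof -
  have D: "DIM('a) \<ge> 1" by (simp add: Suc_leI)
  have "X > 0" unfolding g_fun_Lp(2)[OF h p] using A_recip_pos[OF D q_bounds(1,2)] measure_section_pos h by simp
  then show ?thesis by (simp add: I_def)
qed

text \<open>As (s - 1) p = s, the p-th power of the slope is the s-th power of g, whose integral
  over the section is I.\<close>

lemma slope_powr_integral:
  assumes r: "p = ereal r"
  shows "(\<integral>\<^sup>+y. ennreal (slope y powr r) * indicator C y \<partial>lborel) \<le> ennreal I"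
proof -
  have r1: "r > 1"
  proof -
    have "ereal 1 < p" by (rule order.strict_trans1[OF _ p]) (simp add: Suc_leI)
    then show ?thesis using r by simp
  qed
  have sr: "(s - 1) * r = s" using r1 by (simp add: r conj_exp_def field_simps)
  have "(\<integral>\<^sup>+y. ennreal (slope y powr r) * indicator C y \<partial>lborel) \<le> (\<integral>\<^sup>+y. ennreal (\<bar>g h (N y)\<bar> powr s) * indicator (V h) y \<partial>lborel)"
  proof (rule nn_integral_mono)
    fix y :: 'a
    show "ennreal (slope y powr r) * indicator C y \<le> ennreal (\<bar>g h (N y)\<bar> powr s) * indicator (V h) y"
    proof (cases "y \<in> C \<and> 0 < N y \<and> N y < h")
      case True
      then have "slope y powr r = \<bar>g h (N y)\<bar> powr s"
        using g_fun_pos[of "N y" h] by (simp add: slope_def w_def powr_powr sr)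
      moreover have "y \<in> V h" using True section_iff[OF h] by blast
      ultimately show ?thesis using True by simp
    qed (auto simp: slope_def indicator_def)
  qed
  then show ?thesis by (simp add: nn_integral_g_powr)
qed

lemma slope_le_1: assumes "p = \<infinity>" shows "slope y \<le> 1"
proof -
  have s: "s - 1 = 0" using assms by (simp add: conj_exp_def)
  show ?thesis unfolding slope_def w_def s by simp
qed

text \<open>For p = \<infinity> the factor \<open>I powr recip_exp p\<close> is 1 and the slope is
  at most 1, so the same bound covers both ranges of p.\<close>

lemma Lp_dominated:
  assumes k: "k \<in> borel_measurable (lebesgue_on C)" and c: "c \<ge> 0"
    and le: "AE x in lebesgue. x \<in> C \<longrightarrow> \<bar>k x\<bar> \<le> c * slope x"
  shows "k \<in> Lp_space p C" "Lp_norm p C k \<le> c * I powr recip_exp p"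
proof -
  have "k \<in> Lp_space p C \<and> Lp_norm p C k \<le> c * I powr recip_exp p"
  proof (cases "p = \<infinity>")
    case True
    have "AE x in lebesgue. x \<in> C \<longrightarrow> \<bar>k x\<bar> \<le> c"
      using le
    proof eventually_elim
      case (elim x)
      then show ?case using mult_left_mono[OF slope_le_1[OF True, of x] c] by auto
    qed
    then show ?thesis using Lp_infinityI[OF k open_cone cone_nonempty] True I_pos by (simp add: recip_exp_def)
  next
    case False
    then obtain r where r: "p = ereal r" using p by (cases p) auto
    have "ereal 1 < p" by (rule order.strict_trans1[OF _ p]) (simp add: Suc_leI)
    then have r1: "r > 1" using r by simp
    define A where "A = c * I powr (1 / r)"
    have A: "A \<ge> 0" using c by (simp add: A_def)
    have CL: "C \<in> sets lebesgue" using open_cone by simp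
    have "(\<integral>\<^sup>+x. ennreal (\<bar>k x\<bar> powr r) * indicator C x \<partial>lebesgue) \<le> (\<integral>\<^sup>+x. ennreal (c powr r) * (ennreal (slope x powr r) * indicator C x) \<partial>lebesgue)"
    proof (rule nn_integral_mono_AE)
      show "AE x in lebesgue. ennreal (\<bar>k x\<bar> powr r) * indicator C x \<le> ennreal (c powr r) * (ennreal (slope x powr r) * indicator C x)"
        using le
      proof eventually_elim
        case (elim x)
        show ?case
        proof (cases "x \<in> C")
          case True
          then have "\<bar>k x\<bar> powr r \<le> (c * slope x) powr r" using elim r1 by (intro powr_mono2) auto
          also have "\<dots> = c powr r * slope x powr r" using c slope_nonneg by (simp add: powr_mult)
          finally show ?thesis using True by (simp add: ennreal_mult'[symmetric] ennreal_leI)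
        qed simp
      qed
    qed
    also have "\<dots> = (\<integral>\<^sup>+x. ennreal (c powr r) * (ennreal (slope x powr r) * indicator C x) \<partial>lborel)"
      by (rule nn_integral_completion)
    also have "\<dots> = ennreal (c powr r) * (\<integral>\<^sup>+x. ennreal (slope x powr r) * indicator C x \<partial>lborel)"
      by (rule nn_integral_cmult) measurable
    also have "\<dots> \<le> ennreal (c powr r) * ennreal I" by (intro mult_left_mono slope_powr_integral[OF r]) simp
    also have "\<dots> = ennreal (A powr r)"
      using c I_pos r1 by (simp add: A_def ennreal_mult'[symmetric] powr_mult powr_powr)
    finally have fin: "(\<integral>\<^sup>+x. ennreal (\<bar>k x\<bar> powr r) * indicator C x \<partial>lebesgue) \<le> ennreal (A powr r)" .
    have r0: "r > 0" using r1 by simp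
    show ?thesis using Lp_finiteI[OF k r0 CL A fin] by (simp add: r A_def recip_exp_def)
  qed
  then show "k \<in> Lp_space p C" "Lp_norm p C k \<le> c * I powr recip_exp p" by auto
qed

text \<open>The elementary bound x^(s - 1) \<le> 1 + x^s reduces the claim to the finite measure of
  the section and the finite integral I.\<close>

lemma slope_integrable: "integrable lborel (\<lambda>y. indicator C y * slope y)"
proof (rule integrableI_bounded)
  have "(\<integral>\<^sup>+y. ennreal (norm (indicator C y * slope y)) \<partial>lborel)
     \<le> (\<integral>\<^sup>+y. indicator (V h) y + ennreal (\<bar>g h (N y)\<bar> powr s) * indicator (V h) y \<partial>lborel)"
  proof (rule nn_integral_mono)
    fix y :: 'a
    show "ennreal (norm (indicator C y * slope y)) \<le> indicator (V h) y + ennreal (\<bar>g h (N y)\<bar> powr s) * indicator (V h) y"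
    proof (cases "y \<in> C \<and> 0 < N y \<and> N y < h")
      case True
      have gp: "g h (N y) > 0" using g_fun_pos[of "N y" h] True by simp
      have "w (N y) \<le> 1 + \<bar>g h (N y)\<bar> powr s"
      proof (cases "g h (N y) \<le> 1")
        case le: True
        then have "w (N y) \<le> 1" unfolding w_def using gp s_ge_1 by (intro powr_le1) auto
        then show ?thesis by (smt (verit) powr_ge_zero)
      next
        case False
        then have "w (N y) \<le> \<bar>g h (N y)\<bar> powr s" unfolding w_def using gp by (simp add: powr_mono)
        then show ?thesis by simp
      qed
      then have "ennreal (w (N y)) \<le> ennreal (1 + \<bar>g h (N y)\<bar> powr s)" by (rule ennreal_leI)
      also have "\<dots> = 1 + ennreal (\<bar>g h (N y)\<bar> powr s)" by (subst ennreal_plus) auto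
      finally have "ennreal (w (N y)) \<le> 1 + ennreal (\<bar>g h (N y)\<bar> powr s)" .
      moreover have "y \<in> V h" using True section_iff[OF h] by blast
      ultimately show ?thesis using True w_nonneg[of "N y"] by (simp add: slope_def)
    qed (auto simp: slope_def indicator_def)
  qed
  also have "\<dots> = emeasure lborel (V h) + ennreal I"
    using nn_integral_indicator[of "V h" lborel] by (subst nn_integral_add) (auto simp: nn_integral_g_powr simp del: indicator_inter_arith)
  also have "\<dots> < \<infinity>" by (simp add: emeasure_section[OF h])
  finally show "(\<integral>\<^sup>+y. ennreal (norm (indicator C y * slope y)) \<partial>lborel) < \<infinity>" .
qed measurable

text \<open>The truncation level tends to 0 along 1 / (n + 1). The majorants are F 0 times the
  derivative of the test function on the left and a multiple of the integrable slope on the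
  right.\<close>

lemma weak_derivative_FN:
  assumes \<phi>: "\<phi> \<in> test_functions C"
  shows "(LINT y|lborel. F (N y) * frechet_derivative \<phi> (at y) v) = (LINT y|lborel. slope y * dN v y * \<phi> y)"
proof -
  have [measurable]: "\<phi> \<in> borel_measurable borel" by (rule test_function_measurable[OF \<phi>])
  note [measurable] = frechet_derivative_measurable[OF \<phi>, of v]
  obtain B where B: "B \<ge> 0" "\<And>x. \<bar>\<phi> x\<bar> \<le> B" using test_function_bounded[OF \<phi>] by blast
  have \<phi>0: "\<phi> y = 0" if "y \<notin> C" for y
    using that test_function_props(5)[OF \<phi>] closure_subset[of "{x. \<phi> x \<noteq> 0}"] by auto
  let ?e = "\<lambda>n. 1 / real (Suc n)"
  have e: "?e n > 0" for n by simp
  have 1: "(\<lambda>n. LINT y|lborel. F (max (?e n) (N y)) * frechet_derivative \<phi> (at y) v) \<longlonglongrightarrow> (LINT y|lborel. F (N y) * frechet_derivative \<phi> (at y) v)"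
  proof (rule integral_dominated_convergence[where w="\<lambda>y. F 0 * \<bar>frechet_derivative \<phi> (at y) v\<bar>"])
    show "integrable lborel (\<lambda>y. F 0 * \<bar>frechet_derivative \<phi> (at y) v\<bar>)" using frechet_derivative_integrable[OF \<phi>] by simp
    show "AE y in lborel. (\<lambda>n. F (max (?e n) (N y)) * frechet_derivative \<phi> (at y) v) \<longlonglongrightarrow> F (N y) * frechet_derivative \<phi> (at y) v"
      by (intro AE_I2 tendsto_mult tendsto_const F_max_tendsto body_norm_nonneg)
    show "AE y in lborel. norm (F (max (?e n) (N y)) * frechet_derivative \<phi> (at y) v) \<le> F 0 * \<bar>frechet_derivative \<phi> (at y) v\<bar>" for n
    proof (rule AE_I2)
      fix y
      show "norm (F (max (?e n) (N y)) * frechet_derivative \<phi> (at y) v) \<le> F 0 * \<bar>frechet_derivative \<phi> (at y) v\<bar>"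
        using mult_right_mono[OF F_max_le[OF e[of n], of "N y"], of "\<bar>frechet_derivative \<phi> (at y) v\<bar>"] by (simp add: abs_mult)
    qed
    show "(\<lambda>y. F (max (?e n) (N y)) * frechet_derivative \<phi> (at y) v) \<in> borel_measurable lborel" for n
      using F_max_N_measurable[OF e[of n]] by measurable
  qed measurable
  have 2: "(\<lambda>n. LINT y|lborel. (if ?e n < N y then slope y else 0) * dN v y * \<phi> y) \<longlonglongrightarrow> (LINT y|lborel. slope y * dN v y * \<phi> y)"
  proof (rule integral_dominated_convergence[where w="\<lambda>y. (N v * B) * (indicator C y * slope y)"])
    show "integrable lborel (\<lambda>y. (N v * B) * (indicator C y * slope y))" using slope_integrable by (rule integrable_mult_right)
    show "AE y in lborel. (\<lambda>n. (if ?e n < N y then slope y else 0) * dN v y * \<phi> y) \<longlonglongrightarrow> slope y * dN v y * \<phi> y"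
    proof (rule AE_I2)
      fix y
      have "(\<lambda>n. (if ?e n < N y then slope y else 0)) \<longlonglongrightarrow> slope y"
      proof (cases "0 < N y")
        case True
        have "\<forall>\<^sub>F n in sequentially. ?e n < N y"
          using order_tendstoD(2)[OF LIMSEQ_inverse_real_of_nat True] by (simp add: inverse_eq_divide)
        then have "\<forall>\<^sub>F n in sequentially. slope y = (if ?e n < N y then slope y else 0)" by eventually_elim (simp only: if_True)
        then show ?thesis by (rule Lim_transform_eventually[OF tendsto_const])
      next
        case False
        then have z: "slope y = 0" by (simp add: slope_def)
        show ?thesis unfolding z if_cancel by (rule tendsto_const)
      qed
      then show "(\<lambda>n. (if ?e n < N y then slope y else 0) * dN v y * \<phi> y) \<longlonglongrightarrow> slope y * dN v y * \<phi> y"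
        by (intro tendsto_mult tendsto_const)
    qed
    show "AE y in lborel. norm ((if ?e n < N y then slope y else 0) * dN v y * \<phi> y) \<le> (N v * B) * (indicator C y * slope y)" for n
    proof (rule AE_I2)
      fix y
      show "norm ((if ?e n < N y then slope y else 0) * dN v y * \<phi> y) \<le> (N v * B) * (indicator C y * slope y)"
      proof (cases "y \<in> C")
        case True
        have "\<bar>if ?e n < N y then slope y else 0\<bar> \<le> slope y" using slope_nonneg[of y] by simp
        then have "\<bar>if ?e n < N y then slope y else 0\<bar> * \<bar>dN v y\<bar> * \<bar>\<phi> y\<bar> \<le> slope y * N v * B"
          using slope_nonneg[of y] by (intro mult_mono dN_bound B mult_nonneg_nonneg) auto
        then show ?thesis using True by (simp add: abs_mult ac_simps)
      qed (simp add: \<phi>0)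
    qed
  qed measurable
  show ?thesis
    by (rule LIMSEQ_unique[OF 1]) (use 2 in \<open>simp only: weak_derivative_truncated[OF \<phi> e]\<close>)
qed

lemma fe_eq_indicator: "fe y = indicator C y * F (N y)"
  by (cases "y \<in> C") (auto simp: fe_eq, simp add: f_ext_def)

lemma fe_measurable [measurable]: "fe \<in> borel_measurable borel"
  unfolding fe_eq_indicator[abs_def] by measurable

lemma fe_bounds: "0 \<le> fe y" "\<bar>fe y\<bar> \<le> F 0"
  using F_nonneg F_le[of "N y"] F_pos by (auto simp: fe_eq_indicator indicator_def)

lemma fe_loc_integrable: "fe \<in> loc_integrable C"
  unfolding loc_integrable_def set_integrable_def
proof safe
  fix Q assume Q: "compact Q" "Q \<subseteq> C"
  have "Q \<in> sets borel" using Q(1) by (simp add: borel_compact)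
  then have m: "(\<lambda>x. indicator Q x *\<^sub>R fe x) \<in> borel_measurable borel"
    by (intro borel_measurable_scaleR borel_measurable_indicator fe_measurable)
  have "integrable lborel (\<lambda>x. indicator Q x *\<^sub>R fe x)"
  proof (rule integrable_bounded_compact_support[OF m _ Q(1), of "F 0"])
    show "\<bar>indicator Q x *\<^sub>R fe x\<bar> \<le> F 0" for x using fe_bounds(2)[of x] F_pos by (simp add: indicator_def)
  qed simp
  moreover have "(\<lambda>x. indicator Q x *\<^sub>R fe x) \<in> borel_measurable lborel" using m by simp
  ultimately show "integrable lebesgue (\<lambda>x. indicator Q x *\<^sub>R fe x)" by (subst integrable_completion) auto
qed

text \<open>The derivative of \<open>fe\<close> along v predicted by the chain rule: F'(N y) times
  the directional derivative of N.\<close>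

definition "ddir v y = - (slope y * dN v y)"

lemma ddir_measurable [measurable]: "ddir v \<in> borel_measurable borel"
  unfolding ddir_def[abs_def] by measurable

lemma ddir_bound: "\<bar>ddir v y\<bar> \<le> N v * slope y"
  using mult_left_mono[OF dN_bound[of v y] slope_nonneg[of y]] slope_nonneg[of y]
  by (simp add: ddir_def abs_mult mult.commute)

lemma ddir_loc_integrable: "ddir v \<in> loc_integrable C"
  unfolding loc_integrable_def set_integrable_def
proof safe
  fix Q assume Q: "compact Q" "Q \<subseteq> C"
  have [measurable]: "Q \<in> sets borel" using Q(1) by (simp add: borel_compact)
  have "integrable lborel (\<lambda>x. indicator Q x *\<^sub>R ddir v x)"
  proof (rule Bochner_Integration.integrable_bound[OF integrable_mult_right[OF slope_integrable, of "N v"]])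
    show "AE x in lborel. norm (indicator Q x *\<^sub>R ddir v x) \<le> norm (N v * (indicator C x * slope x))"
    proof (rule AE_I2)
      fix x
      show "norm (indicator Q x *\<^sub>R ddir v x) \<le> norm (N v * (indicator C x * slope x))"
        using ddir_bound[of v x] slope_nonneg[of x] Q(2) by (cases "x \<in> Q") (auto simp: abs_mult subset_iff)
    qed
  qed measurable
  then show "integrable lebesgue (\<lambda>x. indicator Q x *\<^sub>R ddir v x)" by (subst integrable_completion) auto
qed

lemma weak_direction_fe:
  assumes \<phi>: "\<phi> \<in> test_functions C"
  shows "(LINT x:C|lebesgue. fe x * frechet_derivative \<phi> (at x) v) = - (LINT x:C|lebesgue. ddir v x * \<phi> x)"
proof -
  have [measurable]: "\<phi> \<in> borel_measurable borel" by (rule test_function_measurable[OF \<phi>])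
  note [measurable] = frechet_derivative_measurable[OF \<phi>, of v]
  have \<phi>0: "\<phi> y = 0" if "y \<notin> C" for y
    using that test_function_props(5)[OF \<phi>] closure_subset[of "{x. \<phi> x \<noteq> 0}"] by auto
  have D0: "frechet_derivative \<phi> (at y) v = 0" if "y \<notin> C" for y
  proof -
    have "y \<notin> closure {x. \<phi> x \<noteq> 0}" using that test_function_props(5)[OF \<phi>] by blast
    from frechet_derivative_outside_support[OF \<phi> this] show ?thesis by simp
  qed
  have "(LINT x:C|lebesgue. fe x * frechet_derivative \<phi> (at x) v) = (LINT x|lebesgue. F (N x) * frechet_derivative \<phi> (at x) v)"
    unfolding set_lebesgue_integral_def
  proof (rule Bochner_Integration.integral_cong)
    show "indicator C x *\<^sub>R (fe x * frechet_derivative \<phi> (at x) v) = F (N x) * frechet_derivative \<phi> (at x) v" for x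
      using D0[of x] by (cases "x \<in> C") (simp_all add: fe_eq_indicator)
  qed simp
  also have "\<dots> = (LINT x|lborel. F (N x) * frechet_derivative \<phi> (at x) v)" by (rule integral_completion) measurable
  also have "\<dots> = (LINT x|lborel. slope x * dN v x * \<phi> x)" by (rule weak_derivative_FN[OF \<phi>])
  also have "\<dots> = (LINT x|lebesgue. slope x * dN v x * \<phi> x)" by (rule integral_completion[symmetric]) measurable
  also have "\<dots> = (LINT x|lebesgue. - (indicator C x *\<^sub>R (ddir v x * \<phi> x)))"
  proof (rule Bochner_Integration.integral_cong)
    show "slope x * dN v x * \<phi> x = - (indicator C x *\<^sub>R (ddir v x * \<phi> x))" for x
      using \<phi>0[of x] by (cases "x \<in> C") (simp_all add: ddir_def)
  qed simp
  finally show ?thesis by (simp add: set_lebesgue_integral_def)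
qed

lemma ddir_Lp: "ddir v \<in> Lp_space p C"
proof (rule Lp_dominated(1)[of _ "N v"])
  show "ddir v \<in> borel_measurable (lebesgue_on C)"
    by (intro measurable_restrict_space1 measurable_completion) simp
qed (use ddir_bound in auto)

lemma fe_W1p: "fe \<in> W1p p C"
  using fe_loc_integrable ddir_Lp ddir_loc_integrable weak_direction_fe
  by (auto simp: W1p_def weak_partial_def intro!: bexI[of _ "ddir _"])

text \<open>For a fixed v both functions represent the weak derivative of \<open>fe\<close> along v;
  the exceptional null set depends on v.\<close>

lemma gradient_direction: "AE x in lebesgue. x \<in> C \<longrightarrow> weak_gradient C fe x \<bullet> v = ddir v x"
proof (rule AE_eq_of_test_functions[OF open_cone _ ddir_loc_integrable])
  have wp: "weak_partial C fe i (\<lambda>x. weak_gradient C fe x \<bullet> i)" if "i \<in> Basis" for i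
    by (rule weak_gradient_weak_partial[OF fe_W1p that])
  show "(\<lambda>x. weak_gradient C fe x \<bullet> v) \<in> loc_integrable C"
    unfolding loc_integrable_def
  proof safe
    fix Q assume Q: "compact Q" "Q \<subseteq> C"
    have "(\<lambda>x. \<Sum>i\<in>Basis. (v \<bullet> i) * (weak_gradient C fe x \<bullet> i)) absolutely_integrable_on Q"
      using wp Q by (intro absolutely_integrable_sum set_integrable_mult_right) (auto simp: weak_partial_def loc_integrable_def)
    also have "(\<lambda>x. \<Sum>i\<in>Basis. (v \<bullet> i) * (weak_gradient C fe x \<bullet> i)) = (\<lambda>x. weak_gradient C fe x \<bullet> v)"
      by (simp add: euclidean_inner[of _ v] mult.commute)
    finally show "(\<lambda>x. weak_gradient C fe x \<bullet> v) absolutely_integrable_on Q" .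
  qed
  show "(LINT x:C|lebesgue. (weak_gradient C fe x \<bullet> v) * \<phi> x) = (LINT x:C|lebesgue. ddir v x * \<phi> x)"
    if "\<phi> \<in> test_functions C" for \<phi>
    using weak_partial_direction[OF open_cone fe_loc_integrable wp that, of v] weak_direction_fe[OF that, of v] by simp
qed

text \<open>The dual norm involves all directions at once, while the null sets of
  \<open>gradient_direction\<close> depend on v. A countable dense set of directions has a common
  null set, and the inequality between the inner product with the gradient and slope times N v is a
  closed condition on v.\<close>

lemma dual_gradient_le: "AE x in lebesgue. x \<in> C \<longrightarrow> \<bar>N\<^sub>d (weak_gradient C fe x)\<bar> \<le> 1 * slope x"
proof -
  obtain Z :: "'a set" where Z: "countable Z" "UNIV \<subseteq> closure Z"
    using separable[of "UNIV :: 'a set"] by metis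
  have "AE x in lebesgue. \<forall>v\<in>Z. x \<in> C \<longrightarrow> weak_gradient C fe x \<bullet> v = ddir v x"
    using gradient_direction by (intro AE_ball_countable[THEN iffD2] Z(1)) auto
  then show ?thesis
  proof eventually_elim
    case (elim x)
    show ?case
    proof
      assume x: "x \<in> C"
      have "closed {v. v \<bullet> weak_gradient C fe x \<le> slope x * N v}"
        by (intro closed_Collect_le continuous_intros continuous_on_body_norm)
      moreover have "Z \<subseteq> {v. v \<bullet> weak_gradient C fe x \<le> slope x * N v}"
      proof
        fix v assume "v \<in> Z"
        then have "weak_gradient C fe x \<bullet> v = ddir v x" using elim x by blast
        then show "v \<in> {v. v \<bullet> weak_gradient C fe x \<le> slope x * N v}"
          using ddir_bound[of v x] by (simp add: inner_commute mult.commute)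
      qed
      ultimately have "closure Z \<subseteq> {v. v \<bullet> weak_gradient C fe x \<le> slope x * N v}" by (rule closure_minimal[rotated])
      then have "N\<^sub>d (weak_gradient C fe x) \<le> slope x"
        using Z(2) by (intro dual_body_norm_le slope_nonneg) auto
      then show "\<bar>N\<^sub>d (weak_gradient C fe x)\<bar> \<le> 1 * slope x" by simp
    qed
  qed
qed

lemma gradient_norm_le: "Lp_norm p C (\<lambda>x. N\<^sub>d (weak_gradient C fe x)) \<le> I powr recip_exp p"
  using Lp_dominated(2)[OF measurable_dual_gradient[OF fe_W1p] _ dual_gradient_le] by simp

end

subsection \<open>The inequalities and their sharpness\<close>

context cone_body
begin

lemma Lp_1_nn_integral:
  assumes f: "f \<in> Lp_space 1 C"
  shows "(\<integral>\<^sup>+x. ennreal \<bar>f x\<bar> * indicator C x \<partial>lborel) = ennreal (Lp_norm 1 C f)"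
proof -
  have CL: "C \<in> sets lebesgue" using open_cone by simp
  have "(\<integral>\<^sup>+x. ennreal (\<bar>f x\<bar> powr 1) * indicator C x \<partial>lebesgue) = ennreal (Lp_norm (ereal 1) C f powr 1)"
    by (rule Lp_finite_nn_integral[OF _ _ CL]) (use f in \<open>simp_all add: one_ereal_def\<close>)
  then show ?thesis using Lp_norm_finite_nonneg[of 1 C f] by (simp add: nn_integral_completion one_ereal_def)
qed

text \<open>The translate x + V h lies in C, so only a part of the integral of |f| over C is
  involved.\<close>

lemma translated_integral_le:
  assumes f: "f \<in> Lp_space 1 C" and h: "h > 0" and x: "x \<in> C"
  shows "\<bar>LINT u:V h|lebesgue. f (x + u)\<bar> \<le> Lp_norm 1 C f"
proof -
  have CL: "C \<in> sets lebesgue" using open_cone by simp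
  have "f \<in> borel_measurable (lebesgue_on C)" using f by (simp add: Lp_space_def)
  then have "(\<lambda>x. indicator C x * f x) \<in> borel_measurable lebesgue" by (simp add: measurable_lebesgue_on_iff[OF CL])
  then obtain f' where f' [measurable]: "f' \<in> borel_measurable borel" and eq: "AE x in lborel. indicator C x * f x = f' x"
    using completion_ex_borel_measurable_real[of "\<lambda>x. indicator C x * f x" lborel] by auto
  have "ennreal \<bar>LINT u:V h|lebesgue. f (x + u)\<bar> \<le> (\<integral>\<^sup>+u. ennreal \<bar>indicator (V h) u *\<^sub>R f (x + u)\<bar> \<partial>lebesgue)"
    unfolding set_lebesgue_integral_def by (rule abs_integral_le_nn_integral)
  also have "\<dots> = (\<integral>\<^sup>+u. ennreal \<bar>indicator (V h) u *\<^sub>R f (x + u)\<bar> \<partial>lborel)" by (rule nn_integral_completion)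
  also have "\<dots> \<le> (\<integral>\<^sup>+u. ennreal \<bar>f' (u + x)\<bar> \<partial>lborel)"
  proof (rule nn_integral_mono_AE)
    show "AE u in lborel. ennreal \<bar>indicator (V h) u *\<^sub>R f (x + u)\<bar> \<le> ennreal \<bar>f' (u + x)\<bar>"
      using AE_lborel_translation[OF eq, of x]
    proof eventually_elim
      case (elim u)
      show ?case
      proof (cases "u \<in> V h")
        case True
        then have "x + u \<in> C" using add_cone[OF x] by blast
        then show ?thesis using elim True by (simp add: add.commute)
      next
        case False
        then have "indicator (V h) u = (0 :: real)" by (auto simp: indicator_def)
        then show ?thesis by (simp only: scaleR_zero_left) simp
      qed
    qed
  qed
  also have "\<dots> = (\<integral>\<^sup>+z. ennreal \<bar>f' z\<bar> \<partial>lborel)" by (rule nn_integral_translation) measurable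
  also have "\<dots> = (\<integral>\<^sup>+z. ennreal \<bar>f z\<bar> * indicator C z \<partial>lborel)"
    using eq by (intro nn_integral_cong_AE) (auto elim!: eventually_mono split: split_indicator)
  also have "\<dots> = ennreal (Lp_norm 1 C f)" by (rule Lp_1_nn_integral[OF f])
  finally show ?thesis using Lp_norm_finite_nonneg[of 1 C f] by (simp add: ennreal_le_iff one_ereal_def)
qed

lemma avg_norm_h_nonneg: "0 \<le> avg_norm_h C K h f"
  unfolding avg_norm_h_def using cone_nonempty by (auto intro: SUP_upper2)

lemma avg_norm_h_le_L1: "f \<in> Lp_space 1 C \<Longrightarrow> h > 0 \<Longrightarrow> avg_norm_h C K h f \<le> ereal (Lp_norm 1 C f)"
  unfolding avg_norm_h_def using translated_integral_le by (intro SUP_least) auto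

lemma avg_norm_h_le: "h > 0 \<Longrightarrow> avg_norm_h C K h f \<le> avg_norm C K f"
  unfolding avg_norm_def by (intro SUP_upper) auto

lemma avg_norm_nonneg: "0 \<le> avg_norm C K f"
  using avg_norm_h_nonneg[of 1 f] avg_norm_h_le[of 1 f] by simp

lemma avg_norm_le_L1: "f \<in> Lp_space 1 C \<Longrightarrow> avg_norm C K f \<le> ereal (Lp_norm 1 C f)"
  unfolding avg_norm_def using avg_norm_h_le_L1 by (intro SUP_least) auto

abbreviation "grad_norm p f \<equiv> Lp_norm p C (\<lambda>x. N\<^sub>d (weak_gradient C f x))"
abbreviation "g_norm p h \<equiv> Lp_norm (conj_exp p) (V h) (\<lambda>y. g h (N y))"

text \<open>S is an arbitrary real bound on \<open>avg_norm_h\<close>, so that the averaged seminorm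
  at h, its supremum over h and the L_1 norm are all covered by one statement.\<close>

lemma additive_inequality:
  assumes p: "ereal DIM('a) < p" and h: "h > 0" and f: "f \<in> W1p p C" and S: "avg_norm_h C K h f \<le> ereal S"
  shows "f \<in> Lp_space \<infinity> C" "Lp_norm \<infinity> C f \<le> g_norm p h * grad_norm p f + 1 / (\<mu> * h ^ DIM('a)) * S"
proof -
  have avg: "\<bar>LINT u:V h|lebesgue. f (x + u)\<bar> \<le> S" if "x \<in> C" for x
  proof -
    have "ereal \<bar>LINT u:V h|lebesgue. f (x + u)\<bar> \<le> avg_norm_h C K h f"
      unfolding avg_norm_h_def using that by (rule SUP_upper)
    also note S
    finally show ?thesis by simp
  qed
  have CL: "C \<in> sets lebesgue" using open_cone by simp
  have "f \<in> loc_integrable C" using f by (simp add: W1p_def)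
  then have m: "f \<in> borel_measurable (lebesgue_on C)"
    unfolding measurable_lebesgue_on_iff[OF CL] by (rule loc_integrable_measurable[OF open_cone])
  have "AE x in lebesgue. x \<in> C \<longrightarrow> \<bar>f x\<bar> \<le> g_norm p h * grad_norm p f + S / (\<mu> * h ^ DIM('a))"
    by (rule sup_bound[OF p h f avg g_fun_Lp(1)[OF h p]])
  from Lp_infinityI[OF m open_cone cone_nonempty this]
  show "f \<in> Lp_space \<infinity> C" "Lp_norm \<infinity> C f \<le> g_norm p h * grad_norm p f + 1 / (\<mu> * h ^ DIM('a)) * S" by simp_all
qed

text \<open>The closed form of the kernel norm identifies the two additive terms with
  \<open>T\<^sub>1\<close> and \<open>T\<^sub>2\<close>; the two parts together make the
  multiplicative bound the infimum of the additive ones.\<close>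

lemma optimization:
  assumes p: "ereal DIM('a) < p" and S: "S \<ge> 0"
  shows "\<And>h. h > 0 \<Longrightarrow> a_const DIM('a) p * \<mu> powr (- alpha DIM('a) p / DIM('a)) * S powr (1 - alpha DIM('a) p)
      * grad_norm p f powr alpha DIM('a) p \<le> g_norm p h * grad_norm p f + 1 / (\<mu> * h ^ DIM('a)) * S"
    and "(\<And>h. h > 0 \<Longrightarrow> L \<le> g_norm p h * grad_norm p f + 1 / (\<mu> * h ^ DIM('a)) * S) \<Longrightarrow>
      L \<le> a_const DIM('a) p * \<mu> powr (- alpha DIM('a) p / DIM('a)) * S powr (1 - alpha DIM('a) p)
      * grad_norm p f powr alpha DIM('a) p"
proof -
  have dim: "DIM('a) \<ge> 1" by (simp add: Suc_leI)
  note q = recip_exp_bounds[OF dim p]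
  interpret additive_optimization "DIM('a)" "recip_exp p" \<mu> S "grad_norm p f"
    using dim q S measure_section_pos Lp_norm_nonneg[OF open_cone cone_nonempty] by unfold_locales auto
  have T: "T\<^sub>1 h + T\<^sub>2 h = g_norm p h * grad_norm p f + 1 / (\<mu> * h ^ DIM('a)) * S" if "h > 0" for h
    unfolding T\<^sub>1_def T\<^sub>2_def \<gamma>_def g_fun_Lp(2)[OF that p] by (rule refl)
  have R: "R = a_const DIM('a) p * \<mu> powr (- alpha DIM('a) p / DIM('a)) * S powr (1 - alpha DIM('a) p)
      * grad_norm p f powr alpha DIM('a) p"
    unfolding R_def a_const_eq_recip[OF dim p] alpha_eq_recip[OF dim p] by (rule refl)
  show "a_const DIM('a) p * \<mu> powr (- alpha DIM('a) p / DIM('a)) * S powr (1 - alpha DIM('a) p)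
      * grad_norm p f powr alpha DIM('a) p \<le> g_norm p h * grad_norm p f + 1 / (\<mu> * h ^ DIM('a)) * S" if "h > 0" for h
    using multiplicative_le[OF that] unfolding R T[OF that] .
  show "L \<le> a_const DIM('a) p * \<mu> powr (- alpha DIM('a) p / DIM('a)) * S powr (1 - alpha DIM('a) p)
      * grad_norm p f powr alpha DIM('a) p"
    if "\<And>h. h > 0 \<Longrightarrow> L \<le> g_norm p h * grad_norm p f + 1 / (\<mu> * h ^ DIM('a)) * S"
    using le_multiplicative[of L] that T unfolding R by simp
qed

lemma L_avg_h_finite: "f \<in> L_avg_h C K h \<Longrightarrow> avg_norm_h C K h f = ereal (real_of_ereal (avg_norm_h C K h f))"
  using avg_norm_h_nonneg[of h f] by (cases "avg_norm_h C K h f") (auto simp: L_avg_h_def)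

lemma L_avg_finite: "f \<in> L_avg C K \<Longrightarrow> avg_norm C K f = ereal (real_of_ereal (avg_norm C K f))"
  using avg_norm_nonneg[of f] by (cases "avg_norm C K f") (auto simp: L_avg_def)

end

section \<open>Equality for the extremal function\<close>

context extremal_function
begin

lemma F_nn_integral:
  assumes "0 \<le> u" shows "ennreal (F u) = (\<integral>\<^sup>+t. ennreal (w t) * indicator {u<..<h} t \<partial>lborel)"
proof -
  have int: "integrable lborel (\<lambda>t. indicator {u<..<h} t *\<^sub>R w t)"
    using w_integrable_sub[OF assms order_refl] by (simp add: set_integrable_def)
  have "ennreal (F u) = (\<integral>\<^sup>+t. ennreal (indicator {u<..<h} t *\<^sub>R w t) \<partial>lborel)"
    unfolding F_def set_lebesgue_integral_def
    by (rule nn_integral_eq_integral[OF int, symmetric]) (simp add: w_nonneg)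
  also have "\<dots> = (\<integral>\<^sup>+t. ennreal (w t) * indicator {u<..<h} t \<partial>lborel)"
    by (intro nn_integral_cong) (simp split: split_indicator)
  finally show ?thesis .
qed

text \<open>Layer cake: for y in C, \<open>fe y\<close> is the integral of w over the t in (0, h)
  with N y < t, and for fixed t these y fill a section of measure \<mu> t^d = \<mu> h^d (t /
  h)^d.\<close>

lemma fe_nn_integral:
  "(\<integral>\<^sup>+y. ennreal (fe y) \<partial>lborel) = ennreal (\<mu> * h ^ DIM('a)) * (\<integral>\<^sup>+t. ennreal ((t / h) ^ DIM('a) * w t) * indicator {0<..<h} t \<partial>lborel)"
proof -
  have "(\<integral>\<^sup>+y. ennreal (fe y) \<partial>lborel) = (\<integral>\<^sup>+y. \<integral>\<^sup>+t. ennreal (w t) * indicator {0<..<h} t * indicator {y\<in>C. N y < t} y \<partial>lborel \<partial>lborel)"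
  proof (rule nn_integral_cong)
    fix y :: 'a
    show "ennreal (fe y) = (\<integral>\<^sup>+t. ennreal (w t) * indicator {0<..<h} t * indicator {y\<in>C. N y < t} y \<partial>lborel)"
    proof (cases "y \<in> C")
      case True
      have "ennreal (fe y) = (\<integral>\<^sup>+t. ennreal (w t) * indicator {N y<..<h} t \<partial>lborel)"
        using True by (simp add: fe_eq F_nn_integral)
      also have "\<dots> = (\<integral>\<^sup>+t. ennreal (w t) * indicator {0<..<h} t * indicator {y\<in>C. N y < t} y \<partial>lborel)"
      proof (rule nn_integral_cong)
        fix t :: real
        have "t \<in> {N y<..<h} \<longleftrightarrow> t \<in> {0<..<h} \<and> y \<in> {y\<in>C. N y < t}"
          using True le_less_trans[OF body_norm_nonneg[of y], of t] by auto
        then show "ennreal (w t) * indicator {N y<..<h} t = ennreal (w t) * indicator {0<..<h} t * indicator {y\<in>C. N y < t} y"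
          by (simp add: indicator_def)
      qed
      finally show ?thesis .
    qed (simp add: fe_eq_indicator)
  qed
  also have "\<dots> = (\<integral>\<^sup>+t. \<integral>\<^sup>+y. ennreal (w t) * indicator {0<..<h} t * indicator {y\<in>C. N y < t} y \<partial>lborel \<partial>lborel)"
  proof (rule lborel_pair.Fubini')
    show "(\<lambda>(t, y). ennreal (w t) * indicator {0<..<h} t * indicator {y\<in>C. N y < t} y) \<in> borel_measurable (lborel \<Otimes>\<^sub>M lborel)"
      unfolding indicator_def split_beta by measurable
  qed
  also have "\<dots> = (\<integral>\<^sup>+t. ennreal (\<mu> * h ^ DIM('a)) * (ennreal ((t / h) ^ DIM('a) * w t) * indicator {0<..<h} t) \<partial>lborel)"
  proof (rule nn_integral_cong)
    fix t :: real
    show "(\<integral>\<^sup>+y. ennreal (w t) * indicator {0<..<h} t * indicator {y\<in>C. N y < t} y \<partial>lborel)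
      = ennreal (\<mu> * h ^ DIM('a)) * (ennreal ((t / h) ^ DIM('a) * w t) * indicator {0<..<h} t)"
    proof (cases "t \<in> {0<..<h}")
      case True
      then have t: "t > 0" by simp
      have "(\<integral>\<^sup>+y. ennreal (w t) * indicator {0<..<h} t * indicator {y\<in>C. N y < t} y \<partial>lborel) = ennreal (w t) * emeasure lborel {y\<in>C. N y < t}"
        using True by (simp add: nn_integral_cmult)
      also have "emeasure lborel {y\<in>C. N y < t} = ennreal (\<mu> * t ^ DIM('a))"
        using emeasure_section[OF t] by (simp add: section_eq[OF t])
      also have "ennreal (w t) * ennreal (\<mu> * t ^ DIM('a)) = ennreal (w t * (\<mu> * t ^ DIM('a)))"
        by (rule ennreal_mult'[OF w_nonneg, symmetric])
      also have "w t * (\<mu> * t ^ DIM('a)) = \<mu> * h ^ DIM('a) * ((t / h) ^ DIM('a) * w t)"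
        using h by (simp add: power_divide)
      also have "ennreal \<dots> = ennreal (\<mu> * h ^ DIM('a)) * ennreal ((t / h) ^ DIM('a) * w t)"
        using h measure_section_pos by (intro ennreal_mult') simp
      finally show ?thesis using True by simp
    qed simp
  qed
  also have "\<dots> = ennreal (\<mu> * h ^ DIM('a)) * (\<integral>\<^sup>+t. ennreal ((t / h) ^ DIM('a) * w t) * indicator {0<..<h} t \<partial>lborel)"
    by (rule nn_integral_cmult) measurable
  finally show ?thesis .
qed

text \<open>Splitting w into (1 - (t / h)^d) w + (t / h)^d w under the integral for F 0 gives I from
  the first part and, by the layer cake formula, the normalized L_1 norm from the second.\<close>

lemma fe_L1: "fe \<in> Lp_space 1 C" "F 0 = I + 1 / (\<mu> * h ^ DIM('a)) * Lp_norm 1 C fe"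
proof -
  define m where "m = \<mu> * h ^ DIM('a)"
  have m: "m > 0" using measure_section_pos h by (simp add: m_def)
  define E where "E = (\<integral>\<^sup>+t. ennreal ((t / h) ^ DIM('a) * w t) * indicator {0<..<h} t \<partial>lborel)"
  have "ennreal (F 0) = (\<integral>\<^sup>+t. ennreal ((1 - (t / h) ^ DIM('a)) * w t) * indicator {0<..<h} t + ennreal ((t / h) ^ DIM('a) * w t) * indicator {0<..<h} t \<partial>lborel)"
    unfolding F_nn_integral[OF order_refl]
  proof (rule nn_integral_cong)
    fix t :: real
    show "ennreal (w t) * indicator {0<..<h} t = ennreal ((1 - (t / h) ^ DIM('a)) * w t) * indicator {0<..<h} t + ennreal ((t / h) ^ DIM('a) * w t) * indicator {0<..<h} t"
    proof (cases "t \<in> {0<..<h}")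
      case True
      then have "0 \<le> (1 - (t / h) ^ DIM('a)) * w t" "0 \<le> (t / h) ^ DIM('a) * w t"
        using power_ratio_bounds[of t] w_nonneg[of t] by auto
      from ennreal_plus[OF this] True show ?thesis by (simp add: algebra_simps)
    qed simp
  qed
  also have "\<dots> = ennreal I + E"
    unfolding E_def nn_integral_I[symmetric] by (rule nn_integral_add) measurable
  finally have eq: "ennreal (F 0) = ennreal I + E" .
  then have "E \<noteq> top" by (metis ennreal_add_eq_top ennreal_neq_top)
  then obtain e where e: "e \<ge> 0" "E = ennreal e" by (cases E) auto
  have F0: "F 0 = I + e"
    using eq e I_pos F_nonneg[of 0] by (simp add: ennreal_plus[symmetric] del: ennreal_plus)
  have CL: "C \<in> sets lebesgue" using open_cone by simp
  have L: "(\<integral>\<^sup>+y. ennreal \<bar>fe y\<bar> * indicator C y \<partial>lborel) = ennreal (m * e)"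
  proof -
    have "(\<integral>\<^sup>+y. ennreal \<bar>fe y\<bar> * indicator C y \<partial>lborel) = (\<integral>\<^sup>+y. ennreal (fe y) \<partial>lborel)"
      using fe_bounds(1) by (intro nn_integral_cong) (simp add: fe_eq_indicator split: split_indicator)
    also have "\<dots> = ennreal m * ennreal e" unfolding fe_nn_integral E_def[symmetric] e(2) m_def by (rule refl)
    finally show ?thesis using m e by (simp add: ennreal_mult)
  qed
  have "fe \<in> Lp_space (ereal 1) C"
  proof (rule Lp_finiteI(1)[OF _ _ CL, of _ _ "m * e"])
    show "fe \<in> borel_measurable (lebesgue_on C)"
      by (intro measurable_restrict_space1 measurable_completion) simp
    show "(\<integral>\<^sup>+x. ennreal (\<bar>fe x\<bar> powr 1) * indicator C x \<partial>lebesgue) \<le> ennreal ((m * e) powr 1)"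
      using L m e by (simp add: nn_integral_completion)
  qed (use m e in auto)
  then show mem: "fe \<in> Lp_space 1 C" by (simp add: one_ereal_def)
  have "ennreal (Lp_norm 1 C fe) = ennreal (m * e)" using Lp_1_nn_integral[OF mem] L by simp
  then have "Lp_norm 1 C fe = m * e"
    using m e Lp_norm_finite_nonneg[of 1 C fe] by (simp add: one_ereal_def)
  then show "F 0 = I + 1 / (\<mu> * h ^ DIM('a)) * Lp_norm 1 C fe"
    using F0 m by (simp add: m_def[symmetric])
qed

text \<open>On each section V e, which has positive measure, \<open>fe\<close> is at least F e; then
  e tends to 0, and F e tends to F 0.\<close>

lemma fe_sup_ge: assumes "fe \<in> Lp_space \<infinity> C" shows "F 0 \<le> Lp_norm \<infinity> C fe"
proof -
  let ?L = "Lp_norm \<infinity> C fe"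
  have L: "AE y in lborel. y \<in> C \<longrightarrow> \<bar>fe y\<bar> \<le> ?L"
    using Lp_infinity_AE[OF assms open_cone cone_nonempty] by (simp add: AE_lebesgue_iff)
  have "F e \<le> ?L" if e: "e > 0" for e
  proof (rule ccontr)
    assume not: "\<not> F e \<le> ?L"
    have "AE y in lborel. y \<notin> V e"
      using L
    proof eventually_elim
      case (elim y)
      show ?case
      proof
        assume y: "y \<in> V e"
        then have "y \<in> C" "N y < e" using section_iff[OF e] by blast+
        then show False using elim F_antimono[of "N y" e] not F_nonneg[of "N y"] by (simp add: fe_eq)
      qed
    qed
    moreover have Ve: "V e \<in> sets borel" by (rule section_borel[OF e])
    ultimately have "emeasure lborel (V e) = 0" by (subst (asm) AE_iff_measurable[of "V e"]) auto
    then show False using emeasure_section[OF e] measure_section_pos e by simp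
  qed
  then show ?thesis by (intro LIMSEQ_le_const2[OF F_tendsto_0]) auto
qed

text \<open>The equality case of Hoelder's inequality in numbers: conjugacy means s = 1 + s q with q
  = 1 / p, so X times (X^s)^q is X^s.\<close>

lemma g_norm_times_I: "X * I powr recip_exp p = I"
proof -
  have "X \<noteq> 0" using I_pos by (auto simp: I_def)
  then have X: "X > 0" using Lp_norm_finite_nonneg[of s "V h" "\<lambda>y. g h (N y)"] by linarith
  have "s = 1 + s * recip_exp p" using q_bounds(3) by (simp add: s_recip field_simps)
  then have "X powr s = X powr (1 + s * recip_exp p)" by (rule arg_cong)
  also have "\<dots> = X * I powr recip_exp p" using X by (simp add: I_def powr_add powr_powr)
  finally show ?thesis by (simp add: I_def)
qed

text \<open>The right-hand side at \<open>fe\<close> is at most \<open>F 0\<close> and the left-hand side at least \<open>F 0\<close>, so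
  equality holds whichever quantity between \<open>avg_norm_h\<close> and the \<open>L\<^sub>1\<close> norm is used.\<close>

lemma fe_equality:
  assumes S: "avg_norm_h C K h fe \<le> ereal S" "S \<le> Lp_norm 1 C fe"
  shows "Lp_norm \<infinity> C fe = F 0" "g_norm p h * grad_norm p fe + 1 / (\<mu> * h ^ DIM('a)) * S = F 0"
proof -
  note ineq = additive_inequality[OF p h fe_W1p S(1)]
  have "X * grad_norm p fe \<le> X * I powr recip_exp p"
    by (intro mult_left_mono gradient_norm_le Lp_norm_finite_nonneg)
  moreover have "1 / (\<mu> * h ^ DIM('a)) * S \<le> 1 / (\<mu> * h ^ DIM('a)) * Lp_norm 1 C fe"
    using S(2) measure_section_pos h by (intro mult_left_mono) auto
  ultimately have "X * grad_norm p fe + 1 / (\<mu> * h ^ DIM('a)) * S \<le> F 0"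
    using fe_L1(2) g_norm_times_I by linarith
  with ineq(2) fe_sup_ge[OF ineq(1)]
  show "Lp_norm \<infinity> C fe = F 0" "g_norm p h * grad_norm p fe + 1 / (\<mu> * h ^ DIM('a)) * S = F 0"
    by linarith+
qed

lemma fe_avg:
  "fe \<in> L_avg_h C K h" "fe \<in> L_avg C K"
  "real_of_ereal (avg_norm_h C K h fe) \<le> Lp_norm 1 C fe" "real_of_ereal (avg_norm C K fe) \<le> Lp_norm 1 C fe"
proof -
  have le: "avg_norm_h C K h fe \<le> ereal (Lp_norm 1 C fe)" "avg_norm C K fe \<le> ereal (Lp_norm 1 C fe)"
    using avg_norm_h_le_L1[OF fe_L1(1) h] avg_norm_le_L1[OF fe_L1(1)] by auto
  then show m: "fe \<in> L_avg_h C K h" "fe \<in> L_avg C K"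
    using fe_loc_integrable by (auto simp: L_avg_h_def L_avg_def le_less_trans)
  show "real_of_ereal (avg_norm_h C K h fe) \<le> Lp_norm 1 C fe" using le(1) L_avg_h_finite[OF m(1)] by (metis ereal_less_eq(3))
  show "real_of_ereal (avg_norm C K fe) \<le> Lp_norm 1 C fe" using le(2) L_avg_finite[OF m(2)] by (metis ereal_less_eq(3))
qed

end

theorem theorem2:
  fixes C K :: "'a::euclidean_space set" and p :: ereal
  assumes C: "open_convex_cone C"
    and K: "bounded K" "open K" "convex K" "\<forall>x\<in>K. - x \<in> K" "0 \<in> interior K"
    and p: "ereal (real DIM('a)) < p"
  defines "d \<equiv> DIM('a)"
    and "p' \<equiv> conj_exp p"
    and "\<mu> \<equiv> measure lebesgue (K \<inter> C)"
    and "\<alpha> \<equiv> alpha DIM('a) p"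
    and "a \<equiv> a_const DIM('a) p"
    and "G \<equiv> (\<lambda>h y. g_fun C K h (body_norm K y))"
    and "D \<equiv> (\<lambda>f. Lp_norm p C (\<lambda>x. dual_body_norm K (weak_gradient C f x)))"
    and "fe \<equiv> f_ext C K p"
  shows "
    \<comment> \<open>(i)\<close>
    (\<forall>h>0.
      G h \<in> Lp_space p' ((*\<^sub>R) h ` K \<inter> C) \<and>
      (\<forall>f \<in> W1p p C \<inter> L_avg_h C K h.
         f \<in> Lp_space \<infinity> C \<and>
         Lp_norm \<infinity> C f
           \<le> Lp_norm p' ((*\<^sub>R) h ` K \<inter> C) (G h) * D f
             + 1 / (\<mu> * h ^ d) * real_of_ereal (avg_norm_h C K h f)) \<and>
      fe h \<in> W1p p C \<inter> L_avg_h C K h \<and>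
      Lp_norm \<infinity> C (fe h) \<noteq> 0 \<and>
      Lp_norm \<infinity> C (fe h)
        = Lp_norm p' ((*\<^sub>R) h ` K \<inter> C) (G h) * D (fe h)
          + 1 / (\<mu> * h ^ d) * real_of_ereal (avg_norm_h C K h (fe h))) \<and>
    \<comment> \<open>(ii)\<close>
    (\<forall>f \<in> W1p p C \<inter> L_avg C K.
      f \<in> Lp_space \<infinity> C \<and>
      Lp_norm \<infinity> C f
        \<le> a * \<mu> powr (- \<alpha> / d) * real_of_ereal (avg_norm C K f) powr (1 - \<alpha>)
          * D f powr \<alpha>) \<and>
    (\<forall>h>0.
      fe h \<in> W1p p C \<inter> L_avg C K \<and>
      Lp_norm \<infinity> C (fe h) \<noteq> 0 \<and>
      Lp_norm \<infinity> C (fe h)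
        = a * \<mu> powr (- \<alpha> / d) * real_of_ereal (avg_norm C K (fe h)) powr (1 - \<alpha>)
          * D (fe h) powr \<alpha>) \<and>
    \<comment> \<open>(iii)\<close>
    (\<forall>f \<in> W1p p C \<inter> Lp_space 1 C.
      f \<in> Lp_space \<infinity> C \<and>
      (\<forall>h>0. Lp_norm \<infinity> C f
         \<le> Lp_norm p' ((*\<^sub>R) h ` K \<inter> C) (G h) * D f
           + 1 / (\<mu> * h ^ d) * Lp_norm 1 C f) \<and>
      Lp_norm \<infinity> C f
        \<le> a * \<mu> powr (- \<alpha> / d) * Lp_norm 1 C f powr (1 - \<alpha>) * D f powr \<alpha>) \<and>
    (\<forall>h>0.
      fe h \<in> W1p p C \<inter> Lp_space 1 C \<and>
      Lp_norm \<infinity> C (fe h) \<noteq> 0 \<and>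
      Lp_norm \<infinity> C (fe h)
        = Lp_norm p' ((*\<^sub>R) h ` K \<inter> C) (G h) * D (fe h)
          + 1 / (\<mu> * h ^ d) * Lp_norm 1 C (fe h) \<and>
      Lp_norm \<infinity> C (fe h)
        = a * \<mu> powr (- \<alpha> / d) * Lp_norm 1 C (fe h) powr (1 - \<alpha>) * D (fe h) powr \<alpha>)"
proof -
  have zero: "0 \<in> K" using K(5) interior_subset by blast
  interpret cone_body K C using K zero C by unfold_locales auto
  have dim: "DIM('a) = d" by (simp add: d_def)
  have ext: "extremal_function K C p h" if "h > 0" for h using p that by unfold_locales
  have i: "\<forall>f \<in> W1p p C \<inter> L_avg_h C K h. f \<in> Lp_space \<infinity> C \<and>
      Lp_norm \<infinity> C f \<le> Lp_norm p' ((*\<^sub>R) h ` K \<inter> C) (G h) * D f + 1 / (\<mu> * h ^ d) * real_of_ereal (avg_norm_h C K h f)"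
    if h: "h > 0" for h
    \<comment> \<open>Finiteness of the seminorm lets its real value serve as the bound S.\<close>
    using additive_inequality[OF p h _ eq_refl[OF L_avg_h_finite]] by (auto simp: assms)
  have ii: "\<forall>f \<in> W1p p C \<inter> L_avg C K. f \<in> Lp_space \<infinity> C \<and>
      Lp_norm \<infinity> C f \<le> a * \<mu> powr (- \<alpha> / d) * real_of_ereal (avg_norm C K f) powr (1 - \<alpha>) * D f powr \<alpha>"
  proof
    fix f assume f: "f \<in> W1p p C \<inter> L_avg C K"
    have S: "avg_norm_h C K h f \<le> ereal (real_of_ereal (avg_norm C K f))" if "h > 0" for h
      using avg_norm_h_le[OF that, of f] f L_avg_finite[of f] by simp
    show "f \<in> Lp_space \<infinity> C \<and>
      Lp_norm \<infinity> C f \<le> a * \<mu> powr (- \<alpha> / d) * real_of_ereal (avg_norm C K f) powr (1 - \<alpha>) * D f powr \<alpha>"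
      unfolding a_def \<mu>_def \<alpha>_def D_def d_def
      using f additive_inequality[OF p _ _ S] real_of_ereal_pos[OF avg_norm_nonneg]
      by (intro conjI optimization(2)[OF p]) (auto intro: zero_less_one)
  qed
  have iii: "\<forall>f \<in> W1p p C \<inter> Lp_space 1 C. f \<in> Lp_space \<infinity> C \<and>
      (\<forall>h>0. Lp_norm \<infinity> C f \<le> Lp_norm p' ((*\<^sub>R) h ` K \<inter> C) (G h) * D f + 1 / (\<mu> * h ^ d) * Lp_norm 1 C f) \<and>
      Lp_norm \<infinity> C f \<le> a * \<mu> powr (- \<alpha> / d) * Lp_norm 1 C f powr (1 - \<alpha>) * D f powr \<alpha>"
  proof
    fix f assume f: "f \<in> W1p p C \<inter> Lp_space 1 C"
    have S: "avg_norm_h C K h f \<le> ereal (Lp_norm 1 C f)" if "h > 0" for h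
      using avg_norm_h_le_L1 f that by simp
    show "f \<in> Lp_space \<infinity> C \<and>
      (\<forall>h>0. Lp_norm \<infinity> C f \<le> Lp_norm p' ((*\<^sub>R) h ` K \<inter> C) (G h) * D f + 1 / (\<mu> * h ^ d) * Lp_norm 1 C f) \<and>
      Lp_norm \<infinity> C f \<le> a * \<mu> powr (- \<alpha> / d) * Lp_norm 1 C f powr (1 - \<alpha>) * D f powr \<alpha>"
      unfolding a_def \<mu>_def \<alpha>_def D_def d_def G_def p'_def
      using f additive_inequality[OF p _ _ S] Lp_norm_nonneg[OF open_cone cone_nonempty]
      by (intro conjI allI impI optimization(2)[OF p]) (auto intro: zero_less_one)
  qed
  \<comment> \<open>The additive equality is recorded also for \<open>avg_norm\<close>, because the
    sharpness in (ii) is derived from it.\<close>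
  have sharp: "fe h \<in> W1p p C \<inter> L_avg_h C K h \<inter> L_avg C K \<inter> Lp_space 1 C" "Lp_norm \<infinity> C (fe h) \<noteq> 0"
    and additive: "\<And>S. S \<in> {real_of_ereal (avg_norm_h C K h (fe h)), real_of_ereal (avg_norm C K (fe h)), Lp_norm 1 C (fe h)} \<Longrightarrow>
      Lp_norm \<infinity> C (fe h) = Lp_norm p' ((*\<^sub>R) h ` K \<inter> C) (G h) * D (fe h) + 1 / (\<mu> * h ^ d) * S"
    if h: "h > 0" for h
  proof -
    interpret extremal_function K C p h by (rule ext[OF h])
    show "fe h \<in> W1p p C \<inter> L_avg_h C K h \<inter> L_avg C K \<inter> Lp_space 1 C"
      using fe_W1p fe_avg fe_L1 by (simp add: fe_def)
    show "Lp_norm \<infinity> C (fe h) \<noteq> 0"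
      using fe_equality(1)[OF avg_norm_h_le_L1[OF fe_L1(1) h] order_refl] F_pos by (simp add: fe_def)
    fix S assume "S \<in> {real_of_ereal (avg_norm_h C K h (fe h)), real_of_ereal (avg_norm C K (fe h)), Lp_norm 1 C (fe h)}"
    then have "avg_norm_h C K h (f_ext C K p h) \<le> ereal S \<and> S \<le> Lp_norm 1 C (f_ext C K p h)"
      using fe_avg avg_norm_h_le_L1[OF fe_L1(1) h] avg_norm_h_le[OF h, of "f_ext C K p h"]
        L_avg_h_finite[OF fe_avg(1)] L_avg_finite[OF fe_avg(2)] by (auto simp: fe_def)
    then show "Lp_norm \<infinity> C (fe h) = Lp_norm p' ((*\<^sub>R) h ` K \<inter> C) (G h) * D (fe h) + 1 / (\<mu> * h ^ d) * S"
      using fe_equality[of S] by (simp add: fe_def p'_def G_def D_def \<mu>_def d_def)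
  qed
  have multiplicative: "Lp_norm \<infinity> C (fe h) = a * \<mu> powr (- \<alpha> / d) * S powr (1 - \<alpha>) * D (fe h) powr \<alpha>"
    if h: "h > 0" and S: "S \<in> {real_of_ereal (avg_norm C K (fe h)), Lp_norm 1 C (fe h)}" for h S
  \<comment> \<open>For the lower bound: the multiplicative bound is at most the additive one at
    every h, in particular at the h of \<open>fe h\<close>, where the additive bound equals the
    supremum norm.\<close>
  proof (rule antisym)
    show "Lp_norm \<infinity> C (fe h) \<le> a * \<mu> powr (- \<alpha> / d) * S powr (1 - \<alpha>) * D (fe h) powr \<alpha>"
      using S sharp(1)[OF h] ii iii by auto
    have "S \<ge> 0" using S real_of_ereal_pos[OF avg_norm_nonneg] Lp_norm_nonneg[OF open_cone cone_nonempty] by auto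
    from optimization(1)[OF p this h, of "fe h"] additive[OF h, of S] S
    show "a * \<mu> powr (- \<alpha> / d) * S powr (1 - \<alpha>) * D (fe h) powr \<alpha> \<le> Lp_norm \<infinity> C (fe h)"
      by (auto simp: assms)
  qed
  have G: "G h \<in> Lp_space p' ((*\<^sub>R) h ` K \<inter> C)" if "h > 0" for h
    using g_fun_Lp(1)[OF that p] by (simp add: G_def p'_def)
  show ?thesis
    using G i ii iii sharp additive multiplicative by simp
qed

end
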